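(* Let $G$ be a finite group, let $\sigma=\{\sigma_i\mid i\in I\}$ be a partition of the set $\mathbb{P}$ of all primes, and consider the following two conditions on a pair of subgroups $D$, $M$ of $G$: (i) $G=D\rtimes M$ (with $D$ normal in $G$), where $D$ is an abelian Hall subgroup of $G$ of odd order, $M$ is $\sigma$-nilpotent, and every element of $G$ induces (by conjugation) a power automorphism in $D$; (ii) for all $i\in I$, $O_{\sigma_i}(D)$ has a normal complement in a Hall $\sigma_i$-subgroup of $G$. If $G$ is a $\sigma$-soluble $P\sigma T$-group, then for $D=G^{\mathfrak{N}_\sigma}$ (the $\sigma$-nilpotent residual of $G$) and some subgroup $M$ of $G$ conditions (i) and (ii) hold. Conversely, if conditions (i) and (ii) hold for some subgroups $D$ and $M$ of $G$, then $G$ is a $P\sigma T$-group.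
   Context: All groups are finite. For an integer $n$, $\pi(n)$ is the set of primes dividing $n$. $\sigma=\{\sigma_i\mid i\in I\}$ is a partition of the set of all primes $\mathbb{P}$, $\sigma(n)=\{\sigma_i\mid \sigma_i\cap\pi(n)\neq\emptyset\}$ and $\sigma(G)=\sigma(|G|)$. A $\sigma_i$-group is a group all of whose order's prime divisors lie in $\sigma_i$; a group is $\sigma$-primary if it is a $\sigma_i$-group for some $i$. $G$ is $\sigma$-soluble if every chief factor of $G$ is $\sigma$-primary; $G$ is $\sigma$-nilpotent if $G=G_1\times\cdots\times G_n$ for some $\sigma$-primary groups $G_1,\dots,G_n$. $G^{\mathfrak{N}_\sigma}$, the $\sigma$-nilpotent residual of $G$, is the intersection of all normal subgroups $N$ of $G$ with $G/N$ $\sigma$-nilpotent. $O_{\sigma_i}(D)$ is the largest normal $\sigma_i$-subgroup of $D$. A power automorphism of $D$ is an automorphism mapping every subgroup of $D$ onto itself. A complete Hall $\sigma$-set of $G$ is a set $\mathcal{H}$ of subgroups of $G$ such that every member $\neq 1$ of $\mathcal{H}$ is a Hall $\sigma_i$-subgroup of $G$ for some $\sigma_i\in\sigma$ and $\mathcal{H}$ contains exactly one Hall $\sigma_i$-subgroup of $G$ for every $\sigma_i\in\sigma(G)$. A subgroup $A$ of $G$ is $\sigma$-permutable in $G$ if $G$ possesses a complete Hall $\sigma$-set and $AH=HA$ for every Hall $\sigma_i$-subgroup $H$ of $G$ and all $i\in I$. $G$ is a $P\sigma T$-group if $\sigma$-permutability is transitive in $G$: whenever $K$ is a $\sigma$-permutable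 subgroup of $H$ and $H$ is a $\sigma$-permutable subgroup of $G$, then $K$ is a $\sigma$-permutable subgroup of $G$. *)

theory Defs
  imports "HOL-Algebra.Algebra" "HOL-Computational_Algebra.Primes" "HOL-Library.Disjoint_Sets"
begin

(* A partition sigma of the set of primes is the set of its classes,
   partition_on {p. Factorial_Ring.prime p} \<sigma>; "for all i in I" is rendered "for all \<pi> \<in> \<sigma>".
   A subgroup H of G, regarded as a group, is G\<lparr>carrier := H\<rparr>. *)

definition pi_group :: "nat set \<Rightarrow> ('a, 'b) monoid_scheme \<Rightarrow> bool" where
  "pi_group \<pi> G \<longleftrightarrow> group G \<and> finite (carrier G) \<and> prime_factors (order G) \<subseteq> \<pi>"

definition sigma_of_group :: "nat set set \<Rightarrow> ('a, 'b) monoid_scheme \<Rightarrow> nat set set" where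
  "sigma_of_group \<sigma> G = {\<pi> \<in> \<sigma>. \<pi> \<inter> prime_factors (order G) \<noteq> {}}"

definition sigma_primary :: "nat set set \<Rightarrow> ('a, 'b) monoid_scheme \<Rightarrow> bool" where
  "sigma_primary \<sigma> G \<longleftrightarrow> (\<exists>\<pi>\<in>\<sigma>. pi_group \<pi> G)"

definition chief_factor :: "('a, 'b) monoid_scheme \<Rightarrow> 'a set \<Rightarrow> 'a set \<Rightarrow> bool" where
  "chief_factor G H K \<longleftrightarrow>
     H \<lhd> G \<and> K \<lhd> G \<and> K \<subset> H \<and> \<not> (\<exists>L. L \<lhd> G \<and> K \<subset> L \<and> L \<subset> H)"

definition sigma_soluble :: "nat set set \<Rightarrow> ('a, 'b) monoid_scheme \<Rightarrow> bool" where
  "sigma_soluble \<sigma> G \<longleftrightarrow>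
     (\<forall>H K. chief_factor G H K \<longrightarrow> sigma_primary \<sigma> (G\<lparr>carrier := H\<rparr> Mod K))"

(* Taking the direct factors on the type of elements of G is no restriction:
   each factor is isomorphic to a subgroup of G. *)
definition sigma_nilpotent :: "nat set set \<Rightarrow> ('a, 'b) monoid_scheme \<Rightarrow> bool" where
  "sigma_nilpotent \<sigma> G \<longleftrightarrow>
     (\<exists>(n::nat) (F :: nat \<Rightarrow> 'a monoid).
        (\<forall>i<n. sigma_primary \<sigma> (F i)) \<and> G \<cong> product_group {..<n} F)"

definition sigma_nilpotent_residual :: "nat set set \<Rightarrow> ('a, 'b) monoid_scheme \<Rightarrow> 'a set" where
  "sigma_nilpotent_residual \<sigma> G = \<Inter>{N. N \<lhd> G \<and> sigma_nilpotent \<sigma> (G Mod N)}"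

(* "Largest" is with respect to inclusion. *)
definition pi_core :: "nat set \<Rightarrow> ('a, 'b) monoid_scheme \<Rightarrow> 'a set" where
  "pi_core \<pi> G = (GREATEST N. N \<lhd> G \<and> pi_group \<pi> (G\<lparr>carrier := N\<rparr>))"

definition power_automorphism :: "('a, 'b) monoid_scheme \<Rightarrow> ('a \<Rightarrow> 'a) \<Rightarrow> bool" where
  "power_automorphism G f \<longleftrightarrow> f \<in> auto G \<and> (\<forall>K. subgroup K G \<longrightarrow> f ` K = K)"

definition hall_subgroup :: "('a, 'b) monoid_scheme \<Rightarrow> 'a set \<Rightarrow> bool" where
  "hall_subgroup G H \<longleftrightarrow> subgroup H G \<and> coprime (card H) (card (rcosets\<^bsub>G\<^esub> H))"

definition hall_pi_subgroup :: "nat set \<Rightarrow> ('a, 'b) monoid_scheme \<Rightarrow> 'a set \<Rightarrow> bool" where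
  "hall_pi_subgroup \<pi> G H \<longleftrightarrow>
     subgroup H G \<and> pi_group \<pi> (G\<lparr>carrier := H\<rparr>) \<and>
     prime_factors (card (rcosets\<^bsub>G\<^esub> H)) \<inter> \<pi> = {}"

definition complete_hall_sigma_set ::
    "nat set set \<Rightarrow> ('a, 'b) monoid_scheme \<Rightarrow> 'a set set \<Rightarrow> bool" where
  "complete_hall_sigma_set \<sigma> G \<H> \<longleftrightarrow>
     (\<forall>H\<in>\<H>. subgroup H G) \<and>
     (\<forall>H\<in>\<H>. H \<noteq> {\<one>\<^bsub>G\<^esub>} \<longrightarrow> (\<exists>\<pi>\<in>\<sigma>. hall_pi_subgroup \<pi> G H)) \<and>
     (\<forall>\<pi>\<in>sigma_of_group \<sigma> G. \<exists>!H. H \<in> \<H> \<and> hall_pi_subgroup \<pi> G H)"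

definition sigma_permutable :: "nat set set \<Rightarrow> ('a, 'b) monoid_scheme \<Rightarrow> 'a set \<Rightarrow> bool" where
  "sigma_permutable \<sigma> G A \<longleftrightarrow>
     subgroup A G \<and> (\<exists>\<H>. complete_hall_sigma_set \<sigma> G \<H>) \<and>
     (\<forall>\<pi>\<in>\<sigma>. \<forall>H. hall_pi_subgroup \<pi> G H \<longrightarrow> A <#>\<^bsub>G\<^esub> H = H <#>\<^bsub>G\<^esub> A)"

definition PsigmaT_group :: "nat set set \<Rightarrow> ('a, 'b) monoid_scheme \<Rightarrow> bool" where
  "PsigmaT_group \<sigma> G \<longleftrightarrow>
     (\<forall>H K. sigma_permutable \<sigma> (G\<lparr>carrier := H\<rparr>) K \<and> sigma_permutable \<sigma> G H
        \<longrightarrow> sigma_permutable \<sigma> G K)"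

definition complement_in :: "('a, 'b) monoid_scheme \<Rightarrow> 'a set \<Rightarrow> 'a set \<Rightarrow> bool" where
  "complement_in G A B \<longleftrightarrow>
     subgroup A G \<and> subgroup B G \<and> A <#>\<^bsub>G\<^esub> B = carrier G \<and> A \<inter> B = {\<one>\<^bsub>G\<^esub>}"

definition inner_semidirect :: "('a, 'b) monoid_scheme \<Rightarrow> 'a set \<Rightarrow> 'a set \<Rightarrow> bool" where
  "inner_semidirect G D M \<longleftrightarrow> D \<lhd> G \<and> complement_in G D M"

definition condition_i ::
    "nat set set \<Rightarrow> ('a, 'b) monoid_scheme \<Rightarrow> 'a set \<Rightarrow> 'a set \<Rightarrow> bool" where
  "condition_i \<sigma> G D M \<longleftrightarrow>
     inner_semidirect G D M \<and>
     comm_group (G\<lparr>carrier := D\<rparr>) \<and> hall_subgroup G D \<and> odd (card D) \<and>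
     sigma_nilpotent \<sigma> (G\<lparr>carrier := M\<rparr>) \<and>
     (\<forall>g\<in>carrier G. power_automorphism (G\<lparr>carrier := D\<rparr>)
        (\<lambda>x\<in>D. inv\<^bsub>G\<^esub> g \<otimes>\<^bsub>G\<^esub> x \<otimes>\<^bsub>G\<^esub> g))"

definition condition_ii :: "nat set set \<Rightarrow> ('a, 'b) monoid_scheme \<Rightarrow> 'a set \<Rightarrow> bool" where
  "condition_ii \<sigma> G D \<longleftrightarrow>
     (\<forall>\<pi>\<in>\<sigma>. \<exists>H N. hall_pi_subgroup \<pi> G H \<and> N \<lhd> G\<lparr>carrier := H\<rparr> \<and>
        complement_in (G\<lparr>carrier := H\<rparr>) (pi_core \<pi> (G\<lparr>carrier := D\<rparr>)) N)"

end

theory Submission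
  imports Defs
begin

text \<open>Throughout, \<open>\<pi>'\<close> is the complement of a class \<open>\<pi>\<close> of the partition, \<open>pi_core\<close> is
\<open>O\<^sub>\<pi>\<close>, and \<open>pi_residual\<close> is \<open>O\<^sup>\<pi>\<close>, the smallest normal subgroup with a \<open>\<pi>\<close>-group
as quotient. The residual \<open>D = G\<^sup>\<NN>\<close> of \<open>\<sigma>\<close>-nilpotency is the intersection of the
\<open>O\<^sup>\<pi>(G)\<close>, so a \<open>\<pi>\<close>-element lies in \<open>D\<close> as soon as it lies in \<open>O\<^sup>\<pi>(G)\<close>
(\<open>pi_element_in_sigma_residual\<close>). Subgroups are compared through their elements of prime power
order; by Sylow's theorem this controls indices as well.

From transitivity to the structure of \<open>G\<close>. By Schur-Zassenhaus, a \<open>\<sigma>\<close>-soluble group and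
its normal subgroups have a Hall subgroup for each class. Fix \<open>\<pi>\<close> and let
\<open>L = G/O\<^bsub>\<pi>'\<^esub>(G)\<close>, \<open>P = O\<^sub>\<pi>(L)\<close> and \<open>T = O\<^sup>\<pi>(L)\<close>. A subgroup \<open>A\<close> that lies between
\<open>O\<^bsub>\<pi>'\<^esub>(G)\<close> and the preimage of \<open>P\<close> is \<open>\<sigma>\<close>-permutable in that preimage, which is
normal in \<open>G\<close>; by transitivity \<open>A\<close> permutes with every Hall subgroup of \<open>G\<close>, and the Hall
\<open>\<rho>\<close>-subgroups with \<open>\<rho> \<noteq> \<pi>\<close> then normalise \<open>A\<close>. Hence \<open>T\<close> induces power
automorphisms on \<open>P\<close> (\<open>reduced_quotient\<close>).

A \<open>\<pi>'\<close>-element \<open>v\<close> that moves a \<open>p\<close>-element \<open>x\<close> of \<open>P\<close> forces \<open>x\<close> into the centre of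
\<open>P\<close> (\<open>moved_central\<close>) and then moves all \<open>p\<close>-elements of \<open>P\<close> (\<open>fixed_trivial\<close>). So
\<open>P = Z \<times> C\<close>, where \<open>Z\<close> is a central Hall subgroup on which \<open>\<pi>'\<close>-elements act without
fixed points prime by prime and \<open>C\<close> centralises all \<open>\<pi>'\<close>-elements. Since
\<open>P\<close> contains its centraliser (\<open>centraliser_P_subset\<close>) and power automorphisms commute with
everything in sight (\<open>V_commutator\<close>), \<open>P\<close> is a Hall subgroup of \<open>L\<close>, \<open>L/P\<close> is abelian and
\<open>T \<inter> P = Z\<close>. Therefore the image of \<open>D\<close> in \<open>L\<close> is contained in \<open>Z\<close>. As the groups
\<open>O\<^bsub>\<pi>'\<^esub>(G)\<close> intersect trivially, the properties of \<open>Z\<close> for the different classes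
(abelian, Hall, odd order, all subgroups normal in \<open>L\<close>, complement \<open>C\<close> in \<open>P\<close>) give
both conditions for \<open>D\<close> (\<open>residual_conditions\<close>).

From the structure to transitivity. Let \<open>R\<^sub>\<pi>/D\<close> be the Hall \<open>\<pi>\<close>-subgroup of \<open>G/D\<close>. The
second condition says that \<open>R\<^sub>\<pi>\<close> centralises \<open>O\<^sub>\<pi>(D)\<close>. Under the two conditions a subgroup
\<open>A\<close> is \<open>\<sigma>\<close>-permutable in \<open>G\<close> exactly when \<open>D\<close> normalises it
(\<open>sigma_permutable_normalised\<close>, \<open>normalised_imp_sigma_permutable\<close>), and in a subgroup \<open>H\<close>
every \<open>\<sigma>\<close>-permutable \<open>K\<close> is normalised by \<open>D \<inter> H\<close>. If \<open>H\<close> is \<open>\<sigma>\<close>-permutable in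
\<open>G\<close>, a commutator \<open>c = [k, d]\<close> with \<open>d \<in> D\<close> and a \<open>p\<close>-element \<open>k \<in> K\<close> lies in \<open>D \<inter> H\<close>
and so commutes with \<open>k\<close> modulo \<open>K \<inter> D\<close>. If \<open>p\<close> divides \<open>|D|\<close>, then \<open>k \<in> D\<close> and \<open>c = \<one>\<close>. Otherwise
\<open>c\<close> has order prime to \<open>p\<close> while \<open>k\<close> and \<open>k c\<close> have \<open>p\<close>-power order, so \<open>c \<in> K\<close>. Hence \<open>D\<close> normalises \<open>K\<close> (\<open>psigmat\<close>).\<close>

section \<open>Numbers and elements with prime divisors in a given set\<close>

text \<open>The positivity clause excludes \<open>0\<close>, whose set of prime factors is empty.\<close>
definition pi_number :: "nat set \<Rightarrow> nat \<Rightarrow> bool" where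
  "pi_number \<pi> n \<longleftrightarrow> n > 0 \<and> prime_factors n \<subseteq> \<pi>"

lemma pi_numberI:
  assumes "n > 0" and "\<And>p. Factorial_Ring.prime p \<Longrightarrow> p dvd n \<Longrightarrow> p \<in> \<pi>"
  shows "pi_number \<pi> n"
  using assms by (auto simp: pi_number_def in_prime_factors_iff)

lemma pi_number_primeD:
  "pi_number \<pi> n \<Longrightarrow> Factorial_Ring.prime p \<Longrightarrow> p dvd n \<Longrightarrow> p \<in> \<pi>"
  by (auto simp: pi_number_def in_prime_factors_iff)

lemma pi_number_1 [simp]: "pi_number \<pi> (Suc 0)"
  by (simp add: pi_number_def)

lemma pi_number_dvd: "pi_number \<pi> n \<Longrightarrow> m dvd n \<Longrightarrow> pi_number \<pi> m"
  by (meson dvd_pos_nat dvd_trans pi_numberI pi_number_primeD pi_number_def)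

lemma pi_number_mono: "pi_number \<pi> n \<Longrightarrow> \<pi> \<subseteq> \<rho> \<Longrightarrow> pi_number \<rho> n"
  by (auto simp: pi_number_def)

lemma pi_number_mult:
  "pi_number \<pi> m \<Longrightarrow> pi_number \<pi> n \<Longrightarrow> pi_number \<pi> (m * n)"
  by (simp add: pi_number_def prime_factors_product)

lemma pi_number_power: "pi_number \<pi> m \<Longrightarrow> pi_number \<pi> (m ^ k)"
  by (induction k) (auto intro: pi_number_mult)

lemma pi_number_coprime:
  assumes "pi_number \<pi> m" "pi_number \<rho> n" "\<pi> \<inter> \<rho> = {}"
  shows "coprime m n"
proof (rule coprimeI)
  fix c assume c: "c dvd m" "c dvd n"
  show "is_unit c"
  proof (rule ccontr)
    assume "\<not> is_unit c"
    then obtain p where "Factorial_Ring.prime p" "p dvd c"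
      by (metis nat_dvd_1_iff_1 prime_factor_nat)
    with c have "p \<in> \<pi>" "p \<in> \<rho>"
      using assms pi_number_primeD dvd_trans by meson+
    with assms(3) show False by blast
  qed
qed

lemma pi_number_both:
  assumes "pi_number \<pi> m" "pi_number \<rho> m" "\<pi> \<inter> \<rho> = {}"
  shows "m = 1"
  using pi_number_coprime[OF assms] by simp

lemma pi_number_prime_self:
  "Factorial_Ring.prime p \<Longrightarrow> p \<in> \<pi> \<Longrightarrow> pi_number \<pi> p"
  by (metis pi_numberI prime_gt_0_nat primes_dvd_imp_eq)

lemma pi_number_not_dvd:
  "Factorial_Ring.prime p \<Longrightarrow> n > 0 \<Longrightarrow> \<not> p dvd n \<Longrightarrow> pi_number (- {p}) n"
  by (rule pi_numberI) auto

lemma pi_number_split: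
  "n > 0 \<Longrightarrow> \<exists>a b. n = a * b \<and> pi_number \<pi> a \<and> pi_number (- \<pi>) b"
proof (induction n rule: less_induct)
  case (less n)
  show ?case
  proof (cases "n = 1")
    case True
    then show ?thesis by (intro exI[of _ 1]) simp
  next
    case False
    then obtain p m where p: "Factorial_Ring.prime p" "n = p * m"
      by (metis prime_factor_nat dvdE)
    then have "m < n" "m > 0"
      using less.prems prime_gt_1_nat[OF p(1)] by auto
    then obtain a b where ab: "m = a * b" "pi_number \<pi> a" "pi_number (- \<pi>) b"
      using less.IH by blast
    show ?thesis
    proof (cases "p \<in> \<pi>")
      case True
      then have "pi_number \<pi> (p * a)"
        using ab p pi_number_mult pi_number_prime_self by blast
      with ab p show ?thesis
        by (intro exI[of _ "p * a"] exI[of _ b]) (auto simp: algebra_simps)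
    next
      case False
      then have "pi_number (- \<pi>) (p * b)"
        using ab p pi_number_mult pi_number_prime_self by (metis ComplI)
      with ab p show ?thesis
        by (intro exI[of _ a] exI[of _ "p * b"]) (auto simp: algebra_simps)
    qed
  qed
qed

locale finite_group = group G for G (structure) +
  assumes finite_carrier [simp, intro]: "finite (carrier G)"

text \<open>An exponent is used instead of the order of the element, because exponents are inherited by
homomorphic images and by products of commuting elements.\<close>
definition (in monoid) pi_elements :: "nat set \<Rightarrow> 'a set" where
  "pi_elements \<pi> = {x \<in> carrier G. \<exists>n. pi_number \<pi> n \<and> x [^] n = \<one>}"

context finite_group
begin

lemma order_pos: "order G > 0"
  by (simp add: order_gt_0_iff_finite)

lemma subgroup_finite: "subgroup H G \<Longrightarrow> finite H"
  using finite_subset subgroup.subset by blast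

lemma subgroup_finite_group: "subgroup H G \<Longrightarrow> finite_group (G\<lparr>carrier := H\<rparr>)"
  by (simp add: finite_group_axioms_def finite_group_def subgroup_finite subgroup_imp_group)

lemma card_subgroup_pos: "subgroup H G \<Longrightarrow> card H > 0"
  by (simp add: subgroup.finite_imp_card_positive)

lemma card_subgroup_dvd:
  assumes "subgroup H G" "subgroup K G" "H \<subseteq> K"
  shows "card H dvd card K"
proof -
  interpret K: group "G\<lparr>carrier := K\<rparr>"
    using assms subgroup_imp_group by blast
  have "subgroup H (G\<lparr>carrier := K\<rparr>)"
    using assms by (simp add: subgroup_incl)
  from K.lagrange[OF this] show ?thesis
    by (metis dvd_triv_right order_def partial_object.select_convs(1) partial_object.surjective partial_object.update_convs(1))
qed

lemma card_rcosets_subgroup: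
  assumes "subgroup H G"
  shows "card (rcosets H) = order G div card H"
  using lagrange[OF assms] card_subgroup_pos[OF assms]
  by (metis nonzero_mult_div_cancel_right not_less_zero)

lemma subgroup_pow_closed: "subgroup H G \<Longrightarrow> x \<in> H \<Longrightarrow> x [^] (n::nat) \<in> H"
  by (induction n) (auto simp: subgroup.m_closed subgroup.one_closed)

text \<open>In a finite group inverses are powers.\<close>
lemma subgroup_of_mult_closed:
  assumes "H \<subseteq> carrier G" "\<one> \<in> H" "\<And>x y. x \<in> H \<Longrightarrow> y \<in> H \<Longrightarrow> x \<otimes> y \<in> H"
  shows "subgroup H G"
proof (rule subgroupI)
  fix a assume a: "a \<in> H"
  have pow: "a [^] (n::nat) \<in> H" for n
    by (induction n) (use a assms in auto)
  have "a [^] (order G - 1) \<otimes> a = a [^] order G"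
    using order_pos by (cases "order G") auto
  then have "inv a = a [^] (order G - 1)"
    using a assms(1) pow_order_eq_1[of a] by (intro inv_equality) auto
  then show "inv a \<in> H" using pow by simp
qed (use assms in auto)

lemma pi_elementsI: "x \<in> carrier G \<Longrightarrow> x [^] n = \<one> \<Longrightarrow> pi_number \<pi> n \<Longrightarrow> x \<in> pi_elements \<pi>"
  by (auto simp: pi_elements_def)

lemma pi_elements_carrier: "x \<in> pi_elements \<pi> \<Longrightarrow> x \<in> carrier G"
  by (auto simp: pi_elements_def)

lemma pi_elements_mono: "x \<in> pi_elements \<pi> \<Longrightarrow> \<pi> \<subseteq> \<rho> \<Longrightarrow> x \<in> pi_elements \<rho>"
  by (auto simp: pi_elements_def dest: pi_number_mono)

lemma one_pi_element [simp]: "\<one> \<in> pi_elements \<pi>"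
  by (rule pi_elementsI[of _ 1]) auto

lemma pi_elements_pow: "x \<in> pi_elements \<pi> \<Longrightarrow> x [^] (k::nat) \<in> pi_elements \<pi>"
  unfolding pi_elements_def by (auto simp: nat_pow_pow) (metis mult.commute nat_pow_one nat_pow_pow)

lemma pi_elements_inv: "x \<in> pi_elements \<pi> \<Longrightarrow> inv x \<in> pi_elements \<pi>"
  unfolding pi_elements_def by (auto simp: nat_pow_inv)

lemma pi_elements_commuting_mult:
  assumes "x \<in> pi_elements \<pi>" "y \<in> pi_elements \<pi>" "x \<otimes> y = y \<otimes> x"
  shows "x \<otimes> y \<in> pi_elements \<pi>"
proof -
  obtain m n where mn: "x [^] m = \<one>" "y [^] n = \<one>" "pi_number \<pi> m" "pi_number \<pi> n"
      "x \<in> carrier G" "y \<in> carrier G"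
    using assms by (auto simp: pi_elements_def)
  then have "(x \<otimes> y) [^] (m * n) = x [^] (m * n) \<otimes> y [^] (n * m)"
    using pow_mult_distrib[OF assms(3)] by (simp add: mult.commute)
  also have "\<dots> = (x [^] m) [^] n \<otimes> (y [^] n) [^] m"
    using mn(5,6) by (simp add: nat_pow_pow)
  also have "\<dots> = \<one>" using mn by simp
  finally show ?thesis
    using mn by (intro pi_elementsI[of _ "m * n"]) (auto intro: pi_number_mult)
qed

lemma pi_elements_disjoint:
  assumes "x \<in> pi_elements \<pi>" "x \<in> pi_elements \<rho>" "\<pi> \<inter> \<rho> = {}"
  shows "x = \<one>"
proof -
  obtain m n where mn: "x [^] m = \<one>" "x [^] n = \<one>" "pi_number \<pi> m" "pi_number \<rho> n" "x \<in> carrier G"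
    using assms by (auto simp: pi_elements_def)
  then have "ord x dvd m" "ord x dvd n" by (auto simp: pow_eq_id)
  moreover have "coprime m n" using pi_number_coprime assms(3) mn by blast
  ultimately have "ord x = 1" by (metis coprime_common_divisor nat_dvd_1_iff_1)
  then show ?thesis using mn ord_eq_1 by blast
qed

lemma ord_pos: "x \<in> carrier G \<Longrightarrow> ord x > 0"
  by (metis dvd_0_left_iff gr0I ord_dvd_group_order order_pos)

lemma pi_elements_ord: "x \<in> pi_elements \<pi> \<longleftrightarrow> x \<in> carrier G \<and> pi_number \<pi> (ord x)"
  unfolding pi_elements_def using pi_number_dvd by (auto simp: pow_eq_id)

text \<open>An inverse of the exponent \<open>k\<close> modulo \<open>n\<close> recovers \<open>x\<close> from \<open>x\<^sup>k\<close>.\<close>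
lemma pow_coprime_generates:
  fixes k n :: nat
  assumes "x \<in> carrier G" "x [^] n = \<one>" "coprime k n" "n > 0"
  shows "\<exists>j::nat. (x [^] k) [^] j = x"
proof (cases "k = 0")
  case True
  with assms have "n = 1" by simp
  then show ?thesis using assms by (intro exI[of _ 0]) simp
next
  case False
  then obtain a b where "k * a = n * b + gcd k n"
    using bezout_nat by blast
  then have "(x [^] k) [^] a = (x [^] n) [^] b \<otimes> x"
    using assms(1) coprime_imp_gcd_eq_1[OF assms(3)] by (simp add: nat_pow_pow)
  then show ?thesis using assms(1,2) by auto
qed

text \<open>The \<open>\<pi>\<close>-part and the \<open>\<pi>'\<close>-part of an element are powers of it; that they are powers is what
keeps them inside every subgroup that contains the element.\<close>
lemma pi_decomposition:
  assumes "x \<in> carrier G"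
  shows "\<exists>m m'. x [^] (m::nat) \<in> pi_elements \<pi> \<and> x [^] (m'::nat) \<in> pi_elements (- \<pi>)
           \<and> x = x [^] m \<otimes> x [^] m' \<and> x [^] m' = x \<otimes> inv (x [^] m)"
proof -
  obtain a b where ab: "order G = a * b" "pi_number \<pi> a" "pi_number (- \<pi>) b"
    using pi_number_split order_pos by blast
  then have "coprime a b" "a \<noteq> 0" using pi_number_coprime by (auto simp: pi_number_def)
  then obtain c d where cd: "a * c = b * d + 1"
    using bezout_nat[of a b] by auto
  define n where "n = order G"
  have xn: "x [^] n = \<one>" using assms pow_order_eq_1 n_def by simp
  \<comment> \<open>A negative coefficient in Bezout's identity is replaced by its product with \<open>1 - n\<close>.\<close>
  define m m' where "m = b * d * (n - 1)" and "m' = a * c"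
  have "m + m' = b * d * n + 1"
    using cd order_pos n_def unfolding m_def m'_def by (cases n) (auto simp: algebra_simps)
  then have "x [^] m \<otimes> x [^] m' = x [^] (b * d * n) \<otimes> x"
    using assms by (simp add: nat_pow_mult)
  also have "x [^] (b * d * n) = \<one>"
    using xn assms by (metis mult.commute nat_pow_one nat_pow_pow)
  finally have eq: "x = x [^] m \<otimes> x [^] m'" using assms by simp
  have "(x [^] m) [^] a = (x [^] n) [^] (d * (n - 1))"
    unfolding m_def using assms by (simp add: nat_pow_pow n_def ab algebra_simps)
  then have 1: "x [^] m \<in> pi_elements \<pi>"
    using ab assms xn by (intro pi_elementsI[of _ a]) auto
  have "(x [^] m') [^] b = (x [^] n) [^] c"
    unfolding m'_def using assms by (simp add: nat_pow_pow n_def ab algebra_simps)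
  then have 2: "x [^] m' \<in> pi_elements (- \<pi>)"
    using ab assms xn by (intro pi_elementsI[of _ b]) auto
  have "x [^] m' \<otimes> x [^] m = x" using eq assms by (metis nat_pow_comm)
  then have "x [^] m' = x \<otimes> inv (x [^] m)"
    using assms inv_solve_right by auto
  with 1 2 eq show ?thesis by blast
qed

lemma subgroup_pi_elements:
  assumes "subgroup H G" "pi_number \<pi> (card H)"
  shows "H \<subseteq> pi_elements \<pi>"
proof
  fix x assume x: "x \<in> H"
  interpret H: group "G\<lparr>carrier := H\<rparr>" using assms subgroup_imp_group by blast
  have "x [^]\<^bsub>G\<lparr>carrier := H\<rparr>\<^esub> order (G\<lparr>carrier := H\<rparr>) = \<one>\<^bsub>G\<lparr>carrier := H\<rparr>\<^esub>"
    using x by (intro H.pow_order_eq_1) simp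
  then have "x [^] card H = \<one>" by (simp add: order_def nat_pow_consistent[symmetric])
  then show "x \<in> pi_elements \<pi>"
    using x assms subgroup.subset by (intro pi_elementsI) auto
qed

lemma sylow_subgroup:
  assumes "Factorial_Ring.prime p" "subgroup K G"
  obtains S a m where "subgroup S G" "S \<subseteq> K" "card S = p ^ a" "card K = p ^ a * m" "\<not> p dvd m"
proof -
  interpret K: finite_group "G\<lparr>carrier := K\<rparr>" using assms subgroup_finite_group by blast
  obtain a m where am: "card K = p ^ a * m" "\<not> p dvd m"
    using prime_power_canonical[OF assms(1) card_subgroup_pos[OF assms(2)]] by (metis mult.commute)
  obtain S where "subgroup S (G\<lparr>carrier := K\<rparr>)" "card S = p ^ a"
    using sylow_thm[of p "G\<lparr>carrier := K\<rparr>" a m] assms am K.is_group K.finite_carrier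
    by (auto simp: order_def)
  then show thesis
    using that am incl_subgroup[OF assms(2)] subgroup.subset by fastforce
qed

text \<open>A subgroup that contains all \<open>p\<close>-elements contains a Sylow \<open>p\<close>-subgroup. This turns statements
about elements into statements about indices, and is used instead of numerical comparisons of
Sylow subgroups throughout.\<close>
lemma prime_not_dvd_index:
  assumes p: "Factorial_Ring.prime p" and H: "subgroup H G" "subgroup K G" "H \<subseteq> K"
    and elts: "\<And>x. x \<in> K \<Longrightarrow> x \<in> pi_elements {p} \<Longrightarrow> x \<in> H"
  shows "\<not> p dvd card K div card H"
proof -
  obtain S a m where S: "subgroup S G" "S \<subseteq> K" "card S = p ^ a" "card K = p ^ a * m" "\<not> p dvd m"
    using sylow_subgroup[OF p H(2)] by blast
  have "pi_number {p} (card S)"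
    using S(3) p by (simp add: pi_number_power pi_number_prime_self)
  then have "S \<subseteq> H" using subgroup_pi_elements S elts by blast
  then have "p ^ a dvd card H" using card_subgroup_dvd S H by metis
  then obtain c where c: "card H = p ^ a * c" by blast
  have "card H dvd card K" using card_subgroup_dvd H by blast
  then obtain d where d: "card K = card H * d" by blast
  have "m = c * d" using d c S(4) p by (auto simp: algebra_simps)
  moreover have "card K div card H = d" using d card_subgroup_pos[OF H(1)] by simp
  ultimately show ?thesis using S(5) dvd_mult by blast
qed

lemma card_div_subgroup_pos:
  "subgroup H G \<Longrightarrow> subgroup K G \<Longrightarrow> H \<subseteq> K \<Longrightarrow> card K div card H > 0"
  using card_subgroup_dvd[of H K] card_subgroup_pos[of H] card_subgroup_pos[of K]
  by (simp add: div_greater_zero_iff dvd_imp_le)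

lemma pi_index:
  assumes H: "subgroup H G" "subgroup K G" "H \<subseteq> K"
    and elts: "\<And>p x. Factorial_Ring.prime p \<Longrightarrow> p \<notin> \<pi> \<Longrightarrow> x \<in> K \<Longrightarrow> x \<in> pi_elements {p} \<Longrightarrow> x \<in> H"
  shows "pi_number \<pi> (card K div card H)"
proof (rule pi_numberI)
  fix p :: nat assume "Factorial_Ring.prime p" "p dvd card K div card H"
  then show "p \<in> \<pi>" using prime_not_dvd_index[OF _ H] elts by blast
qed (rule card_div_subgroup_pos[OF H])

lemma subgroup_eq_by_prime_elements:
  assumes H: "subgroup H G" "subgroup K G" "H \<subseteq> K"
    and elts: "\<And>p x. Factorial_Ring.prime p \<Longrightarrow> x \<in> K \<Longrightarrow> x \<in> pi_elements {p} \<Longrightarrow> x \<in> H"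
  shows "H = K"
proof -
  have "pi_number {} (card K div card H)"
    using pi_index[OF H] elts by blast
  then have "card K div card H = 1" using pi_number_both by blast
  then have "card H = card K"
    using card_subgroup_dvd[OF H] by (metis dvd_div_mult_self mult_1)
  then show ?thesis using H subgroup_finite by (simp add: card_subset_eq)
qed

lemma subgroup_subset_by_prime_elements:
  assumes H: "subgroup H G" "subgroup K G"
    and elts: "\<And>p x. Factorial_Ring.prime p \<Longrightarrow> x \<in> K \<Longrightarrow> x \<in> pi_elements {p} \<Longrightarrow> x \<in> H"
  shows "K \<subseteq> H"
  using subgroup_eq_by_prime_elements[OF subgroups_Inter_pair[OF H] H(2)] elts by blast

lemma powers_subgroup:
  assumes "x \<in> carrier G"
  shows "subgroup {x [^] (k::nat) | k. True} G"
proof (rule subgroup_of_mult_closed)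
  show "\<one> \<in> {x [^] (k::nat) |k. True}" by (metis (mono_tags, lifting) mem_Collect_eq nat_pow_0)
qed (use assms in \<open>auto simp: nat_pow_mult\<close>)

text \<open>Every element is a product of powers of itself that have prime power order.\<close>
lemma mem_by_prime_parts:
  assumes "x \<in> carrier G" "subgroup H G"
    and "\<And>p m. Factorial_Ring.prime p \<Longrightarrow> x [^] (m::nat) \<in> pi_elements {p} \<Longrightarrow> x [^] m \<in> H"
  shows "x \<in> H"
proof -
  have "{x [^] (k::nat) | k. True} \<subseteq> H"
  proof (rule subgroup_subset_by_prime_elements[OF assms(2) powers_subgroup[OF assms(1)]])
    fix p y assume "Factorial_Ring.prime p" "y \<in> {x [^] (k::nat) | k. True}" "y \<in> pi_elements {p}"
    then show "y \<in> H" using assms(3) by auto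
  qed
  moreover have "x \<in> {x [^] (k::nat) | k. True}"
    using assms(1) by (intro CollectI exI[of _ "1::nat"]) simp
  ultimately show ?thesis by blast
qed

lemma cauchy:
  assumes "Factorial_Ring.prime p" "subgroup K G" "p dvd card K"
  shows "\<exists>x\<in>K. x \<in> pi_elements {p} \<and> x \<noteq> \<one>"
proof (rule ccontr)
  assume "\<not> ?thesis"
  then have "\<not> p dvd card K div card {\<one>}"
    using prime_not_dvd_index[OF assms(1) triv_subgroup assms(2)] assms subgroup.one_closed by blast
  with assms show False by simp
qed

lemma pi_subgroup_iff:
  assumes "subgroup H G"
  shows "pi_number \<pi> (card H) \<longleftrightarrow> H \<subseteq> pi_elements \<pi>"
proof
  assume H: "H \<subseteq> pi_elements \<pi>"
  show "pi_number \<pi> (card H)"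
  proof (rule pi_numberI)
    fix p :: nat assume p: "Factorial_Ring.prime p" "p dvd card H"
    then obtain x where x: "x \<in> H" "x \<in> pi_elements {p}" "x \<noteq> \<one>" using cauchy assms by blast
    then show "p \<in> \<pi>" using pi_elements_disjoint[of x \<pi> "{p}"] H by blast
  qed (use assms card_subgroup_pos in auto)
qed (use assms subgroup_pi_elements in auto)

lemma pow_index_mem_normal:
  assumes N: "N \<lhd> G" and x: "x \<in> carrier G"
  shows "x [^] (order G div card N) \<in> N"
proof -
  interpret N: normal N G by (rule N)
  interpret Q: group "G Mod N" by (rule N.factorgroup_is_group)
  have "order (G Mod N) = order G div card N"
    using card_rcosets_subgroup[OF N.is_subgroup] by (simp add: order_def FactGroup_def)
  moreover have "(N #> x) [^]\<^bsub>G Mod N\<^esub> order (G Mod N) = N"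
    using Q.pow_order_eq_1[of "N #> x"] x by (simp add: FactGroup_def RCOSETS_def) blast
  ultimately have "N #> (x [^] (order G div card N)) = N"
    using N.FactGroup_pow[OF x] by simp
  then show ?thesis using coset_join1[of N "x [^] (order G div card N)"] x N.subset N.is_subgroup by simp
qed

text \<open>Modulo \<open>N\<close> a \<open>\<rho>\<close>-element has an order that is both a \<open>\<rho>\<close>-number and a \<open>\<pi>\<close>-number.\<close>
lemma pi_elements_subset_normal:
  assumes N: "N \<lhd> G" and "pi_number \<pi> (order G div card N)" and "\<pi> \<inter> \<rho> = {}"
  shows "pi_elements \<rho> \<subseteq> N"
proof
  fix x assume "x \<in> pi_elements \<rho>"
  then obtain n where n: "x [^] n = \<one>" "pi_number \<rho> n" "x \<in> carrier G"
    by (auto simp: pi_elements_def)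
  then obtain j where "(x [^] (order G div card N)) [^] (j::nat) = x"
    using pow_coprime_generates[OF n(3,1)] pi_number_coprime[OF assms(2) n(2) assms(3)]
    by (auto simp: pi_number_def)
  then show "x \<in> N"
    by (metis N n(3) normal_imp_subgroup pow_index_mem_normal subgroup_pow_closed)
qed

text \<open>The fibres of the multiplication \<open>A \<times> B \<rightarrow> A B\<close> are in bijection with \<open>A \<inter> B\<close>.\<close>
lemma card_set_mult:
  assumes A: "subgroup A G" and B: "subgroup B G"
  shows "card (A <#> B) * card (A \<inter> B) = card A * card B"
proof -
  note sA = subgroup.mem_carrier[OF A] and sB = subgroup.mem_carrier[OF B]
  define f where "f = (\<lambda>(a, b). a \<otimes> b)"
  have fin: "finite (A \<times> B)" using A B subgroup_finite by blast
  have img: "f ` (A \<times> B) = A <#> B" by (force simp: f_def set_mult_def)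
  have fib: "card {z \<in> A \<times> B. f z = y} = card (A \<inter> B)" if "y \<in> f ` (A \<times> B)" for y
  proof -
    obtain a b where ab: "a \<in> A" "b \<in> B" "y = a \<otimes> b" using \<open>y \<in> f ` (A \<times> B)\<close> by (auto simp: f_def)
    have "bij_betw (\<lambda>c. (a \<otimes> c, inv c \<otimes> b)) (A \<inter> B) {z \<in> A \<times> B. f z = y}"
    proof (rule bij_betw_byWitness[where f' = "\<lambda>(a', b'). inv a \<otimes> a'"])
      show "\<forall>c\<in>A \<inter> B. (\<lambda>(a', b'). inv a \<otimes> a') (a \<otimes> c, inv c \<otimes> b) = c"
        using ab sA sB by (auto simp: m_assoc[symmetric])
      show "(\<lambda>c. (a \<otimes> c, inv c \<otimes> b)) ` (A \<inter> B) \<subseteq> {z \<in> A \<times> B. f z = y}"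
      proof clarify
        fix c assume c: "c \<in> A" "c \<in> B"
        have "a \<otimes> c \<otimes> (inv c \<otimes> b) = a \<otimes> b"
          using c ab sA sB by (metis inv_closed l_inv m_assoc m_closed r_inv r_one)
        then show "(a \<otimes> c, inv c \<otimes> b) \<in> A \<times> B \<and> f (a \<otimes> c, inv c \<otimes> b) = y"
          using c ab A B by (simp add: f_def subgroup.m_closed subgroup.m_inv_closed)
      qed
      have *: "inv a \<otimes> a' \<in> A \<inter> B \<and> a \<otimes> (inv a \<otimes> a') = a' \<and> inv (inv a \<otimes> a') \<otimes> b = b'"
        if "a' \<in> A" "b' \<in> B" "a' \<otimes> b' = a \<otimes> b" for a' b'
      proof -
        note c = that ab sA sB
        have e: "inv a \<otimes> a' = b \<otimes> inv b'"
          using c by (metis inv_closed inv_solve_left inv_solve_right m_assoc m_closed)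
        have "inv a \<otimes> a' \<in> A" using that ab A by (simp add: subgroup.m_closed subgroup.m_inv_closed)
        moreover have "b \<otimes> inv b' \<in> B" using that ab B by (simp add: subgroup.m_closed subgroup.m_inv_closed)
        moreover have "a \<otimes> (inv a \<otimes> a') = a'" using c by (simp add: m_assoc[symmetric])
        moreover have "inv (b \<otimes> inv b') \<otimes> b = b'" using c by (simp add: inv_mult_group m_assoc)
        ultimately show ?thesis using e by simp
      qed
      then show "\<forall>z\<in>{z \<in> A \<times> B. f z = y}. (a \<otimes> (\<lambda>(a', b'). inv a \<otimes> a') z, inv (\<lambda>(a', b'). inv a \<otimes> a') z \<otimes> b) = z"
        using ab by (auto simp: f_def)
      show "(\<lambda>(a', b'). inv a \<otimes> a') ` {z \<in> A \<times> B. f z = y} \<subseteq> A \<inter> B"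
        using * ab by (auto simp: f_def)
    qed
    then show ?thesis using bij_betw_same_card by fastforce
  qed
  have "card (A \<times> B) = (\<Sum>y\<in>f ` (A \<times> B). card {z \<in> A \<times> B. f z = y})"
    using sum.image_gen[OF fin, of "\<lambda>_. 1::nat" f] by simp
  also have "\<dots> = card (A <#> B) * card (A \<inter> B)"
    using fib img by simp
  finally show ?thesis by (simp add: card_cartesian_product)
qed

end

section \<open>Actions of p-groups and Sylow's conjugacy theorem\<close>

text \<open>Orbits of a \<open>p\<close>-group have \<open>p\<close>-power length, so without fixed points all orbit lengths would be
divisible by \<open>p\<close>.\<close>
lemma p_group_fixed_point:
  fixes S (structure)
  assumes "group S" and p: "Factorial_Ring.prime p" "order S = p ^ a"
    and E: "finite E" "\<not> p dvd card E"
    and closed: "\<And>g x. g \<in> carrier S \<Longrightarrow> x \<in> E \<Longrightarrow> act g x \<in> E"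
    and one: "\<And>x. x \<in> E \<Longrightarrow> act \<one> x = x"
    and mult: "\<And>g h x. g \<in> carrier S \<Longrightarrow> h \<in> carrier S \<Longrightarrow> x \<in> E \<Longrightarrow> act (g \<otimes> h) x = act g (act h x)"
  shows "\<exists>x\<in>E. \<forall>g\<in>carrier S. act g x = x"
proof (rule ccontr)
  assume nofix: "\<not> ?thesis"
  interpret S: group S by fact
  define \<phi> where "\<phi> = (\<lambda>g. \<lambda>x\<in>E. act g x)"
  have Bij: "\<phi> g \<in> Bij E" if "g \<in> carrier S" for g
  proof -
    have "bij_betw (act g) E E"
    proof (rule bij_betw_byWitness[where f' = "act (inv g)"])
      show "\<forall>x\<in>E. act (inv g) (act g x) = x" "\<forall>x\<in>E. act g (act (inv g) x) = x"
        using that mult one by (metis S.inv_closed S.l_inv, metis S.inv_closed S.r_inv)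
    qed (use that closed in auto)
    then have "bij_betw (\<phi> g) E E"
      unfolding \<phi>_def by (rule bij_betw_cong[THEN iffD1, rotated]) simp
    then show ?thesis by (simp add: Bij_def \<phi>_def)
  qed
  have "\<phi> (g \<otimes> h) = \<phi> g \<otimes>\<^bsub>BijGroup E\<^esub> \<phi> h" if "g \<in> carrier S" "h \<in> carrier S" for g h
    using that Bij by (auto simp: BijGroup_def \<phi>_def compose_def mult closed fun_eq_iff)
  then have "group_hom S (BijGroup E) \<phi>"
    using Bij by (intro group_hom.intro group_hom_axioms.intro group_BijGroup homI S.is_group)
      (auto simp: BijGroup_def)
  then interpret A: group_action S E \<phi> by (rule group_action.intro)
  have "p dvd card B" if B: "B \<in> orbits S E \<phi>" for B
  proof -
    obtain x where x: "x \<in> E" "B = orbit S \<phi> x" using B by (auto simp: orbits_def)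
    have "card B dvd p ^ a"
      using A.orbit_stabilizer_theorem[OF x(1)] x(2) p(2) by (metis dvd_triv_left)
    then obtain k where k: "card B = p ^ k" using p(1) divides_primepow_nat by blast
    show ?thesis
    proof (cases "k = 0")
      case True
      then obtain y where "B = {y}" using k card_1_singletonE by auto
      moreover have "x \<in> B" using A.orbit_refl x by simp
      ultimately have "\<forall>g\<in>carrier S. \<phi> g x = x"
        using x(2) by (auto simp: orbit_def)
      then show ?thesis using nofix x(1) by (auto simp: \<phi>_def)
    qed (simp add: k)
  qed
  then have "p dvd (\<Sum>B\<in>orbits S E \<phi>. \<Sum>x\<in>B. 1)"
    unfolding card_eq_sum by (rule dvd_sum)
  then show False using A.disjoint_sum[OF E(1), of "\<lambda>_. 1::nat"] E(2) by simp
qed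

definition (in group) normaliser :: "'a set \<Rightarrow> 'a set" where
  "normaliser A = {g \<in> carrier G. \<forall>a\<in>A. g \<otimes> a \<otimes> inv g \<in> A}"

lemma (in group) conj_mult:
  assumes "g \<in> carrier G" "a \<in> carrier G" "b \<in> carrier G"
  shows "g \<otimes> (a \<otimes> b) \<otimes> inv g = (g \<otimes> a \<otimes> inv g) \<otimes> (g \<otimes> b \<otimes> inv g)"
  using assms by (simp add: m_assoc inv_solve_left inv_solve_left')

lemma (in group) conj_by_mult:
  assumes "g \<in> carrier G" "h \<in> carrier G" "a \<in> carrier G"
  shows "(g \<otimes> h) \<otimes> a \<otimes> inv (g \<otimes> h) = g \<otimes> (h \<otimes> a \<otimes> inv h) \<otimes> inv g"
  using assms by (simp add: m_assoc inv_mult_group)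

lemma (in group) conj_pow:
  assumes "g \<in> carrier G" "a \<in> carrier G"
  shows "g \<otimes> (a [^] (n::nat)) \<otimes> inv g = (g \<otimes> a \<otimes> inv g) [^] n"
  using assms by (induction n) (simp_all add: conj_mult)

lemma (in group) conj_inv:
  assumes "g \<in> carrier G" "a \<in> carrier G"
  shows "g \<otimes> inv a \<otimes> inv g = inv (g \<otimes> a \<otimes> inv g)"
  using assms by (simp add: inv_mult_group m_assoc)

lemma (in group) conj_conj_inv:
  assumes "g \<in> carrier G" "a \<in> carrier G"
  shows "g \<otimes> (inv g \<otimes> a \<otimes> g) \<otimes> inv g = a" "inv g \<otimes> (g \<otimes> a \<otimes> inv g) \<otimes> g = a"
  using assms conj_by_mult[of g "inv g" a] conj_by_mult[of "inv g" g a] by simp_all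

lemma (in group) conj_eq_iff_commute:
  assumes "g \<in> carrier G" "a \<in> carrier G"
  shows "g \<otimes> a \<otimes> inv g = a \<longleftrightarrow> g \<otimes> a = a \<otimes> g"
  using assms by (metis inv_solve_right m_closed)

lemma (in group) conj_one_iff:
  assumes "g \<in> carrier G" "a \<in> carrier G"
  shows "g \<otimes> a \<otimes> inv g = \<one> \<longleftrightarrow> a = \<one>"
  using assms by (metis conj_conj_inv(2) inv_closed l_inv r_inv r_one)

lemma (in group) cancel_inv:
  assumes "x \<in> carrier G" "y \<in> carrier G"
  shows "inv x \<otimes> (x \<otimes> y) = y" "x \<otimes> (inv x \<otimes> y) = y"
  using assms by (simp_all add: m_assoc[symmetric])

lemma (in group) subgroup_r_cosets_card:
  assumes "subgroup S G" "subgroup N G" "S \<subseteq> N"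
  shows "card ((\<lambda>x. S #> x) ` N) * card S = card N"
proof -
  interpret N: group "G\<lparr>carrier := N\<rparr>" using assms subgroup_imp_group by blast
  have "subgroup S (G\<lparr>carrier := N\<rparr>)" using assms by (simp add: subgroup_incl)
  moreover have "rcosets\<^bsub>G\<lparr>carrier := N\<rparr>\<^esub> S = (\<lambda>x. S #> x) ` N"
    by (auto simp: RCOSETS_def)
  ultimately show ?thesis using N.lagrange[of S] by (simp add: order_def)
qed

context finite_group
begin

lemma normaliser_subgroup:
  assumes "A \<subseteq> carrier G"
  shows "subgroup (normaliser A) G"
proof (rule subgroup_of_mult_closed)
  show "\<one> \<in> normaliser A" using assms by (auto simp: normaliser_def)
  show "x \<otimes> y \<in> normaliser A" if "x \<in> normaliser A" "y \<in> normaliser A" for x y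
    using that assms conj_by_mult[of x y] by (auto simp: normaliser_def subset_eq)
qed (auto simp: normaliser_def)

lemma subgroup_subset_normaliser: "subgroup A G \<Longrightarrow> A \<subseteq> normaliser A"
  by (auto simp: normaliser_def subgroup.m_closed subgroup.m_inv_closed subgroup.mem_carrier)

lemma normal_iff_normaliser: "subgroup A G \<Longrightarrow> A \<lhd> G \<longleftrightarrow> carrier G \<subseteq> normaliser A"
  by (auto simp: normaliser_def normal_inv_iff)

text \<open>The \<open>p\<close>-group \<open>R\<close> acts by translation on the cosets of \<open>S\<close> in \<open>N\<close>, whose number is prime to
\<open>p\<close>; a fixed coset gives the conjugating element.\<close>
lemma sylow_conjugate:
  assumes p: "Factorial_Ring.prime p" and N: "subgroup N G"
    and S: "subgroup S G" "S \<subseteq> N" "\<not> p dvd card N div card S"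
    and R: "subgroup R G" "R \<subseteq> N" "card R = p ^ a"
  shows "\<exists>x\<in>N. \<forall>g\<in>R. x \<otimes> g \<otimes> inv x \<in> S"
proof -
  note cN = subgroup.mem_carrier[OF N]
  have sS: "S \<subseteq> carrier G" using S subgroup.subset by blast
  define E where "E = (\<lambda>x. S #> x) ` N"
  interpret R: group "G\<lparr>carrier := R\<rparr>" using R subgroup_imp_group by blast
  have "card E * card S = card N" unfolding E_def using subgroup_r_cosets_card N S by blast
  then have cE: "\<not> p dvd card E" using S card_subgroup_pos by (metis nonzero_mult_div_cancel_right not_less_zero)
  have "\<exists>C\<in>E. \<forall>g\<in>carrier (G\<lparr>carrier := R\<rparr>). C #> inv g = C"
  proof (rule p_group_fixed_point[where p = p and a = a and act = "\<lambda>g C. C #> inv g"])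
    show "finite E" using N subgroup_finite by (simp add: E_def)
    show "order (G\<lparr>carrier := R\<rparr>) = p ^ a" using R by (simp add: order_def)
    show "C #> inv g \<in> E" if "g \<in> carrier (G\<lparr>carrier := R\<rparr>)" "C \<in> E" for g C
    proof -
      have "g \<in> N" "\<exists>x\<in>N. C = S #> x" using that R by (auto simp: E_def)
      then obtain x where x: "x \<in> N" "C = S #> x" by blast
      note \<open>g \<in> N\<close>
      then have "C #> inv g = S #> (x \<otimes> inv g)" "x \<otimes> inv g \<in> N"
        using x cN sS N by (auto simp: coset_mult_assoc subgroup.m_closed subgroup.m_inv_closed)
      then show ?thesis by (auto simp: E_def)
    qed
    show "C #> inv \<one>\<^bsub>G\<lparr>carrier := R\<rparr>\<^esub> = C" if "C \<in> E" for C
      using that cN sS by (auto simp: E_def coset_mult_assoc)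
    show "C #> inv (g \<otimes>\<^bsub>G\<lparr>carrier := R\<rparr>\<^esub> h) = C #> inv h #> inv g"
      if "g \<in> carrier (G\<lparr>carrier := R\<rparr>)" "h \<in> carrier (G\<lparr>carrier := R\<rparr>)" "C \<in> E" for g h C
    proof -
      have "C \<subseteq> carrier G" "g \<in> carrier G" "h \<in> carrier G"
        using that cN sS R subgroup.mem_carrier[OF R(1)] by (auto simp: E_def r_coset_def)
      then show ?thesis by (simp add: inv_mult_group coset_mult_assoc)
    qed
  qed (use R.is_group p cE in auto)
  then obtain x where x: "x \<in> N" "\<forall>g\<in>R. S #> x #> inv g = S #> x" by (auto simp: E_def)
  have "x \<otimes> g \<otimes> inv x \<in> S" if g: "g \<in> R" for g
  proof -
    have c: "g \<in> carrier G" "x \<in> carrier G" using g R x cN by auto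
    have "S #> (x \<otimes> inv g) = S #> x" using bspec[OF x(2) g] c sS by (simp add: coset_mult_assoc)
    then have "x \<in> S #> (x \<otimes> inv g)" using c S(1) rcos_self by metis
    then obtain s where s: "s \<in> S" "x = s \<otimes> (x \<otimes> inv g)" by (auto simp: r_coset_def)
    have "x \<otimes> g = s \<otimes> x" using s c sS by (metis inv_closed inv_solve_right m_assoc m_closed subsetD)
    then have "x \<otimes> g \<otimes> inv x = s" using s c sS by (simp add: subset_eq m_assoc)
    then show ?thesis using s by simp
  qed
  then show ?thesis using x by blast
qed

text \<open>Conjugation acts on the \<open>p\<^sup>a - 1\<close> elements different from \<open>\<one>\<close>.\<close>
lemma p_group_centre_nontrivial:
  assumes p: "Factorial_Ring.prime p" and S: "subgroup S G" "card S = p ^ a" "S \<noteq> {\<one>}"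
  shows "\<exists>z\<in>S. z \<noteq> \<one> \<and> (\<forall>s\<in>S. s \<otimes> z = z \<otimes> s)"
proof -
  note cS = subgroup.mem_carrier[OF S(1)]
  interpret S: group "G\<lparr>carrier := S\<rparr>" using S subgroup_imp_group by blast
  have fS: "finite S" "\<one> \<in> S" using S subgroup_finite subgroup.one_closed by auto
  have "a \<noteq> 0"
  proof
    assume "a = 0"
    then obtain y where "S = {y}" using S(2) card_1_singletonE by auto
    then show False using fS S(3) by auto
  qed
  then have "p dvd card S" using S by simp
  moreover have "card S = card (S - {\<one>}) + 1" using card.remove[OF fS] by simp
  ultimately have dvd1: "p dvd card (S - {\<one>}) + 1" by metis
  have ndvd: "\<not> p dvd card (S - {\<one>})"
  proof
    assume "p dvd card (S - {\<one>})"
    with dvd1 have "p dvd 1" by (metis dvd_add_right_iff)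
    with p(1) show False by (meson not_prime_unit)
  qed
  have "\<exists>z\<in>S - {\<one>}. \<forall>g\<in>carrier (G\<lparr>carrier := S\<rparr>). g \<otimes> z \<otimes> inv g = z"
  proof (rule p_group_fixed_point[where p = p and a = a])
    show "g \<otimes> x \<otimes> inv g \<in> S - {\<one>}" if "g \<in> carrier (G\<lparr>carrier := S\<rparr>)" "x \<in> S - {\<one>}" for g x
      using that S cS conj_one_iff[of g x] by (auto simp: subgroup.m_closed subgroup.m_inv_closed)
    show "(g \<otimes>\<^bsub>G\<lparr>carrier := S\<rparr>\<^esub> h) \<otimes> x \<otimes> inv (g \<otimes>\<^bsub>G\<lparr>carrier := S\<rparr>\<^esub> h) = g \<otimes> (h \<otimes> x \<otimes> inv h) \<otimes> inv g"
      if "g \<in> carrier (G\<lparr>carrier := S\<rparr>)" "h \<in> carrier (G\<lparr>carrier := S\<rparr>)" "x \<in> S - {\<one>}" for g h x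
      using that cS by (simp add: conj_by_mult)
  qed (use S.is_group p fS S ndvd cS in \<open>auto simp: order_def\<close>)
  then show ?thesis using conj_eq_iff_commute cS by auto
qed

text \<open>The conjugate of \<open>S\<close> by \<open>g\<close> is a Sylow subgroup of \<open>N\<close> again, hence conjugate to \<open>S\<close> in \<open>N\<close>.\<close>
lemma frattini:
  assumes p: "Factorial_Ring.prime p" and N: "N \<lhd> G"
    and S: "subgroup S G" "S \<subseteq> N" "card S = p ^ a" "\<not> p dvd card N div card S"
    and g: "g \<in> carrier G"
  shows "\<exists>n\<in>N. n \<otimes> g \<in> normaliser S"
proof -
  have sN: "subgroup N G" using N normal_imp_subgroup by blast
  note cS = subgroup.mem_carrier[OF S(1)] and cN = subgroup.mem_carrier[OF sN]
  define R where "R = (\<lambda>s. g \<otimes> s \<otimes> inv g) ` S"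
  have "inj_on (\<lambda>s. g \<otimes> s \<otimes> inv g) S" using g cS by (auto intro!: inj_onI)
  then have "card R = p ^ a" using S by (simp add: R_def card_image)
  moreover have "subgroup R G"
  proof (rule subgroup_of_mult_closed)
    show "\<one> \<in> R" unfolding R_def using g S(1) subgroup.one_closed by (intro image_eqI[of _ _ \<one>]) auto
    show "x \<otimes> y \<in> R" if "x \<in> R" "y \<in> R" for x y
      using that g cS S(1) conj_mult[OF g, symmetric] by (auto simp: R_def subgroup.m_closed)
  qed (use g cS in \<open>auto simp: R_def\<close>)
  moreover have "R \<subseteq> N" using S(2) g N normal_invE(2) by (auto simp: R_def)
  ultimately obtain x where x: "x \<in> N" "\<forall>r\<in>R. x \<otimes> r \<otimes> inv x \<in> S"
    using sylow_conjugate[OF p sN S(1,2,4)] by blast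
  have "x \<otimes> g \<in> normaliser S"
    using x g cS cN conj_by_mult[of x g] by (auto simp: normaliser_def R_def)
  then show ?thesis using x(1) by blast
qed

end

section \<open>Surjective homomorphisms and quotients\<close>

locale surj_hom = G: finite_group G + H: finite_group H
  for G (structure) and H (structure) +
  fixes h
  assumes hom: "h \<in> hom G H" and surj: "h ` carrier G = carrier H"

sublocale surj_hom \<subseteq> group_hom G H h
  by (intro group_hom.intro group_hom_axioms.intro hom G.is_group H.is_group)

context surj_hom
begin

abbreviation Ker where "Ker \<equiv> kernel G H h"

definition pre where "pre A = {g \<in> carrier G. h g \<in> A}"

lemma pre_mem: "g \<in> pre A \<longleftrightarrow> g \<in> carrier G \<and> h g \<in> A"
  by (simp add: pre_def)

lemma pre_subgroup: "subgroup A H \<Longrightarrow> subgroup (pre A) G"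
  by (rule G.subgroup_of_mult_closed) (auto simp: pre_def subgroup.m_closed subgroup.one_closed)

lemma pre_normal: "A \<lhd> H \<Longrightarrow> pre A \<lhd> G"
  using pre_subgroup by (intro G.normal_invI) (auto simp: pre_def H.normal_inv_iff)

lemma image_pre: "A \<subseteq> carrier H \<Longrightarrow> h ` pre A = A"
  using surj by (fastforce simp: pre_def)

lemma Ker_subset_pre: "subgroup A H \<Longrightarrow> Ker \<subseteq> pre A"
  by (auto simp: pre_def kernel_def subgroup.one_closed)

lemma h_eq_iff:
  assumes "x \<in> carrier G" "y \<in> carrier G"
  shows "h x = h y \<longleftrightarrow> x \<otimes> inv y \<in> Ker"
  using assms H.inv_solve_right'[of "\<one>\<^bsub>H\<^esub>" "h x" "h y"] by (auto simp: kernel_def)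

lemma pre_image:
  assumes "subgroup B G" "Ker \<subseteq> B"
  shows "pre (h ` B) = B"
proof
  show "pre (h ` B) \<subseteq> B"
  proof
    fix x assume "x \<in> pre (h ` B)"
    then obtain b where b: "x \<in> carrier G" "b \<in> B" "h x = h b" by (auto simp: pre_def)
    have bc: "b \<in> carrier G" using assms b subgroup.mem_carrier by fast
    then have "x \<otimes> inv b \<in> B" using b h_eq_iff[of x b] assms(2) by blast
    then have "x \<otimes> inv b \<otimes> b \<in> B" using assms(1) b subgroup.m_closed by metis
    then show "x \<in> B" using b bc by (simp add: G.m_assoc)
  qed
qed (use assms subgroup.mem_carrier in \<open>fastforce simp: pre_def\<close>)

lemma image_subgroup: "subgroup B G \<Longrightarrow> subgroup (h ` B) H"
  by (rule subgroup_img_is_subgroup)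

lemma image_normal:
  assumes "B \<lhd> G" shows "h ` B \<lhd> H"
proof (rule H.normal_invI)
  show "subgroup (h ` B) H" using assms image_subgroup normal_imp_subgroup by blast
  fix x y assume "x \<in> carrier H" "y \<in> h ` B"
  then obtain g b where gb: "g \<in> carrier G" "x = h g" "b \<in> B" "y = h b" using surj by blast
  have "b \<in> carrier G" using gb assms normal_imp_subgroup subgroup.mem_carrier by metis
  then have "x \<otimes>\<^bsub>H\<^esub> y \<otimes>\<^bsub>H\<^esub> inv\<^bsub>H\<^esub> x = h (g \<otimes> b \<otimes> inv g)" using gb by simp
  then show "x \<otimes>\<^bsub>H\<^esub> y \<otimes>\<^bsub>H\<^esub> inv\<^bsub>H\<^esub> x \<in> h ` B" using gb assms G.normal_invE(2) by blast
qed

lemma card_image: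
  assumes "subgroup B G"
  shows "card (h ` B) * card (B \<inter> Ker) = card B"
proof -
  interpret B: group_hom "G\<lparr>carrier := B\<rparr>" "H\<lparr>carrier := h ` B\<rparr>" h
    using assms image_subgroup G.subgroup_imp_group H.subgroup_imp_group subgroup.mem_carrier[OF assms]
    by (intro group_hom.intro group_hom_axioms.intro homI) auto
  have k: "kernel (G\<lparr>carrier := B\<rparr>) (H\<lparr>carrier := h ` B\<rparr>) h = B \<inter> Ker"
    using assms subgroup.mem_carrier by (fastforce simp: kernel_def)
  have "(G\<lparr>carrier := B\<rparr>) Mod (B \<inter> Ker) \<cong> H\<lparr>carrier := h ` B\<rparr>"
    using B.FactGroup_iso k by simp
  then have "card (rcosets\<^bsub>G\<lparr>carrier := B\<rparr>\<^esub> (B \<inter> Ker)) = card (h ` B)"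
    using iso_same_card by (fastforce simp: FactGroup_def)
  then show ?thesis
    using B.G.lagrange[OF B.subgroup_kernel] k by (simp add: order_def)
qed

lemma card_pre:
  assumes "subgroup A H" shows "card (pre A) = card A * card Ker"
  using card_image[OF pre_subgroup[OF assms]] image_pre[of A] Ker_subset_pre[OF assms]
    subgroup.subset[OF assms] by (simp add: Int_absorb1)

lemma order_eq: "order G = order H * card Ker"
  using card_image[OF G.subgroup_self] surj by (simp add: order_def Int_absorb1 kernel_def subset_eq)

lemma hom_pi_elements: "x \<in> G.pi_elements \<pi> \<Longrightarrow> h x \<in> H.pi_elements \<pi>"
  unfolding G.pi_elements_def H.pi_elements_def by (auto simp flip: hom_nat_pow)

text \<open>The \<open>\<pi>\<close>-part of an arbitrary preimage is a preimage as well.\<close>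
lemma lift_pi_element:
  assumes "y \<in> H.pi_elements \<pi>"
  shows "\<exists>x\<in>G.pi_elements \<pi>. h x = y"
proof -
  have "y \<in> h ` carrier G" using H.pi_elements_carrier[OF assms] surj by simp
  then obtain x where x: "x \<in> carrier G" "h x = y" by blast
  obtain m m' where m: "x [^] (m::nat) \<in> G.pi_elements \<pi>" "x [^] (m'::nat) \<in> G.pi_elements (- \<pi>)"
    "x = x [^] m \<otimes> x [^] m'" using G.pi_decomposition[OF x(1)] by blast
  have "h (x [^] m') \<in> H.pi_elements (- \<pi>)" using m(2) hom_pi_elements by blast
  moreover have "h (x [^] m') = y [^]\<^bsub>H\<^esub> m'" using x by (simp add: hom_nat_pow)
  ultimately have "h (x [^] m') = \<one>\<^bsub>H\<^esub>"
    using H.pi_elements_pow[OF assms] H.pi_elements_disjoint[of _ \<pi> "- \<pi>"] by simp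
  then have "h (x [^] m \<otimes> x [^] m') = h (x [^] m)" using x(1) by simp
  then show ?thesis using m x by metis
qed

end

text \<open>Coset representatives realise a quotient on the element type of the group itself. An induction over
quotients needs this, since types are fixed in an induction; so does the definition of
\<open>\<sigma>\<close>-nilpotency, whose direct factors live on that type.\<close>
lemma (in finite_group) quotient_on_same_type:
  assumes "N \<lhd> G"
  shows "\<exists>(Q :: 'a monoid) h. surj_hom G Q h \<and> kernel G Q h = N"
proof -
  interpret N: normal N G by fact
  define h where "h x = (SOME y. y \<in> N #> x)" for x
  define U :: "'a monoid" where "U = \<lparr>carrier = UNIV, monoid.mult = (\<lambda>x y. h (x \<otimes> y)), one = \<one>\<rparr>"
  have h: "h x \<in> N #> x" if "x \<in> carrier G" for x
    unfolding h_def using rcos_self[OF that N.is_subgroup] by (rule someI)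
  have hc: "h x \<in> carrier G" if "x \<in> carrier G" for x
    using h[OF that] that N.subset r_coset_subset_G by blast
  have coset: "N #> h x = N #> x" if "x \<in> carrier G" for x
    using repr_independence[OF h[OF that] that N.is_subgroup] by simp
  have h_cong: "h x = h y \<longleftrightarrow> N #> x = N #> y" if "x \<in> carrier G" "y \<in> carrier G" for x y
    using coset that by (metis h_def)
  have hom: "h \<in> hom G U"
  proof (rule homI)
    fix x y assume xy: "x \<in> carrier G" "y \<in> carrier G"
    have "N #> (h x \<otimes> h y) = (N #> x) <#> (N #> y)"
      using xy hc N.rcos_sum[of "h x" "h y"] coset by simp
    also have "\<dots> = N #> (x \<otimes> y)" using xy N.rcos_sum by simp
    finally show "h (x \<otimes> y) = h x \<otimes>\<^bsub>U\<^esub> h y" using xy hc h_cong by (simp add: U_def)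
  qed (simp add: U_def)
  define Q where "Q = U\<lparr>carrier := h ` carrier G, one := h \<one>\<rparr>"
  have Q: "group Q" unfolding Q_def by (rule hom_imp_img_group[OF hom])
  then have "surj_hom G Q h"
    using hom by (intro surj_hom.intro surj_hom_axioms.intro finite_group.intro finite_group_axioms.intro)
      (auto simp: Q_def hom_def)
  moreover have "kernel G Q h = N"
  proof -
    have "h x = h \<one> \<longleftrightarrow> x \<in> N" if "x \<in> carrier G" for x
      using h_cong[OF that one_closed] that N.subset N.is_subgroup
      by (simp add: coset_mult_one) (metis coset_join1 coset_join2)
    then show ?thesis using N.subset by (auto simp: kernel_def Q_def)
  qed
  ultimately show ?thesis by blast
qed

section \<open>The Schur-Zassenhaus theorem\<close>

text \<open>Choose representatives \<open>r\<close> of the cosets of \<open>N\<close>, write \<open>g r(C) = c(g, C) r(g C)\<close> and let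
\<open>\<phi>(g)\<close> be the product of the \<open>c(g, C)\<close> over all cosets \<open>C\<close>. Then \<open>\<phi>\<close> is a crossed homomorphism
into \<open>N\<close> that restricts to the power map with exponent \<open>|G : N|\<close> on \<open>N\<close>. This power map is
bijective on \<open>N\<close>, so the kernel of \<open>\<phi>\<close> is a complement.\<close>
lemma (in finite_group) abelian_normal_hall_complement:
  assumes N: "N \<lhd> G" and comm: "\<And>x y. x \<in> N \<Longrightarrow> y \<in> N \<Longrightarrow> x \<otimes> y = y \<otimes> x"
    and cop: "coprime (card N) (order G div card N)"
  shows "\<exists>C. subgroup C G \<and> N \<inter> C = {\<one>} \<and> card C = order G div card N"
proof -
  interpret N: normal N G by fact
  have sN: "subgroup N G" by (rule N.is_subgroup)
  note cN = subgroup.mem_carrier[OF sN] and mN = subgroup.m_closed[OF sN] and iN = subgroup.m_inv_closed[OF sN]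
  let ?GN = "G\<lparr>carrier := N\<rparr>"
  interpret GN: comm_group ?GN
    using comm subgroup_imp_group[OF sN] by (intro group.group_comm_groupI) auto
  define Q where "Q = (\<lambda>x. N #> x) ` carrier G"
  define r where "r C = (SOME x. x \<in> C)" for C :: "'a set"
  have r: "r C \<in> carrier G \<and> C = N #> r C" if C: "C \<in> Q" for C
  proof -
    obtain x where x: "x \<in> carrier G" "C = N #> x" using C by (auto simp: Q_def)
    have "r C \<in> C" unfolding r_def using rcos_self[OF x(1) sN] x(2) by (metis someI)
    then show ?thesis using x repr_independence[of "r C" N x] sN r_coset_subset_G[OF N.subset] by auto
  qed
  have gC: "g <# C = N #> (g \<otimes> r C)" "g <# C \<in> Q" if "C \<in> Q" "g \<in> carrier G" for g C
  proof -
    have "g <# C = g <# (r C <# N)" using r[OF that(1)] N.coset_eq by metis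
    also have "\<dots> = (g \<otimes> r C) <# N" using r[OF that(1)] that N.subset by (simp add: lcos_m_assoc)
    also have "\<dots> = N #> (g \<otimes> r C)" using r[OF that(1)] that N.coset_eq by (metis m_closed)
    finally show "g <# C = N #> (g \<otimes> r C)" .
    then show "g <# C \<in> Q" using r[OF that(1)] that by (auto simp: Q_def)
  qed
  have finQ: "finite Q" by (simp add: Q_def)
  define c where "c g C = g \<otimes> r C \<otimes> inv (r (g <# C))" for g C
  have c: "c g C \<in> N" if "C \<in> Q" "g \<in> carrier G" for g C
  proof -
    have "N #> (g \<otimes> r C) = N #> r (g <# C)" using r[OF gC(2)[OF that]] gC(1)[OF that] by simp
    then have "g \<otimes> r C \<in> N #> r (g <# C)"
      using rcos_self[of "g \<otimes> r C" N] sN r[OF that(1)] that(2) by auto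
    then show ?thesis unfolding c_def using r[OF gC(2)[OF that]] r[OF that(1)] that(2)
      by (intro N.rcos_module_imp[OF is_group]) auto
  qed
  define \<phi> where "\<phi> g = finprod ?GN (c g) Q" for g
  have \<phi>N: "\<phi> g \<in> N" if "g \<in> carrier G" for g
    using GN.finprod_closed[of "c g" Q] c that by (auto simp: \<phi>_def)
  have conj_prod: "finprod ?GN (\<lambda>C. g \<otimes> f C \<otimes> inv g) A = g \<otimes> finprod ?GN f A \<otimes> inv g"
    if "g \<in> carrier G" "finite A" "f \<in> A \<rightarrow> N" for g A and f :: "'a set \<Rightarrow> 'a"
    using that(2,3)
  proof (induction A rule: finite_induct)
    case empty
    then show ?case using that by simp
  next
    case (insert C A)
    have "finprod ?GN f A \<in> N" using GN.finprod_closed[of f A] insert by auto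
    moreover have "(\<lambda>C. g \<otimes> f C \<otimes> inv g) \<in> A \<rightarrow> N" "g \<otimes> f C \<otimes> inv g \<in> N"
      using insert that N.inv_op_closed2 by auto
    ultimately show ?case using insert that cN by (simp add: conj_mult)
  qed
  \<comment> \<open>Left translation by \<open>k\<close> permutes the cosets, which reindexes the second factor.\<close>
  have crossed: "\<phi> (g \<otimes> k) = (g \<otimes> \<phi> k \<otimes> inv g) \<otimes> \<phi> g" if gk: "g \<in> carrier G" "k \<in> carrier G" for g k
  proof -
    have bij: "inj_on (\<lambda>C. k <# C) Q" "(\<lambda>C. k <# C) ` Q = Q"
    proof -
      show inj: "inj_on (\<lambda>C. k <# C) Q"
      proof (rule inj_onI)
        fix C D assume *: "C \<in> Q" "D \<in> Q" "k <# C = k <# D"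
        then have "C \<subseteq> carrier G" "D \<subseteq> carrier G" using r_coset_subset_G[OF N.subset] by (auto simp: Q_def)
        then show "C = D" using * gk lcos_m_assoc[of _ "inv k" k] lcos_mult_one by (metis inv_closed l_inv)
      qed
      show "(\<lambda>C. k <# C) ` Q = Q"
        using gC(2) gk finQ inj by (intro endo_inj_surj) auto
    qed
    have "\<phi> (g \<otimes> k) = finprod ?GN (\<lambda>C. (g \<otimes> c k C \<otimes> inv g) \<otimes>\<^bsub>?GN\<^esub> c g (k <# C)) Q"
      unfolding \<phi>_def
    proof (rule GN.finprod_cong')
      show "(\<lambda>C. (g \<otimes> c k C \<otimes> inv g) \<otimes>\<^bsub>?GN\<^esub> c g (k <# C)) \<in> Q \<rightarrow> carrier ?GN"
        using c gC(2) gk N.inv_op_closed2 mN by auto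
      fix C assume C: "C \<in> Q"
      note rr = r[OF C] r[OF gC(2)[OF C gk(2)]] r[OF gC(2)[OF gC(2)[OF C gk(2)] gk(1)]]
      have "C \<subseteq> carrier G" using C r_coset_subset_G[OF N.subset] by (auto simp: Q_def)
      then have "(g \<otimes> k) <# C = g <# (k <# C)" using gk by (simp add: lcos_m_assoc)
      then show "c (g \<otimes> k) C = (g \<otimes> c k C \<otimes> inv g) \<otimes>\<^bsub>?GN\<^esub> c g (k <# C)"
        unfolding c_def using rr gk by (simp add: m_assoc inv_solve_left inv_solve_left')
    qed simp
    also have "\<dots> = finprod ?GN (\<lambda>C. g \<otimes> c k C \<otimes> inv g) Q \<otimes> finprod ?GN (\<lambda>C. c g (k <# C)) Q"
      using c gC(2) gk N.inv_op_closed2 by (subst GN.finprod_multf) auto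
    also have "finprod ?GN (\<lambda>C. g \<otimes> c k C \<otimes> inv g) Q = g \<otimes> \<phi> k \<otimes> inv g"
      unfolding \<phi>_def using c gk finQ by (intro conj_prod) auto
    also have "finprod ?GN (\<lambda>C. c g (k <# C)) Q = \<phi> g"
      unfolding \<phi>_def using GN.finprod_reindex[of "c g" "\<lambda>C. k <# C" Q] bij c gk by auto
    finally show ?thesis .
  qed
  have onN: "\<phi> g = g [^] card Q" if g: "g \<in> N" for g
  proof -
    have "\<phi> g = finprod ?GN (\<lambda>C. g) Q"
      unfolding \<phi>_def
    proof (rule GN.finprod_cong')
      fix C assume C: "C \<in> Q"
      have "g \<otimes> r C \<in> N #> r C" using g r[OF C] by (auto simp: r_coset_def)
      then have "N #> (g \<otimes> r C) = N #> r C" using r[OF C] repr_independence sN by metis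
      then have "g <# C = C" using gC(1)[OF C] g cN r[OF C] by simp
      then show "c g C = g" using g cN r[OF C] by (simp add: c_def m_assoc)
    qed (use g in auto)
    also have "\<dots> = g [^] card Q" using GN.finprod_const[of g Q] g nat_pow_consistent by auto
    finally show ?thesis .
  qed
  have cardQ: "card Q * card N = order G"
    using subgroup_r_cosets_card[OF sN subgroup_self] N.subset by (simp add: Q_def order_def)
  then have cardQ': "card Q = order G div card N" using card_subgroup_pos[OF sN] by (metis div_mult_self_is_m)
  have root: "\<exists>j::nat. (x [^] card Q) [^] j = x" if "x \<in> N" for x
  proof -
    have "x [^] card N = \<one>"
      using GN.pow_order_eq_1[of x] that by (simp add: order_def nat_pow_consistent[symmetric])
    then show ?thesis
      using pow_coprime_generates[of x "card N" "card Q"] that cN cop cardQ' card_subgroup_pos[OF sN]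
      by (auto simp: coprime_commute)
  qed
  define C where "C = {g \<in> carrier G. \<phi> g = \<one>}"
  have sC: "subgroup C G"
  proof (rule subgroup_of_mult_closed)
    show "\<one> \<in> C" using onN[OF N.one_closed] by (simp add: C_def)
    show "x \<otimes> y \<in> C" if "x \<in> C" "y \<in> C" for x y using that crossed by (auto simp: C_def)
  qed (auto simp: C_def)
  have int: "N \<inter> C = {\<one>}"
  proof -
    have "x = \<one>" if "x \<in> N" "x \<in> C" for x
      using root[OF that(1)] onN[OF that(1)] that(2) by (auto simp: C_def)
    then show ?thesis using N.one_closed sC subgroup.one_closed by blast
  qed
  have "N <#> C = carrier G"
  proof
    show "carrier G \<subseteq> N <#> C"
    proof
      fix g assume g: "g \<in> carrier G"
      let ?a = "inv (\<phi> g)"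
      have a: "?a \<in> N" using \<phi>N[OF g] iN by simp
      obtain j :: nat where j: "(?a [^] card Q) [^] j = ?a" using root[OF a] by blast
      define n where "n = ?a [^] j"
      have n: "n \<in> N" unfolding n_def using subgroup_pow_closed[OF sN a] .
      have "\<phi> n = ?a" using onN[OF n] j a cN by (simp add: n_def nat_pow_pow mult.commute)
      then have "\<phi> (n \<otimes> g) = n \<otimes> \<phi> g \<otimes> inv n \<otimes> ?a" using crossed[of n g] n g cN by simp
      also have "n \<otimes> \<phi> g \<otimes> inv n = \<phi> g"
        using comm[OF n \<phi>N[OF g]] conj_eq_iff_commute[OF cN[OF n] cN[OF \<phi>N[OF g]]] by simp
      also have "\<phi> g \<otimes> ?a = \<one>" using \<phi>N[OF g] cN by simp
      finally have "n \<otimes> g \<in> C" using n g cN by (simp add: C_def)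
      moreover have "g = inv n \<otimes> (n \<otimes> g)" using n g cN by (simp add: m_assoc[symmetric])
      ultimately show "g \<in> N <#> C" using iN[OF n] unfolding set_mult_def by blast
    qed
  qed (use setmult_subset_G N.subset sC subgroup.subset in blast)
  then have "order G = card N * card C"
    using card_set_mult[OF sN sC] int by (simp add: order_def)
  then show ?thesis using sC int card_subgroup_pos[OF sN] by auto
qed

lemma (in finite_group) normal_restrict:
  assumes "N \<lhd> G" "subgroup J G"
  shows "N \<inter> J \<lhd> G\<lparr>carrier := J\<rparr>"
  using normal_Int_subgroup[OF assms(2,1)] by (simp add: Int_commute)

text \<open>If \<open>G = N J\<close>, then a complement of \<open>N \<inter> J\<close> in \<open>J\<close> is a complement of \<open>N\<close> in \<open>G\<close>. The
factorisation is stated through cardinalities, which is the form in which it arises.\<close>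
lemma (in finite_group) complement_from_supplement:
  assumes N: "N \<lhd> G" and J: "subgroup J G" "card J * card N = order G * card (N \<inter> J)"
    and C: "subgroup C (G\<lparr>carrier := J\<rparr>)" "N \<inter> J \<inter> C = {\<one>}" "card C = card J div card (N \<inter> J)"
  shows "subgroup C G \<and> N \<inter> C = {\<one>} \<and> card C = order G div card N"
proof -
  have sN: "subgroup N G" using N normal_imp_subgroup by blast
  have 1: "subgroup C G" "C \<subseteq> J" using incl_subgroup[OF J(1) C(1)] subgroup.subset[OF C(1)] by auto
  have 2: "subgroup (N \<inter> J) G" using subgroups_Inter_pair[OF sN J(1)] .
  have "card N dvd order G" using card_subgroup_dvd[OF sN subgroup_self] subgroup.subset[OF sN] by (simp add: order_def)
  then obtain i where i: "order G = card N * i" by blast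
  have "card J = i * card (N \<inter> J)"
    using J(2) i card_subgroup_pos[OF sN] by (simp add: algebra_simps)
  then have "card C = i" using C(3) card_subgroup_pos[OF 2] by simp
  then show ?thesis using 1 C(2) i card_subgroup_pos[OF sN] by auto
qed

text \<open>If some Sylow subgroup \<open>S\<close> of \<open>N\<close> is not normal in \<open>G\<close>, its normaliser is a proper supplement of \<open>N\<close>
by the Frattini argument. Otherwise the centre \<open>Z\<close> of \<open>S\<close> is a nontrivial abelian normal subgroup of
\<open>G\<close>: either \<open>Z = N\<close>, which is the abelian case, or a complement in \<open>G/Z\<close> gives a proper
supplement \<open>J\<close> with \<open>N \<inter> J = Z\<close>.\<close>
lemma schur_zassenhaus_step:
  fixes G :: "'a monoid" (structure)
  assumes "finite_group G" and N: "N \<lhd> G" and cop: "coprime (card N) (order G div card N)"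
    and IH: "\<And>(K :: 'a monoid) N. order K < order G \<Longrightarrow> finite_group K \<Longrightarrow> N \<lhd> K \<Longrightarrow>
      coprime (card N) (order K div card N) \<Longrightarrow>
      \<exists>C. subgroup C K \<and> N \<inter> C = {\<one>\<^bsub>K\<^esub>} \<and> card C = order K div card N"
  shows "\<exists>C. subgroup C G \<and> N \<inter> C = {\<one>} \<and> card C = order G div card N"
proof -
  interpret finite_group G by fact
  have sN: "subgroup N G" using N normal_imp_subgroup by blast
  note posN = card_subgroup_pos[OF sN]
  have supp: ?thesis
    if J: "subgroup J G" "J \<noteq> carrier G" "card J * card N = order G * card (N \<inter> J)" for J
  proof -
    let ?J = "G\<lparr>carrier := J\<rparr>"
    have sM: "subgroup (N \<inter> J) G" using subgroups_Inter_pair[OF sN J(1)] .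
    have lt: "order ?J < order G"
      using J(1,2) subgroup.subset[OF J(1)] by (simp add: order_def psubset_card_mono psubset_eq)
    have "card (N \<inter> J) dvd card N" using card_subgroup_dvd[OF sM sN] by blast
    moreover have "card J div card (N \<inter> J) = order G div card N"
      using J(3) posN card_subgroup_pos[OF sM]
      by (metis card_subgroup_dvd sM J(1) inf_le2 dvd_div_eq_mult dvd_mult_div_cancel div_mult_mult1 less_not_refl mult.commute nonzero_mult_div_cancel_left div_mult_mult2)
    ultimately have "coprime (card (N \<inter> J)) (order ?J div card (N \<inter> J))"
      using cop coprime_divisors[OF _ dvd_refl] by (metis order_def partial_object.select_convs(1) partial_object.surjective partial_object.update_convs(1))
    then obtain C where "subgroup C ?J" "N \<inter> J \<inter> C = {\<one>}" "card C = card J div card (N \<inter> J)"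
      using IH[OF lt subgroup_finite_group[OF J(1)] normal_restrict[OF N J(1)]]
      by (auto simp: order_def)
    then show ?thesis using complement_from_supplement[OF N J(1,3)] by blast
  qed
  show ?thesis
  proof (cases "N = {\<one>}")
    case True
    then show ?thesis using subgroup_self by (intro exI[of _ "carrier G"]) (auto simp: order_def)
  next
    case False
    then have "card N \<noteq> 1"
      using subgroup.one_closed[OF sN] by (metis card_1_singletonE singletonD)
    then obtain p where p: "Factorial_Ring.prime p" "p dvd card N" using prime_factor_nat by blast
    obtain S a m where S: "subgroup S G" "S \<subseteq> N" "card S = p ^ a" "card N = p ^ a * m" "\<not> p dvd m"
      using sylow_subgroup[OF p(1) sN] by blast
    have ind: "\<not> p dvd card N div card S" using S p(1) prime_gt_0_nat by simp
    show ?thesis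
    proof (cases "S \<lhd> G")
      case notnormal: False
      define J where "J = normaliser S"
      have sJ: "subgroup J G" unfolding J_def using normaliser_subgroup S(1) subgroup.subset by blast
      have neq: "J \<noteq> carrier G" using notnormal normal_iff_normaliser[OF S(1)] by (auto simp: J_def)
      have "N <#> J = carrier G"
      proof
        show "carrier G \<subseteq> N <#> J"
        proof
          fix g assume g: "g \<in> carrier G"
          obtain n where n: "n \<in> N" "n \<otimes> g \<in> J"
            using frattini[OF p(1) N S(1,2,3) ind g] unfolding J_def by blast
          have "n \<in> carrier G" using n(1) subgroup.mem_carrier[OF sN] by blast
          then have "g = inv n \<otimes> (n \<otimes> g)" using g by (simp add: m_assoc[symmetric])
          then show "g \<in> N <#> J"
            using n subgroup.m_inv_closed[OF sN n(1)] unfolding set_mult_def by blast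
        qed
      qed (use setmult_subset_G sN sJ subgroup.subset in blast)
      then have "card J * card N = order G * card (N \<inter> J)"
        using card_set_mult[OF sN sJ] by (simp add: order_def mult.commute)
      then show ?thesis using supp[OF sJ neq] by blast
    next
      case normal: True
      define Z where "Z = {z \<in> S. \<forall>s\<in>S. s \<otimes> z = z \<otimes> s}"
      note cS = subgroup.mem_carrier[OF S(1)]
      have sZ: "subgroup Z G"
      proof (rule subgroup_of_mult_closed)
        show "\<one> \<in> Z" using S(1) cS by (auto simp: Z_def subgroup.one_closed)
        fix x y assume xy: "x \<in> Z" "y \<in> Z"
        have "s \<otimes> (x \<otimes> y) = x \<otimes> y \<otimes> s" if "s \<in> S" for s
        proof -
          have c: "x \<in> carrier G" "y \<in> carrier G" "s \<in> carrier G" and e: "s \<otimes> x = x \<otimes> s" "s \<otimes> y = y \<otimes> s"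
            using xy that cS by (auto simp: Z_def)
          have "s \<otimes> (x \<otimes> y) = (s \<otimes> x) \<otimes> y" using c by (simp only: m_assoc)
          also have "\<dots> = x \<otimes> (s \<otimes> y)" unfolding e(1) using c by (simp only: m_assoc)
          also have "\<dots> = x \<otimes> y \<otimes> s" unfolding e(2) using c by (simp only: m_assoc)
          finally show ?thesis .
        qed
        moreover have "x \<otimes> y \<in> S" using xy subgroup.m_closed[OF S(1)] unfolding Z_def by blast
        ultimately show "x \<otimes> y \<in> Z" unfolding Z_def by blast
      qed (auto simp: Z_def cS)
      have nZ: "Z \<lhd> G"
      proof (rule normal_invI[OF sZ])
        fix g z assume gz: "g \<in> carrier G" "z \<in> Z"
        have z: "z \<in> S" "z \<in> carrier G" using gz cS by (auto simp: Z_def)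
        have "s \<otimes> (g \<otimes> z \<otimes> inv g) = (g \<otimes> z \<otimes> inv g) \<otimes> s" if s: "s \<in> S" for s
        proof -
          define t where "t = inv g \<otimes> s \<otimes> g"
          have t: "t \<in> S" unfolding t_def
            using normal.inv_op_closed1[OF normal gz(1) s] .
          have seq: "s = g \<otimes> t \<otimes> inv g" unfolding t_def using gz s cS conj_conj_inv(1) by simp
          have "t \<otimes> z = z \<otimes> t" using gz t by (auto simp: Z_def)
          then have "g \<otimes> (t \<otimes> z) \<otimes> inv g = g \<otimes> (z \<otimes> t) \<otimes> inv g" by simp
          then show ?thesis unfolding seq using conj_mult gz(1) t z cS by metis
        qed
        moreover have "g \<otimes> z \<otimes> inv g \<in> S" using normal_invE(2)[OF normal gz(1) z(1)] .
        ultimately show "g \<otimes> z \<otimes> inv g \<in> Z" by (simp add: Z_def)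
      qed
      have ZN: "Z \<subseteq> N" using S(2) by (auto simp: Z_def)
      have "S \<noteq> {\<one>}"
      proof
        assume "S = {\<one>}"
        then have "p ^ a = 1" using S(3) by simp
        then show False using p(2) S(4,5) by (metis mult_1)
      qed
      then obtain z where "z \<in> Z" "z \<noteq> \<one>"
        using p_group_centre_nontrivial[OF p(1) S(1,3)] by (auto simp: Z_def)
      then have cZ: "card Z > 1"
        using sZ subgroup_finite subgroup.one_closed
        by (metis One_nat_def Suc_lessI card_1_singletonE card_subgroup_pos singletonD)
      show ?thesis
      proof (cases "Z = N")
        case True
        then have "x \<otimes> y = y \<otimes> x" if "x \<in> N" "y \<in> N" for x y using that by (auto simp: Z_def)
        then show ?thesis using abelian_normal_hall_complement[OF N _ cop] by blast
      next
        case False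
        obtain Q :: "'a monoid" and h where Q: "surj_hom G Q h" "kernel G Q h = Z"
          using quotient_on_same_type[OF nZ] by blast
        interpret Q: surj_hom G Q h by (rule Q)
        have oQ: "order G = order Q * card Z" using Q.order_eq Q(2) by simp
        have cN: "card (h ` N) * card Z = card N"
          using Q.card_image[OF sN] ZN Q(2) by (simp add: Int_absorb1)
        have idx: "order Q div card (h ` N) = order G div card N"
          using oQ cN cZ by (metis div_mult_mult2 less_nat_zero_code)
        have lt: "order Q < order G" using oQ cZ order_pos
          by (metis One_nat_def n_less_m_mult_n mult.commute nat_0_less_mult_iff)
        have "coprime (card (h ` N)) (order Q div card (h ` N))"
          using cop idx cN by (metis coprime_mult_left_iff)
        then obtain C where C: "subgroup C Q" "h ` N \<inter> C = {\<one>\<^bsub>Q\<^esub>}" "card C = order G div card N"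
          using IH[OF lt Q.H.finite_group_axioms Q.image_normal[OF N]] idx by auto
        define J where "J = Q.pre C"
        have sJ: "subgroup J G" unfolding J_def using Q.pre_subgroup C by blast
        have NJ: "N \<inter> J = Z"
        proof
          show "N \<inter> J \<subseteq> Z"
            using C(2) Q(2) by (auto simp: J_def Q.pre_def kernel_def)
          show "Z \<subseteq> N \<inter> J" using ZN Q.Ker_subset_pre[OF C(1)] Q(2) by (auto simp: J_def)
        qed
        have cJ: "card J = (order G div card N) * card Z"
          unfolding J_def using Q.card_pre[OF C(1)] C(3) Q(2) by simp
        have dvdN: "card N dvd order G"
          using card_subgroup_dvd[OF sN subgroup_self] subgroup.subset[OF sN] by (simp add: order_def)
        then have eq: "card J * card N = order G * card (N \<inter> J)"
          unfolding NJ cJ by (metis dvd_div_mult_self mult.assoc mult.commute)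
        have "card Z < card N" using ZN False subgroup_finite[OF sN] by (simp add: psubset_card_mono psubset_eq)
        then have "J \<noteq> carrier G"
          using eq NJ order_pos by (auto simp: order_def)
        then show ?thesis using supp[OF sJ _ eq] by blast
      qed
    qed
  qed
qed

lemma schur_zassenhaus_monoid:
  fixes G :: "'a monoid"
  assumes "finite_group G" "N \<lhd> G" "coprime (card N) (order G div card N)"
  shows "\<exists>C. subgroup C G \<and> N \<inter> C = {\<one>\<^bsub>G\<^esub>} \<and> card C = order G div card N"
  using assms
proof (induction "order G" arbitrary: G N rule: less_induct)
  case less
  show ?case using schur_zassenhaus_step[OF less.prems] less.hyps by blast
qed

text \<open>The quotient by the trivial subgroup transports the statement from plain monoid records, to which the
induction is confined, to arbitrary extensions of them.\<close>
theorem (in finite_group) schur_zassenhaus: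
  assumes N: "N \<lhd> G" and cop: "coprime (card N) (order G div card N)"
  shows "\<exists>C. subgroup C G \<and> N \<inter> C = {\<one>} \<and> N <#> C = carrier G \<and> card C = order G div card N"
proof -
  have sN: "subgroup N G" using N normal_imp_subgroup by blast
  obtain Q :: "'a monoid" and h where Q: "surj_hom G Q h" "kernel G Q h = {\<one>}"
    using quotient_on_same_type[OF one_is_normal] by blast
  interpret Q: surj_hom G Q h by (rule Q)
  have oQ: "order G = order Q" using Q.order_eq Q(2) by simp
  have cN: "card (h ` N) = card N"
    using Q.card_image[OF sN] subgroup.one_closed[OF sN] Q(2) by (simp add: Int_absorb1)
  obtain C where C: "subgroup C Q" "h ` N \<inter> C = {\<one>\<^bsub>Q\<^esub>}" "card C = order G div card N"
    using schur_zassenhaus_monoid[OF Q.H.finite_group_axioms Q.image_normal[OF N]] cop cN oQ by auto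
  have sJ: "subgroup (Q.pre C) G" using Q.pre_subgroup C by blast
  have cJ: "card (Q.pre C) = order G div card N" using Q.card_pre[OF C(1)] C(3) Q(2) by simp
  have int: "N \<inter> Q.pre C = {\<one>}"
  proof -
    have "x = \<one>" if "x \<in> N" "x \<in> Q.pre C" for x
    proof -
      have "h x = \<one>\<^bsub>Q\<^esub>" "x \<in> carrier G" using that C(2) by (auto simp: Q.pre_def)
      then have "x \<in> kernel G Q h" by (simp add: kernel_def)
      then show ?thesis using Q(2) by simp
    qed
    then show ?thesis using subgroup.one_closed[OF sN] subgroup.one_closed[OF sJ] by blast
  qed
  have "card N dvd order G"
    using card_subgroup_dvd[OF sN subgroup_self] subgroup.subset[OF sN] by (simp add: order_def)
  then have "card (N <#> Q.pre C) = card (carrier G)"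
    using card_set_mult[OF sN sJ] int cJ by (simp add: order_def)
  moreover have "N <#> Q.pre C \<subseteq> carrier G"
    using setmult_subset_G subgroup.subset[OF sN] subgroup.subset[OF sJ] by blast
  ultimately have "N <#> Q.pre C = carrier G" by (simp add: card_subset_eq)
  then show ?thesis using sJ int cJ by blast
qed

section \<open>Hall subgroups, radicals and residuals\<close>

lemma set_mult_obtain:
  fixes G (structure)
  assumes "g \<in> A <#> B"
  obtains a b where "a \<in> A" "b \<in> B" "g = a \<otimes> b"
  using assms by (auto simp: set_mult_def)

lemma (in group) set_mult_mem: "a \<in> A \<Longrightarrow> b \<in> B \<Longrightarrow> a \<otimes> b \<in> A <#> B"
  by (auto simp: set_mult_def)

context finite_group
begin

lemma card_eq_index_mult:
  assumes "subgroup H G" "subgroup K G" "H \<subseteq> K"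
  shows "card K = card H * (card K div card H)"
  using card_subgroup_dvd[OF assms] by simp

lemma index_mult:
  assumes "subgroup H G" "subgroup K G" "subgroup L G" "H \<subseteq> K" "K \<subseteq> L"
  shows "card L div card H = (card K div card H) * (card L div card K)"
  using card_eq_index_mult[OF assms(1,2,4)] card_eq_index_mult[OF assms(2,3,5)]
    card_subgroup_pos[OF assms(1)]
  by (metis mult.assoc nonzero_mult_div_cancel_left less_not_refl)

lemma normal_Inter:
  assumes "\<N> \<noteq> {}" "\<And>N. N \<in> \<N> \<Longrightarrow> N \<lhd> G"
  shows "\<Inter>\<N> \<lhd> G"
proof (rule normal_invI)
  show "subgroup (\<Inter>\<N>) G" using assms normal_imp_subgroup by (intro subgroups_Inter) auto
qed (use assms normal_invE(2) in blast)

lemma carrier_normal: "carrier G \<lhd> G"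
  by (rule normal_invI[OF subgroup_self]) auto

lemma set_mult_normal_subgroup:
  assumes "N \<lhd> G" "subgroup H G"
  shows "subgroup (N <#> H) G" "N \<subseteq> N <#> H" "H \<subseteq> N <#> H"
proof -
  interpret second_isomorphism_grp N G H
    using assms by (simp add: second_isomorphism_grp_def second_isomorphism_grp_axioms_def)
  show "subgroup (N <#> H) G" by (rule normal_set_mult_subgroup)
  show "N \<subseteq> N <#> H" by (rule H_contained_in_set_mult)
  show "H \<subseteq> N <#> H" by (rule S_contained_in_set_mult)
qed

text \<open>The product of two normal \<open>\<pi>\<close>-subgroups is one again, so a normal \<open>\<pi>\<close>-subgroup of maximal order
contains all others and the definite description in the definition is justified.\<close>
lemma pi_core_properties:
  shows pi_core_normal: "pi_core \<pi> G \<lhd> G"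
    and pi_core_card: "pi_number \<pi> (card (pi_core \<pi> G))"
    and pi_core_greatest: "\<And>N. N \<lhd> G \<Longrightarrow> pi_number \<pi> (card N) \<Longrightarrow> N \<subseteq> pi_core \<pi> G"
proof -
  let ?P = "\<lambda>N. N \<lhd> G \<and> pi_number \<pi> (card N)"
  have P: "N \<lhd> G \<and> pi_group \<pi> (G\<lparr>carrier := N\<rparr>) \<longleftrightarrow> ?P N" for N
    using subgroup_finite_group[of N] normal_imp_subgroup[of N] card_subgroup_pos[of N]
    by (auto simp: pi_group_def pi_number_def finite_group_def finite_group_axioms_def order_def)
  have bound: "card N \<le> order G" if "?P N" for N
    using that normal_imp_subgroup[of N] subgroup.subset[of N]
    by (auto simp: order_def intro: card_mono)
  have "?P {\<one>}" using one_is_normal by simp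
  then obtain N where N: "?P N" "\<And>M. ?P M \<Longrightarrow> card M \<le> card N"
    using ex_has_greatest_nat[of ?P "{\<one>}" card "Suc (order G)"] bound by (auto simp: less_Suc_eq_le)
  have max: "M \<subseteq> N" if M: "?P M" for M
  proof -
    have sM: "subgroup M G" and sN: "subgroup N G" using M N normal_imp_subgroup by auto
    have nMN: "M <#> N \<lhd> G" using normal_subgroup_set_mult_closed M N by blast
    have sub: "N \<subseteq> M <#> N" "M \<subseteq> M <#> N" using set_mult_normal_subgroup M sN by auto
    have "card (M <#> N) dvd card M * card N"
      using card_set_mult[OF sM sN] by (metis dvd_triv_left)
    then have "pi_number \<pi> (card (M <#> N))" using M N pi_number_mult pi_number_dvd by blast
    then have "card (M <#> N) \<le> card N" using N(2) nMN by blast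
    then have "N = M <#> N"
      using sub(1) nMN normal_imp_subgroup subgroup_finite by (metis card_seteq)
    then show ?thesis using sub by blast
  qed
  have "pi_core \<pi> G = N"
    unfolding pi_core_def P using N(1) max by (intro Greatest_equality) auto
  then show "pi_core \<pi> G \<lhd> G" "pi_number \<pi> (card (pi_core \<pi> G))"
    "\<And>N. N \<lhd> G \<Longrightarrow> pi_number \<pi> (card N) \<Longrightarrow> N \<subseteq> pi_core \<pi> G"
    using N max by auto
qed

lemma hall_pi_subgroup_iff:
  "hall_pi_subgroup \<pi> G H \<longleftrightarrow>
     subgroup H G \<and> pi_number \<pi> (card H) \<and> pi_number (- \<pi>) (order G div card H)"
proof (cases "subgroup H G")
  case True
  have "0 < order G div card H"
    using card_div_subgroup_pos[OF True subgroup_self] subgroup.subset[OF True] by (simp add: order_def)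
  then show ?thesis
    using True subgroup_finite_group[OF True] card_subgroup_pos[OF True] card_rcosets_subgroup[OF True]
    by (auto simp: hall_pi_subgroup_def pi_group_def pi_number_def finite_group_def
        finite_group_axioms_def order_def)
qed (simp add: hall_pi_subgroup_def)

text \<open>The product \<open>N E\<close> is a \<open>\<pi>\<close>-group that contains the Hall subgroup \<open>E\<close>.\<close>
lemma normal_pi_subgroup_subset_hall:
  assumes E: "hall_pi_subgroup \<pi> G E" and N: "N \<lhd> G" "pi_number \<pi> (card N)"
  shows "N \<subseteq> E"
proof -
  have sE: "subgroup E G" and cE: "pi_number \<pi> (card E)" "pi_number (- \<pi>) (order G div card E)"
    using E by (auto simp: hall_pi_subgroup_iff)
  note NE = set_mult_normal_subgroup[OF N(1) sE]
  have "card (N <#> E) dvd card N * card E"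
    using card_set_mult[OF normal_imp_subgroup[OF N(1)] sE] by (metis dvd_triv_left)
  then have "pi_number \<pi> (card (N <#> E))"
    using N cE pi_number_mult pi_number_dvd by blast
  then have p1: "pi_number \<pi> (card (N <#> E) div card E)"
    using card_eq_index_mult[OF sE NE(1,3)] pi_number_dvd by (metis dvd_triv_right)
  have "order G div card E = (card (N <#> E) div card E) * (order G div card (N <#> E))"
    unfolding order_def using index_mult[OF sE NE(1) subgroup_self NE(3)] subgroup.subset[OF NE(1)] by blast
  then have p2: "pi_number (- \<pi>) (card (N <#> E) div card E)"
    using cE(2) pi_number_dvd by (metis dvd_triv_left)
  have "card (N <#> E) div card E = 1" using pi_number_both[OF p1 p2] by simp
  then have "card (N <#> E) = card E" using card_eq_index_mult[OF sE NE(1,3)] by simp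
  then have "E = N <#> E" using NE(1,3) subgroup_finite by (simp add: card_subset_eq)
  then show ?thesis using NE(2) by simp
qed

end

lemma partition_on_eq:
  "partition_on A \<sigma> \<Longrightarrow> \<pi> \<in> \<sigma> \<Longrightarrow> \<rho> \<in> \<sigma> \<Longrightarrow> p \<in> \<pi> \<Longrightarrow> p \<in> \<rho> \<Longrightarrow> \<pi> = \<rho>"
  by (auto simp: partition_on_def disjoint_def)

lemma partition_on_class:
  "partition_on A \<sigma> \<Longrightarrow> p \<in> A \<Longrightarrow> \<exists>\<pi>\<in>\<sigma>. p \<in> \<pi>"
  by (auto simp: partition_on_def)

lemma partition_on_compl:
  "partition_on A \<sigma> \<Longrightarrow> \<pi> \<in> \<sigma> \<Longrightarrow> \<rho> \<in> \<sigma> \<Longrightarrow> \<pi> \<noteq> \<rho> \<Longrightarrow> \<rho> \<subseteq> - \<pi>"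
  using partition_on_eq[of A \<sigma> \<pi> \<rho>] by auto

text \<open>A subgroup that is a Hall subgroup for two classes is trivial and therefore belongs to no class that
meets the order of \<open>G\<close>. This makes the choice of one Hall subgroup for each such class
unambiguous.\<close>
lemma (in finite_group) complete_hall_sigma_set_exists:
  assumes part: "partition_on {p. Factorial_Ring.prime p} \<sigma>"
    and hall: "\<And>\<pi>. \<pi> \<in> \<sigma> \<Longrightarrow> \<exists>H. hall_pi_subgroup \<pi> G H"
  shows "\<exists>\<H>. complete_hall_sigma_set \<sigma> G \<H>"
proof -
  obtain E where E: "\<And>\<pi>. \<pi> \<in> \<sigma> \<Longrightarrow> hall_pi_subgroup \<pi> G (E \<pi>)" using hall by metis
  have uniq: "\<pi> = \<rho>" if \<pi>: "\<pi> \<in> sigma_of_group \<sigma> G" and \<rho>: "\<rho> \<in> \<sigma>" and h: "hall_pi_subgroup \<pi> G (E \<rho>)" for \<pi> \<rho>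
  proof (rule ccontr)
    assume "\<pi> \<noteq> \<rho>"
    obtain p where p: "\<pi> \<in> \<sigma>" "p \<in> \<pi>" "p \<in> prime_factors (order G)"
      using \<pi> by (auto simp: sigma_of_group_def)
    have "\<pi> \<inter> \<rho> = {}" using partition_on_compl[OF part p(1) \<rho>] \<open>\<pi> \<noteq> \<rho>\<close> by blast
    then have "card (E \<rho>) = 1"
      using pi_number_both[of \<pi> _ \<rho>] h E[OF \<rho>] by (auto simp: hall_pi_subgroup_iff)
    then have "pi_number (- \<pi>) (order G)" using h by (simp add: hall_pi_subgroup_iff)
    then show False using p by (auto simp: pi_number_def)
  qed
  have "complete_hall_sigma_set \<sigma> G (E ` sigma_of_group \<sigma> G)"
    unfolding complete_hall_sigma_set_def
  proof (intro conjI ballI impI)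
    fix H assume "H \<in> E ` sigma_of_group \<sigma> G"
    then obtain \<pi> where \<pi>: "\<pi> \<in> \<sigma>" "H = E \<pi>" by (auto simp: sigma_of_group_def)
    show "subgroup H G" using E[OF \<pi>(1)] \<pi>(2) by (simp add: hall_pi_subgroup_iff)
    show "\<exists>\<pi>\<in>\<sigma>. hall_pi_subgroup \<pi> G H" using E \<pi> by blast
  next
    fix \<pi> assume \<pi>: "\<pi> \<in> sigma_of_group \<sigma> G"
    then have "\<pi> \<in> \<sigma>" by (simp add: sigma_of_group_def)
    show "\<exists>!H. H \<in> E ` sigma_of_group \<sigma> G \<and> hall_pi_subgroup \<pi> G H"
    proof (rule ex1I[of _ "E \<pi>"])
      show "E \<pi> \<in> E ` sigma_of_group \<sigma> G \<and> hall_pi_subgroup \<pi> G (E \<pi>)" using \<pi> E \<open>\<pi> \<in> \<sigma>\<close> by blast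
      fix H assume "H \<in> E ` sigma_of_group \<sigma> G \<and> hall_pi_subgroup \<pi> G H"
      then show "H = E \<pi>" using uniq[OF \<pi>] by (auto simp: sigma_of_group_def)
    qed
  qed
  then show ?thesis by blast
qed

lemma (in finite_group) complete_hall_sigma_set_imp_hall:
  assumes "complete_hall_sigma_set \<sigma> G \<H>" "\<pi> \<in> \<sigma>"
  shows "\<exists>H. hall_pi_subgroup \<pi> G H"
proof (cases "\<pi> \<in> sigma_of_group \<sigma> G")
  case True
  then have "\<exists>!H. H \<in> \<H> \<and> hall_pi_subgroup \<pi> G H"
    using assms(1) unfolding complete_hall_sigma_set_def by (elim conjE bspec)
  then show ?thesis by auto
next
  case False
  then have "pi_number (- \<pi>) (order G)"
    using assms(2) order_pos by (auto simp: sigma_of_group_def pi_number_def)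
  then have "hall_pi_subgroup \<pi> G {\<one>}" by (simp add: hall_pi_subgroup_iff triv_subgroup)
  then show ?thesis by blast
qed

text \<open>This form of \<open>\<pi>\<close>-separability passes to quotients and provides the next term of a normal series
above \<open>Z\<close> inside any prescribed normal subgroup \<open>C\<close>.\<close>
definition (in group) pi_separable :: "nat set \<Rightarrow> bool" where
  "pi_separable \<pi> \<longleftrightarrow> (\<forall>Z C. Z \<lhd> G \<and> C \<lhd> G \<and> Z \<subset> C \<longrightarrow>
     (\<exists>K. K \<lhd> G \<and> Z \<subset> K \<and> K \<subseteq> C \<and>
        (pi_number \<pi> (card K div card Z) \<or> pi_number (- \<pi>) (card K div card Z))))"

lemma (in group) pi_separableD:
  "pi_separable \<pi> \<Longrightarrow> Z \<lhd> G \<Longrightarrow> C \<lhd> G \<Longrightarrow> Z \<subset> C \<Longrightarrow> \<exists>K. K \<lhd> G \<and> Z \<subset> K \<and> K \<subseteq> C \<and>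
     (pi_number \<pi> (card K div card Z) \<or> pi_number (- \<pi>) (card K div card Z))"
  unfolding pi_separable_def by simp

context finite_group
begin

text \<open>A normal subgroup that is minimal among those strictly above \<open>Z\<close> inside \<open>C\<close> is a chief factor over
\<open>Z\<close>.\<close>
lemma sigma_soluble_imp_pi_separable:
  assumes sol: "sigma_soluble \<sigma> G" and part: "partition_on {p. Factorial_Ring.prime p} \<sigma>" and \<pi>: "\<pi> \<in> \<sigma>"
  shows "pi_separable \<pi>"
  unfolding pi_separable_def
proof (intro allI impI)
  fix Z C assume "Z \<lhd> G \<and> C \<lhd> G \<and> Z \<subset> C"
  then have Z: "Z \<lhd> G" and C: "C \<lhd> G" "Z \<subset> C" by auto
  let ?P = "\<lambda>K. K \<lhd> G \<and> Z \<subset> K \<and> K \<subseteq> C"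
  obtain K where K: "?P K" "\<And>L. ?P L \<Longrightarrow> card K \<le> card L"
    using ex_has_least_nat[of ?P C card] C by blast
  have sK: "subgroup K G" and sZ: "subgroup Z G" using K Z normal_imp_subgroup by auto
  have "chief_factor G K Z"
    unfolding chief_factor_def
  proof (intro conjI notI)
    assume "\<exists>L. L \<lhd> G \<and> Z \<subset> L \<and> L \<subset> K"
    then obtain L where L: "L \<lhd> G" "Z \<subset> L" "L \<subset> K" by blast
    then have "card K \<le> card L" using K by (meson order_trans psubset_imp_subset)
    moreover have "card L < card K" using L(3) subgroup_finite[OF sK] by (rule psubset_card_mono[rotated])
    ultimately show False by simp
  qed (use K Z in auto)
  then obtain \<rho> where \<rho>: "\<rho> \<in> \<sigma>" "pi_group \<rho> (G\<lparr>carrier := K\<rparr> Mod Z)"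
    using sol by (auto simp: sigma_soluble_def sigma_primary_def)
  interpret K: finite_group "G\<lparr>carrier := K\<rparr>" using subgroup_finite_group[OF sK] .
  have "subgroup Z (G\<lparr>carrier := K\<rparr>)" using sZ sK K subgroup_incl by blast
  then have "order (G\<lparr>carrier := K\<rparr> Mod Z) = card K div card Z"
    using K.card_rcosets_subgroup[of Z] by (simp add: order_def FactGroup_def)
  then have "pi_number \<rho> (card K div card Z)"
    using \<rho>(2) card_div_subgroup_pos[OF sZ sK] K by (auto simp: pi_group_def pi_number_def)
  moreover have "\<rho> = \<pi> \<or> \<rho> \<subseteq> - \<pi>" using partition_on_compl[OF part \<pi> \<rho>(1)] by blast
  ultimately show "\<exists>K. K \<lhd> G \<and> Z \<subset> K \<and> K \<subseteq> C \<and>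
        (pi_number \<pi> (card K div card Z) \<or> pi_number (- \<pi>) (card K div card Z))"
    using K pi_number_mono by blast
qed

text \<open>Schur-Zassenhaus in \<open>J/K\<close>, stated for subgroups of \<open>G\<close>.\<close>
lemma schur_zassenhaus_section:
  assumes K: "K \<lhd> G" and M: "M \<lhd> G" and J: "subgroup J G" and sub: "K \<subseteq> M" "M \<subseteq> J"
    and cop: "coprime (card M div card K) (card J div card M)"
  shows "\<exists>C. subgroup C G \<and> K \<subseteq> C \<and> C \<subseteq> J \<and> card C = card K * (card J div card M)"
proof -
  let ?J = "G\<lparr>carrier := J\<rparr>"
  interpret J: finite_group ?J using subgroup_finite_group[OF J] .
  have sK: "subgroup K G" and sM: "subgroup M G" using K M normal_imp_subgroup by auto
  have KJ: "K \<lhd> ?J" and MJ: "M \<lhd> ?J" using normal_restrict_supergroup J K M sub by blast+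
  obtain Q :: "'a monoid" and h where Q: "surj_hom ?J Q h" "kernel ?J Q h = K"
    using J.quotient_on_same_type[OF KJ] by blast
  interpret Q: surj_hom ?J Q h by (rule Q)
  have cM: "card (h ` M) * card K = card M"
    using Q.card_image[OF normal_imp_subgroup[OF MJ]] Q(2) sub by (simp add: Int_absorb1)
  have oQ: "card J = order Q * card K" using Q.order_eq Q(2) by (simp add: order_def)
  have "order Q div card (h ` M) = card J div card M"
    using cM oQ card_subgroup_pos[OF sK] by (metis div_mult_mult2 less_not_refl)
  moreover have "card M div card K = card (h ` M)"
    using cM card_subgroup_pos[OF sK] by (metis div_mult_self_is_m)
  ultimately obtain C where C: "subgroup C Q" "card C = card J div card M"
    using Q.H.schur_zassenhaus[OF Q.image_normal[OF MJ]] cop by auto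
  have "subgroup (Q.pre C) G" "Q.pre C \<subseteq> J"
    using Q.pre_subgroup[OF C(1)] incl_subgroup[OF J] subgroup.subset by (blast, fastforce)
  moreover have "K \<subseteq> Q.pre C" using Q.Ker_subset_pre[OF C(1)] Q(2) by simp
  moreover have "card (Q.pre C) = card K * (card J div card M)"
    using Q.card_pre[OF C(1)] C(2) Q(2) by simp
  ultimately show ?thesis by blast
qed

text \<open>Downward induction along a normal series between \<open>K\<close> and \<open>N\<close>: given a Hall subgroup \<open>J/M\<close> of \<open>N/M\<close>,
keep \<open>J\<close> if \<open>M/K\<close> is a \<open>\<pi>\<close>-group, and pass to a complement of \<open>M/K\<close> in \<open>J/K\<close> if it is a
\<open>\<pi>'\<close>-group.\<close>
lemma pi_separable_hall_relative:
  assumes sep: "pi_separable \<pi>" and N: "N \<lhd> G" and "K \<lhd> G" "K \<subseteq> N"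
  shows "\<exists>J. subgroup J G \<and> K \<subseteq> J \<and> J \<subseteq> N \<and> pi_number \<pi> (card J div card K)
           \<and> pi_number (- \<pi>) (card N div card J)"
  using assms(3,4)
proof (induction "card N - card K" arbitrary: K rule: less_induct)
  case less
  have sN: "subgroup N G" and sK: "subgroup K G" using N less.prems normal_imp_subgroup by auto
  show ?case
  proof (cases "K = N")
    case True
    then show ?thesis using sN card_subgroup_pos[OF sN] by (intro exI[of _ N]) simp
  next
    case False
    then obtain M where M: "M \<lhd> G" "K \<subset> M" "M \<subseteq> N"
        "pi_number \<pi> (card M div card K) \<or> pi_number (- \<pi>) (card M div card K)"
      using sep less.prems N unfolding pi_separable_def by blast
    have sM: "subgroup M G" using M normal_imp_subgroup by auto
    have "card K < card M" "card M \<le> card N"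
      using M subgroup_finite sM sN by (simp_all add: psubset_card_mono card_mono)
    then have "card N - card M < card N - card K" by simp
    then obtain J where J: "subgroup J G" "M \<subseteq> J" "J \<subseteq> N" "pi_number \<pi> (card J div card M)"
        "pi_number (- \<pi>) (card N div card J)"
      using less.hyps[OF _ M(1,3)] by blast
    have KJ: "K \<subseteq> J" using J M by blast
    show ?thesis
    proof (cases "pi_number \<pi> (card M div card K)")
      case True
      then have "pi_number \<pi> (card J div card K)"
        using index_mult[OF sK sM J(1)] M J pi_number_mult by (metis psubset_imp_subset)
      then show ?thesis using J KJ by blast
    next
      case False
      then have M': "pi_number (- \<pi>) (card M div card K)" using M(4) by blast
      have "coprime (card M div card K) (card J div card M)"
        using pi_number_coprime[OF M' J(4)] by simp
      then obtain C where C: "subgroup C G" "K \<subseteq> C" "C \<subseteq> J" "card C = card K * (card J div card M)"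
        using schur_zassenhaus_section[OF less.prems(1) M(1) J(1) _ J(2)] M(2) by blast
      have idx: "card C div card K = card J div card M" using C(4) card_subgroup_pos[OF sK] by simp
      have "card J = card C * (card M div card K)"
        using C(4) card_eq_index_mult[OF sK sM] card_eq_index_mult[OF sM J(1,2)] M(2)
        by (metis mult.commute mult.left_commute psubset_imp_subset)
      then have "card J div card C = card M div card K" using card_subgroup_pos[OF C(1)] by simp
      then have "pi_number (- \<pi>) (card N div card C)"
        using index_mult[OF C(1) J(1) sN C(3) J(3)] M' J(5) pi_number_mult by metis
      then show ?thesis using C J(3,4) idx by (intro exI[of _ C]) auto
    qed
  qed
qed

lemma pi_separable_normal_hall:
  assumes "pi_separable \<pi>" "N \<lhd> G"
  shows "\<exists>J. hall_pi_subgroup \<pi> (G\<lparr>carrier := N\<rparr>) J"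
proof -
  have sN: "subgroup N G" using assms normal_imp_subgroup by blast
  interpret N: finite_group "G\<lparr>carrier := N\<rparr>" using subgroup_finite_group[OF sN] .
  obtain J where J: "subgroup J G" "J \<subseteq> N" "pi_number \<pi> (card J)" "pi_number (- \<pi>) (card N div card J)"
    using pi_separable_hall_relative[OF assms one_is_normal] subgroup.one_closed[OF sN] by auto
  then have "subgroup J (G\<lparr>carrier := N\<rparr>)" using subgroup_incl sN by blast
  then show ?thesis using J N.hall_pi_subgroup_iff by (auto simp: order_def)
qed

text \<open>This is \<open>O\<^sup>\<pi>(G)\<close>: a normal subgroup has a \<open>\<pi>\<close>-group as quotient if and only if it contains all
\<open>\<pi>'\<close>-elements.\<close>
definition pi_residual :: "nat set \<Rightarrow> 'a set" where
  "pi_residual \<pi> = \<Inter>{K. K \<lhd> G \<and> pi_elements (- \<pi>) \<subseteq> K}"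

lemma pi_residual_normal: "pi_residual \<pi> \<lhd> G"
  unfolding pi_residual_def using carrier_normal pi_elements_carrier by (intro normal_Inter) auto

lemma pi_elements_subset_residual: "pi_elements (- \<pi>) \<subseteq> pi_residual \<pi>"
  by (auto simp: pi_residual_def)

lemma pi_residual_least: "K \<lhd> G \<Longrightarrow> pi_elements (- \<pi>) \<subseteq> K \<Longrightarrow> pi_residual \<pi> \<subseteq> K"
  by (auto simp: pi_residual_def)

lemma pi_residual_least_index:
  "K \<lhd> G \<Longrightarrow> pi_number \<pi> (order G div card K) \<Longrightarrow> pi_residual \<pi> \<subseteq> K"
  using pi_elements_subset_normal[of K \<pi> "- \<pi>"] by (intro pi_residual_least) auto

end

section \<open>\<open>\<sigma>\<close>-nilpotent groups and the \<open>\<sigma>\<close>-nilpotent residual\<close>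

lemma prod_dvd_of_pairwise_coprime:
  fixes a :: "'i \<Rightarrow> nat"
  assumes "finite I" "\<And>i. i \<in> I \<Longrightarrow> a i dvd n"
    and "\<And>i j. i \<in> I \<Longrightarrow> j \<in> I \<Longrightarrow> i \<noteq> j \<Longrightarrow> coprime (a i) (a j)"
  shows "prod a I dvd n"
  using assms
proof (induction I rule: finite_induct)
  case (insert i I)
  have "coprime (a i) (prod a I)"
    using insert.prems insert.hyps by (intro prod_coprime_right) auto
  then show ?case using insert by (simp add: divides_mult)
qed simp

lemma finite_sigma_of_group:
  assumes "partition_on {p. Factorial_Ring.prime p} \<sigma>"
  shows "finite (sigma_of_group \<sigma> G)"
proof -
  define cl where "cl p = (SOME \<pi>. \<pi> \<in> \<sigma> \<and> p \<in> \<pi>)" for p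
  have "sigma_of_group \<sigma> G \<subseteq> cl ` prime_factors (order G)"
  proof
    fix \<pi> assume "\<pi> \<in> sigma_of_group \<sigma> G"
    then obtain p where p: "\<pi> \<in> \<sigma>" "p \<in> \<pi>" "p \<in> prime_factors (order G)" by (auto simp: sigma_of_group_def)
    have "cl p \<in> \<sigma> \<and> p \<in> cl p" unfolding cl_def using p(1,2) by (metis (mono_tags, lifting) someI)
    then have "\<pi> = cl p" using partition_on_eq[OF assms p(1) _ p(2)] by blast
    then show "\<pi> \<in> cl ` prime_factors (order G)" using p by blast
  qed
  then show ?thesis by (rule finite_subset) simp
qed

lemma pi_group_finite_group:
  "pi_group \<pi> F \<Longrightarrow> finite_group F \<and> carrier F \<subseteq> monoid.pi_elements F \<pi>"
proof -
  assume F: "pi_group \<pi> F"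
  then interpret F: finite_group F
    by (intro finite_group.intro finite_group_axioms.intro) (auto simp: pi_group_def)
  have "pi_number \<pi> (card (carrier F))"
    using F F.order_pos by (simp add: pi_group_def pi_number_def order_def)
  then show ?thesis using F.pi_subgroup_iff[OF F.subgroup_self] F.finite_group_axioms by blast
qed

lemma hom_pi_elements:
  assumes "finite_group G" "finite_group H" "h \<in> hom G H" "x \<in> monoid.pi_elements G \<pi>"
  shows "h x \<in> monoid.pi_elements H \<pi>"
proof -
  interpret G: finite_group G by fact
  interpret H: finite_group H by fact
  interpret group_hom G H h
    using assms(3) by (intro group_hom.intro group_hom_axioms.intro G.is_group H.is_group)
  show ?thesis using assms(4)
    unfolding G.pi_elements_def H.pi_elements_def by (auto simp flip: hom_nat_pow)
qed

text \<open>In a direct product of primary groups, the product of the factors that are not \<open>\<pi>\<close>-groups is the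
normal Hall \<open>\<pi>'\<close>-subgroup \<open>K\<close>. Conversely \<open>G\<close> embeds into the product of the quotients by these
subgroups, and the order of that product divides the order of \<open>G\<close>, because its factors have
pairwise coprime orders. Expressing \<open>K\<close> through elements makes the criterion easy to
transfer to quotients and subgroups.\<close>
lemma (in finite_group) sigma_nilpotent_iff:
  assumes part: "partition_on {p. Factorial_Ring.prime p} \<sigma>"
  shows "sigma_nilpotent \<sigma> G \<longleftrightarrow>
    (\<forall>\<pi>\<in>\<sigma>. \<exists>K. K \<lhd> G \<and> pi_elements (- \<pi>) \<subseteq> K \<and> K \<inter> pi_elements \<pi> = {\<one>})" (is "_ \<longleftrightarrow> ?R")
proof
  assume "sigma_nilpotent \<sigma> G"
  then obtain n and F :: "nat \<Rightarrow> 'a monoid" where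
    F: "\<And>i. i < n \<Longrightarrow> sigma_primary \<sigma> (F i)" "G \<cong> product_group {..<n} F"
    unfolding sigma_nilpotent_def by blast
  then obtain \<phi> where \<phi>: "\<phi> \<in> iso G (product_group {..<n} F)" by (auto simp: is_iso_def)
  have FG: "finite_group (F i)" if "i < n" for i
    using F(1)[OF that] pi_group_finite_group by (auto simp: sigma_primary_def)
  have hom: "(\<lambda>x. \<phi> x i) \<in> hom G (F i)" if "i < n" for i
    using \<phi> that by (auto simp: iso_def hom_def PiE_iff Pi_iff)
  have trivial: "\<phi> x i = \<one>\<^bsub>F i\<^esub>"
    if "i < n" "x \<in> pi_elements \<pi>" "pi_group \<rho> (F i)" "\<pi> \<inter> \<rho> = {}" for x i \<pi> \<rho>
  proof -
    interpret Fi: finite_group "F i" using FG that by blast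
    have "\<phi> x i \<in> Fi.pi_elements \<pi>"
      using hom_pi_elements[OF finite_group_axioms FG[OF that(1)] hom[OF that(1)] that(2)] .
    moreover have "\<phi> x i \<in> Fi.pi_elements \<rho>"
      using pi_group_finite_group[OF that(3)] calculation Fi.pi_elements_carrier by blast
    ultimately show ?thesis using Fi.pi_elements_disjoint that(4) by blast
  qed
  show ?R
  proof
    fix \<pi> assume \<pi>: "\<pi> \<in> \<sigma>"
    define \<N> where "\<N> = insert (carrier G)
      ((\<lambda>i. kernel G (F i) (\<lambda>x. \<phi> x i)) ` {i. i < n \<and> pi_group \<pi> (F i)})"
    have ker: "kernel G (F i) (\<lambda>x. \<phi> x i) \<lhd> G" if "i < n" for i
    proof -
      interpret Fi: finite_group "F i" using FG that by blast
      interpret group_hom G "F i" "\<lambda>x. \<phi> x i"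
        using hom[OF that] by (intro group_hom.intro group_hom_axioms.intro) auto
      show ?thesis by (rule normal_kernel)
    qed
    have nK: "\<Inter>\<N> \<lhd> G" using ker carrier_normal by (intro normal_Inter) (auto simp: \<N>_def)
    have cK: "pi_elements (- \<pi>) \<subseteq> \<Inter>\<N>"
      using trivial[of _ _ "- \<pi>" \<pi>] pi_elements_carrier by (auto simp: \<N>_def kernel_def)
    have "x = \<one>" if x: "x \<in> \<Inter>\<N>" "x \<in> pi_elements \<pi>" for x
    proof -
      have "\<phi> x i = \<one>\<^bsub>F i\<^esub>" if i: "i < n" for i
      proof (cases "pi_group \<pi> (F i)")
        case True
        then have "x \<in> kernel G (F i) (\<lambda>x. \<phi> x i)" using x(1) i unfolding \<N>_def by blast
        then show ?thesis by (simp add: kernel_def)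
      next
        case False
        obtain \<rho> where \<rho>: "\<rho> \<in> \<sigma>" "pi_group \<rho> (F i)" using F(1)[OF i] by (auto simp: sigma_primary_def)
        then have "\<pi> \<inter> \<rho> = {}" using partition_on_compl[OF part \<pi> \<rho>(1)] False by blast
        then show ?thesis using trivial[OF i x(2) \<rho>(2)] by blast
      qed
      moreover have c: "x \<in> carrier G" using x(2) pi_elements_carrier by blast
      moreover have "\<phi> x \<in> carrier (product_group {..<n} F)"
        using \<phi> c by (auto simp: iso_def hom_def)
      ultimately have "\<phi> x = \<one>\<^bsub>product_group {..<n} F\<^esub>"
        by (intro ext) (auto simp: PiE_iff extensional_def)
      moreover have "\<phi> \<one> = \<one>\<^bsub>product_group {..<n} F\<^esub>"
        using \<phi> by (intro hom_one[OF _ is_group] product_group finite_group.axioms(1) FG) (auto simp: iso_def)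
      ultimately show "x = \<one>" using \<phi> c by (auto simp: iso_def bij_betw_def inj_on_def)
    qed
    then have "\<Inter>\<N> \<inter> pi_elements \<pi> = {\<one>}"
      using subgroup.one_closed[OF normal_imp_subgroup[OF nK]] one_pi_element by (intro equalityI subsetI) (metis Int_iff singletonI, metis IntI singletonD)
    with nK cK show "\<exists>K. K \<lhd> G \<and> pi_elements (- \<pi>) \<subseteq> K \<and> K \<inter> pi_elements \<pi> = {\<one>}"
      by (intro exI[of _ "\<Inter>\<N>"] conjI)
  qed
next
  assume R: ?R
  obtain K where K: "\<And>\<pi>. \<pi> \<in> \<sigma> \<Longrightarrow> K \<pi> \<lhd> G" "\<And>\<pi>. \<pi> \<in> \<sigma> \<Longrightarrow> pi_elements (- \<pi>) \<subseteq> K \<pi>"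
      "\<And>\<pi>. \<pi> \<in> \<sigma> \<Longrightarrow> K \<pi> \<inter> pi_elements \<pi> = {\<one>}"
    using R by metis
  \<comment> \<open>Only the finitely many classes that meet the order of \<open>G\<close> contribute a factor.\<close>
  define \<Sigma> where "\<Sigma> = sigma_of_group \<sigma> G"
  define n where "n = card \<Sigma>"
  have \<Sigma>\<sigma>: "\<Sigma> \<subseteq> \<sigma>" by (auto simp: \<Sigma>_def sigma_of_group_def)
  obtain f where "bij_betw f {0..<n} \<Sigma>"
    using ex_bij_betw_nat_finite[OF finite_sigma_of_group[OF part, of G]] by (auto simp: n_def \<Sigma>_def)
  then have f: "bij_betw f {..<n} \<Sigma>" by (simp add: lessThan_atLeast0)
  have f\<sigma>: "f i \<in> \<sigma>" if "i < n" for i using f that \<Sigma>\<sigma> by (auto simp: bij_betw_def)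
  have "\<forall>i. \<exists>(F :: 'a monoid) h. i < n \<longrightarrow> surj_hom G F h \<and> kernel G F h = K (f i)"
    using quotient_on_same_type K(1) f\<sigma> by blast
  then obtain F :: "nat \<Rightarrow> 'a monoid" and h where
    F: "\<And>i. i < n \<Longrightarrow> surj_hom G (F i) (h i)" "\<And>i. i < n \<Longrightarrow> kernel G (F i) (h i) = K (f i)"
    by metis
  have FG: "finite_group (F i)" if "i < n" for i using F(1)[OF that] by (rule surj_hom.axioms(2))
  have ord: "order G = order (F i) * card (K (f i))" if "i < n" for i
    using surj_hom.order_eq[OF F(1)[OF that]] F(2)[OF that] by simp
  have pin: "pi_number (f i) (order (F i))" if i: "i < n" for i
  proof -
    have sK: "subgroup (K (f i)) G" using K(1)[OF f\<sigma>[OF i]] normal_imp_subgroup by blast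
    have "pi_number (f i) (card (carrier G) div card (K (f i)))"
    proof (rule pi_index[OF sK subgroup_self subgroup.subset[OF sK]])
      fix p x assume "p \<notin> f i" "x \<in> pi_elements {p}"
      then show "x \<in> K (f i)" using pi_elements_mono[of x "{p}" "- f i"] K(2)[OF f\<sigma>[OF i]] by blast
    qed
    then show ?thesis using ord[OF i] card_subgroup_pos[OF sK] by (simp add: order_def)
  qed
  let ?P = "product_group {..<n} F"
  define \<Psi> where "\<Psi> x = (\<lambda>i\<in>{..<n}. h i x)" for x
  have hhom: "h i \<in> hom G (F i)" if "i < n" for i using surj_hom.hom[OF F(1)[OF that]] .
  have hom: "\<Psi> \<in> hom G ?P"
    using hhom by (intro homI) (auto simp: \<Psi>_def hom_def fun_eq_iff PiE_iff)
  have gP: "group ?P" by (intro product_group finite_group.axioms(1)[OF FG]) auto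
  interpret \<Psi>: group_hom G ?P \<Psi> using hom gP by (intro group_hom.intro group_hom_axioms.intro) auto
  have inj: "inj_on \<Psi> (carrier G)"
    unfolding \<Psi>.inj_on_one_iff
  proof (intro allI impI)
    fix x assume x: "x \<in> carrier G" "\<Psi> x = \<one>\<^bsub>?P\<^esub>"
    have hx: "h i x = \<one>\<^bsub>F i\<^esub>" if "i < n" for i
      using fun_cong[OF x(2), of i] that by (simp add: \<Psi>_def)
    show "x = \<one>"
    proof -
      have "x \<in> {\<one>}"
      proof (rule mem_by_prime_parts[OF x(1) triv_subgroup])
        fix p m assume p: "Factorial_Ring.prime p" "x [^] (m::nat) \<in> pi_elements {p}"
        show "x [^] m \<in> {\<one>}"
        proof (cases "p dvd order G")
          case True
          obtain \<pi> where \<pi>: "\<pi> \<in> \<sigma>" "p \<in> \<pi>" using partition_on_class[OF part] p(1) by blast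
          then have "\<pi> \<in> \<Sigma>" using True p(1) order_pos by (auto simp: \<Sigma>_def sigma_of_group_def in_prime_factors_iff)
          then obtain i where i: "i < n" "f i = \<pi>" using f by (auto simp: bij_betw_def)
          have "x \<in> K \<pi>" using hx[OF i(1)] F(2)[OF i(1)] i(2) x(1) by (auto simp: kernel_def)
          then have "x [^] m \<in> K \<pi>" using K(1)[OF \<pi>(1)] normal_imp_subgroup subgroup_pow_closed by blast
          moreover have "x [^] m \<in> pi_elements \<pi>" using p(2) pi_elements_mono \<pi>(2) by blast
          ultimately show ?thesis using K(3)[OF \<pi>(1)] by blast
        next
          case False
          then have "pi_number (- {p}) (order G)" using pi_number_not_dvd p(1) order_pos by blast
          then have "x [^] m \<in> pi_elements (- {p})"
            using x(1) pow_order_eq_1[of "x [^] m"] by (intro pi_elementsI) auto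
          then show ?thesis using p(2) pi_elements_disjoint[of _ "{p}" "- {p}"] by blast
        qed
      qed
      then show ?thesis by simp
    qed
  qed
  have finP: "finite (carrier ?P)" using finite_group.finite_carrier[OF FG] by (auto intro!: finite_PiE)
  have "card (carrier ?P) = (\<Prod>i<n. order (F i))" by (simp add: card_PiE order_def)
  also have "\<dots> dvd order G"
  proof (rule prod_dvd_of_pairwise_coprime)
    fix i j assume ij: "i \<in> {..<n}" "j \<in> {..<n}" "i \<noteq> j"
    then have "f i \<noteq> f j" using f by (auto simp: bij_betw_def inj_on_def)
    then have "f i \<inter> f j = {}" using partition_on_compl[OF part f\<sigma> f\<sigma>, of i j] ij by blast
    then show "coprime (order (F i)) (order (F j))" using pi_number_coprime[OF pin pin, of i j] ij by blast
  qed (use ord in auto)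
  finally have "card (carrier ?P) \<le> card (carrier G)" using order_pos by (simp add: order_def dvd_imp_le)
  then have "\<Psi> ` carrier G = carrier ?P"
    using inj finP hom_carrier[OF hom] by (metis card_image card_seteq)
  then have "\<Psi> \<in> iso G ?P" using hom inj by (simp add: iso_def bij_betw_def)
  then have "G \<cong> ?P" by (rule is_isoI)
  moreover have "sigma_primary \<sigma> (F i)" if "i < n" for i
    using pin[OF that] f\<sigma>[OF that] finite_group.axioms(1)[OF FG[OF that]] finite_group.finite_carrier[OF FG[OF that]]
    by (auto simp: sigma_primary_def pi_group_def pi_number_def)
  ultimately show "sigma_nilpotent \<sigma> G" unfolding sigma_nilpotent_def by blast
qed

context finite_group
begin

lemma quotient_surj_hom:
  assumes "N \<lhd> G"
  shows "surj_hom G (G Mod N) (\<lambda>x. N #> x)" "kernel G (G Mod N) (\<lambda>x. N #> x) = N"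
proof -
  interpret N: normal N G by fact
  show "surj_hom G (G Mod N) (\<lambda>x. N #> x)"
    using N.factorgroup_is_group N.r_coset_hom_Mod
    by (intro surj_hom.intro surj_hom_axioms.intro finite_group.intro finite_group_axioms.intro)
      (auto simp: carrier_FactGroup)
  show "kernel G (G Mod N) (\<lambda>x. N #> x) = N"
    using N.subset N.is_subgroup coset_join1[of N] coset_join2[of _ N]
    by (auto simp: kernel_def)
qed

lemma pi_elements_restrict:
  assumes "subgroup H G"
  shows "monoid.pi_elements (G\<lparr>carrier := H\<rparr>) \<pi> = pi_elements \<pi> \<inter> H"
proof -
  interpret H: finite_group "G\<lparr>carrier := H\<rparr>" using subgroup_finite_group[OF assms] .
  show ?thesis
    using subgroup.mem_carrier[OF assms]
    by (auto simp: H.pi_elements_def pi_elements_def nat_pow_consistent[symmetric])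
qed

lemma commutative_pi_elements_normal:
  assumes "\<And>x y. x \<in> carrier G \<Longrightarrow> y \<in> carrier G \<Longrightarrow> x \<otimes> y = y \<otimes> x"
  shows "pi_elements \<pi> \<lhd> G"
proof (rule normal_invI)
  show "subgroup (pi_elements \<pi>) G"
    using pi_elements_commuting_mult assms pi_elements_carrier by (intro subgroup_of_mult_closed) auto
  fix x y assume "x \<in> carrier G" "y \<in> pi_elements \<pi>"
  then show "x \<otimes> y \<otimes> inv x \<in> pi_elements \<pi>"
    using assms conj_eq_iff_commute[of x y] pi_elements_carrier by metis
qed

text \<open>An explicit form of the \<open>\<sigma>\<close>-nilpotent residual; see \<open>sigma_nilpotent_residual_eq\<close>.\<close>
definition sigma_residual :: "nat set set \<Rightarrow> 'a set" where
  "sigma_residual \<sigma> = (\<Inter>\<pi>\<in>\<sigma>. pi_residual \<pi>)"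

text \<open>For \<open>\<rho> \<noteq> \<pi>\<close> a \<open>\<pi>\<close>-element is a \<open>\<rho>'\<close>-element, hence lies in \<open>O\<^sup>\<rho>(G)\<close> anyway.\<close>
lemma pi_element_in_sigma_residual:
  assumes part: "partition_on {p. Factorial_Ring.prime p} \<sigma>" and "\<pi> \<in> \<sigma>" "x \<in> pi_elements \<pi>" "x \<in> pi_residual \<pi>"
  shows "x \<in> sigma_residual \<sigma>"
  unfolding sigma_residual_def
proof
  fix \<rho> assume \<rho>: "\<rho> \<in> \<sigma>"
  show "x \<in> pi_residual \<rho>"
  proof (cases "\<rho> = \<pi>")
    case False
    then have "\<pi> \<subseteq> - \<rho>" using partition_on_compl[OF part \<rho> assms(2)] by blast
    then show ?thesis using assms(3) pi_elements_mono pi_elements_subset_residual by blast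
  qed (use assms in simp)
qed

lemma partition_primes_nonempty:
  "partition_on {p::nat. Factorial_Ring.prime p} \<sigma> \<Longrightarrow> \<sigma> \<noteq> {}"
  using partition_on_class[of _ \<sigma> 2] two_is_prime_nat by blast

lemma sigma_residual_normal:
  assumes "partition_on {p. Factorial_Ring.prime p} \<sigma>"
  shows "sigma_residual \<sigma> \<lhd> G"
  unfolding sigma_residual_def
  using partition_primes_nonempty[OF assms] pi_residual_normal by (intro normal_Inter) auto

text \<open>Modulo the intersection of all \<open>O\<^sup>\<pi>(G)\<close>, the image of \<open>O\<^sup>\<pi>(G)\<close> is a normal Hall
\<open>\<pi>'\<close>-subgroup by \<open>pi_element_in_sigma_residual\<close>. If conversely \<open>G/N\<close> is \<open>\<sigma>\<close>-nilpotent, its normal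
Hall \<open>\<pi>'\<close>-subgroup pulls back to a subgroup containing \<open>O\<^sup>\<pi>(G)\<close>, and these pullbacks
intersect in \<open>N\<close>.\<close>
lemma sigma_nilpotent_residual_eq:
  assumes part: "partition_on {p. Factorial_Ring.prime p} \<sigma>"
  shows "sigma_nilpotent_residual \<sigma> G = sigma_residual \<sigma>"
proof
  let ?D = "sigma_residual \<sigma>"
  have "sigma_nilpotent \<sigma> (G Mod ?D)"
  proof -
    interpret Q: surj_hom G "G Mod ?D" "\<lambda>x. ?D #> x"
      using quotient_surj_hom sigma_residual_normal[OF part] by blast
    have Ker: "Q.Ker = ?D" using quotient_surj_hom sigma_residual_normal[OF part] by blast
    show ?thesis
      unfolding Q.H.sigma_nilpotent_iff[OF part]
    proof
      fix \<pi> assume \<pi>: "\<pi> \<in> \<sigma>"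
      let ?K = "(\<lambda>x. ?D #> x) ` pi_residual \<pi>"
      have nK: "?K \<lhd> G Mod ?D" using Q.image_normal[OF pi_residual_normal] .
      moreover have "Q.H.pi_elements (- \<pi>) \<subseteq> ?K"
        using Q.lift_pi_element[of _ "- \<pi>"] pi_elements_subset_residual by blast
      moreover have "y = \<one>\<^bsub>G Mod ?D\<^esub>" if y: "y \<in> ?K" "y \<in> Q.H.pi_elements \<pi>" for y
      proof -
        have sub: "subgroup (pi_residual \<pi>) G" using pi_residual_normal normal_imp_subgroup by blast
        obtain t where t: "t \<in> pi_residual \<pi>" "y = ?D #> t" using y by blast
        have tc: "t \<in> carrier G" using t sub subgroup.mem_carrier by fast
        obtain m m' where m: "t [^] (m::nat) \<in> pi_elements \<pi>" "t [^] (m'::nat) \<in> pi_elements (- \<pi>)"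
            "t = t [^] m \<otimes> t [^] m'" using pi_decomposition[OF tc] by blast
        have "?D #> t [^] m' \<in> Q.H.pi_elements (- \<pi>)" using Q.hom_pi_elements m(2) by blast
        moreover have "?D #> t [^] m' = y [^]\<^bsub>G Mod ?D\<^esub> m'" using t(2) Q.hom_nat_pow tc by simp
        ultimately have "?D #> t [^] m' = \<one>\<^bsub>G Mod ?D\<^esub>"
          using Q.H.pi_elements_pow[OF y(2)] Q.H.pi_elements_disjoint[of _ \<pi> "- \<pi>"] by simp
        moreover have "?D #> t [^] m = \<one>\<^bsub>G Mod ?D\<^esub>"
        proof -
          have "t [^] m \<in> ?D"
            using pi_element_in_sigma_residual[OF part \<pi> m(1)] subgroup_pow_closed[OF sub t(1)] by blast
          then show ?thesis using Ker by (auto simp: kernel_def)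
        qed
        ultimately show ?thesis
          using t(2) m(3) Q.hom_mult[of "t [^] m" "t [^] m'"] tc
          by (metis Q.H.l_one Q.H.one_closed nat_pow_closed)
      qed
      moreover have "\<one>\<^bsub>G Mod ?D\<^esub> \<in> ?K" using nK normal_imp_subgroup subgroup.one_closed by blast
      ultimately show "\<exists>K. K \<lhd> G Mod ?D \<and> Q.H.pi_elements (- \<pi>) \<subseteq> K \<and> K \<inter> Q.H.pi_elements \<pi> = {\<one>\<^bsub>G Mod ?D\<^esub>}"
        using Q.H.one_pi_element by (intro exI[of _ ?K]) blast
    qed
  qed
  then show "sigma_nilpotent_residual \<sigma> G \<subseteq> ?D"
    unfolding sigma_nilpotent_residual_def using sigma_residual_normal[OF part] by blast
  show "?D \<subseteq> sigma_nilpotent_residual \<sigma> G"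
    unfolding sigma_nilpotent_residual_def
  proof (intro Inter_greatest, clarify)
    fix N x assume N: "N \<lhd> G" "sigma_nilpotent \<sigma> (G Mod N)" and x: "x \<in> ?D"
    interpret Q: surj_hom G "G Mod N" "\<lambda>x. N #> x" using quotient_surj_hom N(1) by blast
    have Ker: "Q.Ker = N" using quotient_surj_hom N(1) by blast
    have sD: "subgroup ?D G" using sigma_residual_normal[OF part] normal_imp_subgroup by blast
    have xc: "x \<in> carrier G" using subgroup.mem_carrier[OF sD x] .
    show "x \<in> N"
    proof (rule mem_by_prime_parts[OF xc normal_imp_subgroup[OF N(1)]])
      fix p m assume p: "Factorial_Ring.prime p" "x [^] (m::nat) \<in> pi_elements {p}"
      obtain \<pi> where \<pi>: "\<pi> \<in> \<sigma>" "p \<in> \<pi>" using partition_on_class[OF part] p(1) by blast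
      obtain K where K: "K \<lhd> G Mod N" "Q.H.pi_elements (- \<pi>) \<subseteq> K" "K \<inter> Q.H.pi_elements \<pi> = {\<one>\<^bsub>G Mod N\<^esub>}"
        using N(2) \<pi>(1) Q.H.sigma_nilpotent_iff[OF part] by blast
      have "pi_residual \<pi> \<subseteq> Q.pre K"
      proof (rule pi_residual_least[OF Q.pre_normal[OF K(1)]])
        show "pi_elements (- \<pi>) \<subseteq> Q.pre K"
          using Q.hom_pi_elements[of _ "- \<pi>"] K(2) pi_elements_carrier by (auto simp: Q.pre_def)
      qed
      moreover have "x [^] m \<in> pi_residual \<pi>"
        using subgroup_pow_closed[OF sD x] \<pi>(1) by (auto simp: sigma_residual_def)
      ultimately have "N #> x [^] m \<in> K" by (auto simp: Q.pre_def)
      moreover have "N #> x [^] m \<in> Q.H.pi_elements \<pi>"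
        using Q.hom_pi_elements[OF p(2)] Q.H.pi_elements_mono[of _ "{p}" \<pi>] \<pi>(2) by blast
      ultimately have "x [^] m \<in> Q.Ker" using K(3) xc by (auto simp: kernel_def)
      then show "x [^] m \<in> N" using Ker by simp
    qed
  qed
qed

lemma sigma_residual_subset_of_commutative:
  assumes part: "partition_on {p. Factorial_Ring.prime p} \<sigma>" and N: "N \<lhd> G"
    and comm: "\<And>x y. x \<in> carrier G \<Longrightarrow> y \<in> carrier G \<Longrightarrow> x \<otimes> y \<otimes> inv x \<otimes> inv y \<in> N"
  shows "sigma_residual \<sigma> \<subseteq> N"
proof -
  interpret Q: surj_hom G "G Mod N" "\<lambda>x. N #> x" using quotient_surj_hom N by blast
  have Ker: "Q.Ker = N" using quotient_surj_hom N by blast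
  have Qcomm: "x \<otimes>\<^bsub>G Mod N\<^esub> y = y \<otimes>\<^bsub>G Mod N\<^esub> x"
    if "x \<in> carrier (G Mod N)" "y \<in> carrier (G Mod N)" for x y
  proof -
    have "x \<in> (\<lambda>x. N #> x) ` carrier G" "y \<in> (\<lambda>x. N #> x) ` carrier G"
      using that unfolding carrier_FactGroup by auto
    then obtain a b where ab: "a \<in> carrier G" "b \<in> carrier G" "x = N #> a" "y = N #> b"
      by auto
    have "(a \<otimes> b) \<otimes> inv (b \<otimes> a) \<in> Q.Ker"
      using comm[OF ab(1,2)] ab Ker by (simp add: inv_mult_group m_assoc)
    then have "N #> (a \<otimes> b) = N #> (b \<otimes> a)" using Q.h_eq_iff[of "a \<otimes> b" "b \<otimes> a"] ab by simp
    then show ?thesis using ab Q.hom_mult[of a b] Q.hom_mult[of b a] by simp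
  qed
  have "sigma_nilpotent \<sigma> (G Mod N)"
    unfolding Q.H.sigma_nilpotent_iff[OF part]
  proof
    fix \<pi> assume \<pi>: "\<pi> \<in> \<sigma>"
    have "Q.H.pi_elements (- \<pi>) \<lhd> G Mod N"
      using Q.H.commutative_pi_elements_normal Qcomm by blast
    moreover have "Q.H.pi_elements (- \<pi>) \<inter> Q.H.pi_elements \<pi> = {\<one>\<^bsub>G Mod N\<^esub>}"
      using Q.H.pi_elements_disjoint[of _ "- \<pi>" \<pi>] Q.H.one_pi_element by blast
    ultimately show "\<exists>K. K \<lhd> G Mod N \<and> Q.H.pi_elements (- \<pi>) \<subseteq> K \<and> K \<inter> Q.H.pi_elements \<pi> = {\<one>\<^bsub>G Mod N\<^esub>}"
      by blast
  qed
  then show ?thesis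
    using sigma_nilpotent_residual_eq[OF part] N unfolding sigma_nilpotent_residual_def by blast
qed

text \<open>The subgroup \<open>M\<close> embeds into \<open>G/D\<close>; its Hall subgroups can be written down directly.\<close>
lemma residual_complement_sigma_nilpotent:
  assumes part: "partition_on {p. Factorial_Ring.prime p} \<sigma>" and M: "subgroup M G"
    and int: "sigma_residual \<sigma> \<inter> M = {\<one>}"
  shows "sigma_nilpotent \<sigma> (G\<lparr>carrier := M\<rparr>)"
proof -
  interpret M: finite_group "G\<lparr>carrier := M\<rparr>" using subgroup_finite_group[OF M] .
  show ?thesis
    unfolding M.sigma_nilpotent_iff[OF part]
  proof
    fix \<pi> assume \<pi>: "\<pi> \<in> \<sigma>"
    let ?K = "pi_residual \<pi> \<inter> M"
    have nK: "?K \<lhd> G\<lparr>carrier := M\<rparr>" using normal_restrict[OF pi_residual_normal M] .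
    have cK: "M.pi_elements (- \<pi>) \<subseteq> ?K"
      unfolding pi_elements_restrict[OF M] using pi_elements_subset_residual by blast
    have "?K \<inter> M.pi_elements \<pi> \<subseteq> {\<one>}"
      using pi_element_in_sigma_residual[OF part \<pi>] int unfolding pi_elements_restrict[OF M] by blast
    moreover have "\<one> \<in> ?K"
      using subgroup.one_closed[OF M] subgroup.one_closed[OF normal_imp_subgroup[OF pi_residual_normal]] by blast
    moreover have "\<one> \<in> M.pi_elements \<pi>" using M.one_pi_element by simp
    ultimately have "?K \<inter> M.pi_elements \<pi> = {\<one>\<^bsub>G\<lparr>carrier := M\<rparr>\<^esub>}" by auto
    with nK cK show "\<exists>K. K \<lhd> G\<lparr>carrier := M\<rparr> \<and> M.pi_elements (- \<pi>) \<subseteq> K \<and>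
        K \<inter> M.pi_elements \<pi> = {\<one>\<^bsub>G\<lparr>carrier := M\<rparr>\<^esub>}"
      by (intro exI[of _ ?K] conjI)
  qed
qed

end

section \<open>Coprime power automorphisms\<close>

definition (in group) centraliser :: "'a set \<Rightarrow> 'a set" where
  "centraliser A = {g \<in> carrier G. \<forall>a\<in>A. g \<otimes> a = a \<otimes> g}"

context finite_group
begin

lemma commute_mult:
  assumes "x \<in> carrier G" "y \<in> carrier G" "a \<in> carrier G" "x \<otimes> a = a \<otimes> x" "y \<otimes> a = a \<otimes> y"
  shows "(x \<otimes> y) \<otimes> a = a \<otimes> (x \<otimes> y)"
proof -
  have "(x \<otimes> y) \<otimes> a = x \<otimes> (y \<otimes> a)" using assms(1-3) by (simp only: m_assoc)
  also have "\<dots> = (x \<otimes> a) \<otimes> y" unfolding assms(5) using assms(1-3) by (simp only: m_assoc)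
  also have "\<dots> = a \<otimes> (x \<otimes> y)" unfolding assms(4) using assms(1-3) by (simp only: m_assoc)
  finally show ?thesis .
qed

lemma commute_pow:
  assumes "x \<in> carrier G" "a \<in> carrier G" "x \<otimes> a = a \<otimes> x"
  shows "x [^] (n::nat) \<otimes> a = a \<otimes> x [^] n"
  using group_commutes_pow[OF assms(3,1,2)] .

lemma centraliser_subgroup:
  assumes "A \<subseteq> carrier G"
  shows "subgroup (centraliser A) G"
proof (rule subgroup_of_mult_closed)
  show "\<one> \<in> centraliser A" using assms by (auto simp: centraliser_def)
  fix x y assume "x \<in> centraliser A" "y \<in> centraliser A"
  then have xy: "x \<in> carrier G" "y \<in> carrier G" "\<forall>a\<in>A. x \<otimes> a = a \<otimes> x" "\<forall>a\<in>A. y \<otimes> a = a \<otimes> y"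
    unfolding centraliser_def by blast+
  then have "(x \<otimes> y) \<otimes> a = a \<otimes> (x \<otimes> y)" if "a \<in> A" for a
    using commute_mult[of x y a] that assms by blast
  then show "x \<otimes> y \<in> centraliser A" using xy(1,2) unfolding centraliser_def by blast
qed (auto simp: centraliser_def)

lemma pi_elements_conj:
  assumes "g \<in> carrier G" "x \<in> pi_elements \<pi>"
  shows "g \<otimes> x \<otimes> inv g \<in> pi_elements \<pi>"
proof -
  obtain n where n: "pi_number \<pi> n" "x [^] n = \<one>" "x \<in> carrier G" using assms(2) by (auto simp: pi_elements_def)
  then have "(g \<otimes> x \<otimes> inv g) [^] n = \<one>" using conj_pow[OF assms(1) n(3), of n] assms(1) by simp
  then show ?thesis using assms(1) n by (intro pi_elementsI) auto
qed

lemma conj_commute: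
  assumes "g \<in> carrier G" "a \<in> carrier G" "b \<in> carrier G" "a \<otimes> b = b \<otimes> a"
  shows "(g \<otimes> a \<otimes> inv g) \<otimes> (g \<otimes> b \<otimes> inv g) = (g \<otimes> b \<otimes> inv g) \<otimes> (g \<otimes> a \<otimes> inv g)"
  using conj_mult[OF assms(1,2,3)] conj_mult[OF assms(1,3,2)] assms(4) by metis

lemma centraliser_normal:
  assumes A: "A \<subseteq> carrier G" and inv: "\<And>g a. g \<in> carrier G \<Longrightarrow> a \<in> A \<Longrightarrow> g \<otimes> a \<otimes> inv g \<in> A"
  shows "centraliser A \<lhd> G"
proof (rule normal_invI[OF centraliser_subgroup[OF A]])
  fix g x assume g: "g \<in> carrier G" and x: "x \<in> centraliser A"
  have xc: "x \<in> carrier G" using x by (simp add: centraliser_def)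
  have "(g \<otimes> x \<otimes> inv g) \<otimes> a = a \<otimes> (g \<otimes> x \<otimes> inv g)" if a: "a \<in> A" for a
  proof -
    define b where "b = inv g \<otimes> a \<otimes> g"
    have "b \<in> A" using inv[of "inv g" a] g a by (simp add: b_def)
    then have b: "b \<in> carrier G" "x \<otimes> b = b \<otimes> x" using A x unfolding centraliser_def by blast+
    have "a = g \<otimes> b \<otimes> inv g" unfolding b_def using conj_conj_inv(1)[OF g] A a by auto
    then show ?thesis using conj_commute[OF g xc b(1,2)] by simp
  qed
  then show "g \<otimes> x \<otimes> inv g \<in> centraliser A" using g xc unfolding centraliser_def by simp
qed

lemma coprime_pow_eq_one:
  assumes "x \<in> pi_elements {p}" "x [^] k = \<one>" "\<not> p dvd k" "Factorial_Ring.prime p"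
  shows "x = \<one>"
proof -
  have "k > 0" using assms(3) by (cases k) auto
  then have "x \<in> pi_elements (- {p})"
    using assms pi_number_not_dvd pi_elements_carrier by (intro pi_elementsI[of _ k]) auto
  then show ?thesis using assms(1) pi_elements_disjoint[of x "{p}" "- {p}"] by blast
qed

lemma coprime_pow_generates:
  assumes "x \<in> pi_elements {p}" "\<not> p dvd k" "Factorial_Ring.prime p"
  shows "\<exists>j::nat. (x [^] k) [^] j = x"
proof -
  obtain n where n: "pi_number {p} n" "x [^] n = \<one>" "x \<in> carrier G" using assms(1) by (auto simp: pi_elements_def)
  have "k > 0" using assms(2) by (cases k) auto
  then have "coprime k n" using pi_number_not_dvd[OF assms(3) _ assms(2)] pi_number_coprime[OF _ n(1)] by blast
  then show ?thesis using pow_coprime_generates[OF n(3,2)] n(1) by (simp add: pi_number_def)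
qed

text \<open>The exponent \<open>p c - 1\<close> is prime to \<open>p\<close> and annihilates \<open>x\<close>.\<close>
lemma p_element_not_pth_power:
  assumes "x \<in> pi_elements {p}" "x = x [^] (p * c)" "Factorial_Ring.prime p"
  shows "x = \<one>"
proof (cases "c = 0")
  case True
  then show ?thesis using assms(2) by simp
next
  case False
  have x: "x \<in> carrier G" using assms(1) pi_elements_carrier by blast
  define d where "d = p * c - 1"
  have "p * c \<ge> 2" using prime_ge_2_nat[OF assms(3)] False by (metis One_nat_def Suc_leI gr0I mult_le_mono mult.right_neutral)
  then have d: "p * c = Suc d" "d > 0" by (auto simp: d_def)
  then have "x [^] d \<otimes> x = \<one> \<otimes> x" using assms(2) x by simp
  then have "x [^] d = \<one>" using x by (metis nat_pow_closed one_closed right_cancel)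
  moreover have "\<not> p dvd d"
  proof
    assume "p dvd d"
    then have "p dvd 1" using d(1) by (metis One_nat_def dvd_add_right_iff dvd_triv_left add.commute plus_1_eq_Suc)
    then show False using assms(3) by (meson not_prime_unit)
  qed
  ultimately show ?thesis using coprime_pow_eq_one assms by blast
qed

text \<open>Power automorphisms are recorded with the exponent \<open>k + 1\<close>, so that \<open>x\<^sup>k\<close> is the commutator with
\<open>x\<close>. An automorphism of order prime to \<open>p\<close> that moves \<open>x\<close> acts nontrivially modulo \<open>p\<close>. Otherwise take
the last power \<open>y\<close> in the chain of iterated \<open>p\<close>-th powers of \<open>x\<close> that is still moved. Its commutator
\<open>c\<close> is a power of \<open>y\<^sup>p\<close> and hence fixed, so the \<open>n\<close>-th iterate maps \<open>y\<close> to \<open>y c\<^sup>n\<close>, which forces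
\<open>c = \<one>\<close>.\<close>
lemma coprime_conj_exponent:
  assumes p: "Factorial_Ring.prime p" and x: "x \<in> pi_elements {p}" and u: "u \<in> carrier G"
    and conj: "u \<otimes> x \<otimes> inv u = x [^] Suc k" and n: "u [^] n \<otimes> x = x \<otimes> u [^] (n::nat)" "\<not> p dvd n"
    and moved: "u \<otimes> x \<noteq> x \<otimes> u"
  shows "\<not> p dvd k"
proof
  assume "p dvd k"
  then obtain l where l: "k = p * l" by blast
  have xc: "x \<in> carrier G" using x pi_elements_carrier by blast
  let ?fix = "\<lambda>i. u \<otimes> x [^] (p ^ i) = x [^] (p ^ i) \<otimes> u"
  obtain a where "x [^] (p ^ a) = \<one>"
  proof -
    obtain m where m: "pi_number {p} m" "x [^] m = \<one>" using x by (auto simp: pi_elements_def)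
    have "ord x dvd m" using m xc pow_eq_id by blast
    then have pno: "pi_number {p} (ord x)" using m pi_number_dvd by blast
    obtain c a where "ord x = c * p ^ a" "\<not> p dvd c"
      using prime_power_canonical[OF p ord_pos[OF xc]] by metis
    moreover have "c = 1"
    proof -
      have "c > 0" using \<open>\<not> p dvd c\<close> by (cases c) auto
      then have "pi_number (- {p}) c" using pi_number_not_dvd p \<open>\<not> p dvd c\<close> by blast
      moreover have "pi_number {p} c" using pno \<open>ord x = c * p ^ a\<close> pi_number_dvd by (metis dvd_triv_left)
      ultimately show ?thesis using pi_number_both[of "{p}" c "- {p}"] by blast
    qed
    ultimately have "x [^] (p ^ a) = \<one>" using pow_ord_eq_1[OF xc] by simp
    then show thesis using that by blast
  qed
  then have "?fix a" using u by simp
  moreover have "\<not> ?fix 0" using moved xc by simp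
  ultimately obtain i where i: "\<not> ?fix i" "?fix (Suc i)"
    using ex_least_nat_less[of ?fix a] by (metis lessI less_or_eq_imp_le order_refl)
  define y where "y = x [^] (p ^ i)"
  have yc: "y \<in> carrier G" using xc by (simp add: y_def)
  have yp: "u \<otimes> y [^] p = y [^] p \<otimes> u" using i(2) xc by (simp add: y_def nat_pow_pow mult.commute)
  define c where "c = y [^] k"
  have cc: "c \<in> carrier G" using yc by (simp add: c_def)
  have cl: "c = (y [^] p) [^] l" using yc by (simp add: c_def l nat_pow_pow)
  have "y [^] p \<in> carrier G" using yc by simp
  then have "c \<otimes> u = u \<otimes> c" unfolding cl using commute_pow[of "y [^] p" u l] u yp by metis
  then have uc: "u \<otimes> c \<otimes> inv u = c" using conj_eq_iff_commute[OF u cc] by simp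
  have uy: "u \<otimes> y \<otimes> inv u = y \<otimes> c"
  proof -
    have "u \<otimes> y \<otimes> inv u = (x [^] Suc k) [^] (p ^ i)" unfolding y_def using conj_pow[OF u xc] conj by simp
    also have "\<dots> = y [^] Suc k" unfolding y_def using xc by (simp only: nat_pow_pow mult.commute)
    also have "\<dots> = y \<otimes> c" unfolding c_def using yc by (simp only: nat_pow_Suc2)
    finally show ?thesis .
  qed
  have iter: "u [^] j \<otimes> y \<otimes> inv (u [^] j) = y \<otimes> c [^] j" for j :: nat
  proof (induction j)
    case 0
    then show ?case using yc by simp
  next
    case (Suc j)
    have "u [^] Suc j \<otimes> y \<otimes> inv (u [^] Suc j) = u \<otimes> (u [^] j \<otimes> y \<otimes> inv (u [^] j)) \<otimes> inv u"
      using conj_by_mult[of u "u [^] j" y] u yc by (simp only: nat_pow_Suc2 nat_pow_closed)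
    also have "\<dots> = (u \<otimes> y \<otimes> inv u) \<otimes> (u \<otimes> c \<otimes> inv u) [^] j"
      unfolding Suc using conj_mult[OF u yc] conj_pow[OF u cc] cc by simp
    also have "\<dots> = y \<otimes> c [^] Suc j"
      unfolding uc uy using yc cc by (simp only: m_assoc nat_pow_closed nat_pow_Suc2)
    finally show ?case .
  qed
  have "u [^] n \<otimes> y = y \<otimes> u [^] n" unfolding y_def
    using commute_pow[of x "u [^] n" "p ^ i"] n(1) xc u by (metis nat_pow_closed)
  then have "y \<otimes> c [^] n = y"
    using iter[of n] conj_eq_iff_commute[of "u [^] n" y] u yc by (metis nat_pow_closed)
  then have "c [^] n = \<one>" using yc cc by (metis l_cancel_one nat_pow_closed)
  moreover have "c \<in> pi_elements {p}" unfolding c_def y_def using x pi_elements_pow by blast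
  ultimately have "c = \<one>" using coprime_pow_eq_one n(2) p by blast
  then have "u \<otimes> y \<otimes> inv u = y" using uy yc by simp
  then show False using i(1) conj_eq_iff_commute[OF u yc] unfolding y_def by blast
qed

end

section \<open>Residuals that act by power automorphisms\<close>

text \<open>The setting of \<open>L = G/O\<^bsub>\<pi>'\<^esub>(G)\<close>: the \<open>\<pi>\<close>-residual \<open>T\<close> normalises every cyclic subgroup of the
\<open>\<pi>\<close>-radical \<open>P\<close>. The set \<open>V\<close> of all \<open>\<pi>'\<close>-elements is invariant under conjugation, which a single Hall
\<open>\<pi>'\<close>-subgroup would not be.\<close>
locale reduced_power_group = finite_group +
  fixes \<pi> :: "nat set" and P T V
  defines "P \<equiv> pi_core \<pi> G" and "T \<equiv> pi_residual \<pi>" and "V \<equiv> pi_elements (- \<pi>)"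
  assumes reduced: "pi_core (- \<pi>) G = {\<one>}"
    and separable: "pi_separable \<pi>"
    and power: "\<And>t x. t \<in> T \<Longrightarrow> x \<in> P \<Longrightarrow> \<exists>k. t \<otimes> x \<otimes> inv t = x [^] Suc k"
    and hall: "\<exists>E. hall_pi_subgroup \<pi> G E"
begin

lemma P_normal: "P \<lhd> G" and P_card: "pi_number \<pi> (card P)"
  unfolding P_def by (rule pi_core_normal, rule pi_core_card)

lemma P_greatest: "N \<lhd> G \<Longrightarrow> pi_number \<pi> (card N) \<Longrightarrow> N \<subseteq> P"
  unfolding P_def by (rule pi_core_greatest)

lemma P_subgroup: "subgroup P G" using P_normal normal_imp_subgroup by blast
lemma P_carrier: "x \<in> P \<Longrightarrow> x \<in> carrier G" using P_subgroup subgroup.mem_carrier by fast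
lemma P_pi: "x \<in> P \<Longrightarrow> x \<in> pi_elements \<pi>" using subgroup_pi_elements[OF P_subgroup P_card] by blast
lemma P_conj: "g \<in> carrier G \<Longrightarrow> x \<in> P \<Longrightarrow> g \<otimes> x \<otimes> inv g \<in> P" using normal_invE(2)[OF P_normal] .
lemma P_mult: "x \<in> P \<Longrightarrow> y \<in> P \<Longrightarrow> x \<otimes> y \<in> P" using subgroup.m_closed[OF P_subgroup] .
lemma P_inv: "x \<in> P \<Longrightarrow> inv x \<in> P" using subgroup.m_inv_closed[OF P_subgroup] .
lemma P_pow: "x \<in> P \<Longrightarrow> x [^] (n::nat) \<in> P" using subgroup_pow_closed[OF P_subgroup] .

lemma T_normal: "T \<lhd> G" unfolding T_def by (rule pi_residual_normal)
lemma T_subgroup: "subgroup T G" using T_normal normal_imp_subgroup by blast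
lemma T_carrier: "x \<in> T \<Longrightarrow> x \<in> carrier G" using T_subgroup subgroup.mem_carrier by fast
lemma T_inv: "x \<in> T \<Longrightarrow> inv x \<in> T" using subgroup.m_inv_closed[OF T_subgroup] .
lemma T_mult: "x \<in> T \<Longrightarrow> y \<in> T \<Longrightarrow> x \<otimes> y \<in> T" using subgroup.m_closed[OF T_subgroup] .
lemma T_conj: "g \<in> carrier G \<Longrightarrow> x \<in> T \<Longrightarrow> g \<otimes> x \<otimes> inv g \<in> T" using normal_invE(2)[OF T_normal] .

lemma V_T: "v \<in> V \<Longrightarrow> v \<in> T" unfolding V_def T_def using pi_elements_subset_residual by blast
lemma V_carrier: "v \<in> V \<Longrightarrow> v \<in> carrier G" using V_T T_carrier by blast
lemma V_conj: "g \<in> carrier G \<Longrightarrow> v \<in> V \<Longrightarrow> g \<otimes> v \<otimes> inv g \<in> V" unfolding V_def by (rule pi_elements_conj)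

lemma power_inv:
  assumes "t \<in> T" "x \<in> P" shows "\<exists>k. inv t \<otimes> x \<otimes> t = x [^] Suc k"
  using power[OF T_inv[OF assms(1)] assms(2)] T_carrier[OF assms(1)] by simp

lemma prime_in_pi:
  assumes "x \<in> P" "x \<in> pi_elements {p}" "x \<noteq> \<one>" shows "p \<in> \<pi>"
  using pi_elements_disjoint[of x \<pi> "{p}"] P_pi assms by blast

lemma moved_exponent:
  assumes p: "Factorial_Ring.prime p" and v: "v \<in> V" and x: "x \<in> P" "x \<in> pi_elements {p}"
    and moved: "v \<otimes> x \<noteq> x \<otimes> v" and k: "v \<otimes> x \<otimes> inv v = x [^] Suc k"
  shows "\<not> p dvd k"
proof -
  have "x \<noteq> \<one>" using moved V_carrier[OF v] by auto
  then have p\<pi>: "p \<in> \<pi>" using prime_in_pi x by blast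
  obtain n where n: "v [^] n = \<one>" "pi_number (- \<pi>) n" using v by (auto simp: V_def pi_elements_def)
  have "\<not> p dvd n" using n(2) p p\<pi> pi_number_primeD by blast
  then show ?thesis
    using coprime_conj_exponent[OF p x(2) V_carrier[OF v] k _ _ moved, of n] n(1) P_carrier[OF x(1)] by simp
qed

text \<open>An instance of Cooper's theorem that power automorphisms are central. With
\<open>v x v\<^sup>-\<^sup>1 = x z\<close>, where \<open>z = x\<^sup>k\<close>, the element \<open>v\<close> normalises every conjugate of \<open>\<langle>y\<rangle>\<close>, and therefore \<open>z\<close>
normalises every \<open>\<langle>y\<rangle>\<close>. The automorphism group of \<open>\<langle>y\<rangle>\<close> is abelian, so \<open>z\<close> and its conjugate
\<open>v z v\<^sup>-\<^sup>1 = z\<^sup>k\<^sup>+\<^sup>1\<close> act alike on \<open>\<langle>y\<rangle>\<close>, that is, \<open>z\<^sup>k\<close> centralises \<open>y\<close>. Since \<open>p\<close> does not divide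
\<open>k\<close>, the element \<open>x\<close> is a power of \<open>z\<^sup>k\<close>.\<close>
lemma moved_central:
  assumes p: "Factorial_Ring.prime p" and v: "v \<in> V" and x: "x \<in> P" "x \<in> pi_elements {p}"
    and moved: "v \<otimes> x \<noteq> x \<otimes> v" and y: "y \<in> P"
  shows "x \<otimes> y = y \<otimes> x"
proof -
  note vT = V_T[OF v] and vc = V_carrier[OF v] and xc = P_carrier[OF x(1)] and yc = P_carrier[OF y]
  obtain k where k: "v \<otimes> x \<otimes> inv v = x [^] Suc k" using power[OF vT x(1)] by blast
  have pk: "\<not> p dvd k" using moved_exponent[OF p v x moved k] .
  define z where "z = x [^] k"
  have zc: "z \<in> carrier G" using xc by (simp add: z_def)
  have xz: "x [^] Suc k = x \<otimes> z" unfolding z_def using xc by (rule nat_pow_Suc2)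
  \<comment> \<open>Here \<open>?w\<close> is the preimage of \<open>y\<close> under conjugation by \<open>v\<close>; conjugating \<open>x ?w x\<^sup>-\<^sup>1\<close> by \<open>v\<close> gives
    \<open>x (z y z\<^sup>-\<^sup>1) x\<^sup>-\<^sup>1\<close>.\<close>
  have norm: "\<exists>r::nat. z \<otimes> y \<otimes> inv z = y [^] r"
  proof -
    obtain l where l: "inv v \<otimes> y \<otimes> v = y [^] Suc l" using power_inv[OF vT y] by blast
    let ?w = "y [^] Suc l"
    have wP: "?w \<in> P" using P_pow[OF y] .
    note wc = P_carrier[OF wP]
    have vw: "v \<otimes> ?w \<otimes> inv v = y" using conj_conj_inv(1)[OF vc yc] l by simp
    have "x \<otimes> ?w \<otimes> inv x \<in> P" using P_conj[OF xc wP] .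
    then obtain j where "v \<otimes> (x \<otimes> ?w \<otimes> inv x) \<otimes> inv v = (x \<otimes> ?w \<otimes> inv x) [^] Suc j"
      using power[OF vT] by blast
    also have "\<dots> = x \<otimes> ?w [^] Suc j \<otimes> inv x" by (simp only: conj_pow[OF xc wc])
    finally have e1: "v \<otimes> (x \<otimes> ?w \<otimes> inv x) \<otimes> inv v = x \<otimes> ?w [^] Suc j \<otimes> inv x" .
    have "v \<otimes> (x \<otimes> ?w \<otimes> inv x) \<otimes> inv v
        = (v \<otimes> x \<otimes> inv v) \<otimes> (v \<otimes> ?w \<otimes> inv v) \<otimes> (v \<otimes> inv x \<otimes> inv v)"
      using conj_mult[OF vc, of "x \<otimes> ?w" "inv x"] conj_mult[OF vc xc wc] xc wc by simp
    also have "\<dots> = (x \<otimes> z) \<otimes> y \<otimes> inv (x \<otimes> z)" unfolding conj_inv[OF vc xc] k vw xz ..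
    also have "\<dots> = x \<otimes> (z \<otimes> y \<otimes> inv z) \<otimes> inv x" using conj_by_mult[OF xc zc yc] .
    finally have "x \<otimes> (z \<otimes> y \<otimes> inv z) \<otimes> inv x = x \<otimes> ?w [^] Suc j \<otimes> inv x" using e1 by simp
    then have "z \<otimes> y \<otimes> inv z = ?w [^] Suc j" using xc yc zc wc by simp
    then show ?thesis using yc by (metis nat_pow_pow)
  qed
  then obtain r :: nat where r: "z \<otimes> y \<otimes> inv z = y [^] r" by blast
  obtain l where l: "v \<otimes> y \<otimes> inv v = y [^] Suc l" using power[OF vT y] by blast
  let ?Y = "y [^] Suc l"
  have YP: "?Y \<in> P" using P_pow[OF y] .
  note Yc = P_carrier[OF YP]
  have vz: "v \<otimes> z \<otimes> inv v = z \<otimes> z [^] k"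
  proof -
    have "v \<otimes> z \<otimes> inv v = (x [^] Suc k) [^] k" unfolding z_def using conj_pow[OF vc xc] k by simp
    also have "\<dots> = z [^] Suc k" unfolding z_def using xc by (simp only: nat_pow_pow mult.commute)
    also have "\<dots> = z \<otimes> z [^] k" using zc by (rule nat_pow_Suc2)
    finally show ?thesis .
  qed
  have "z \<otimes> (z [^] k \<otimes> ?Y \<otimes> inv (z [^] k)) \<otimes> inv z = (v \<otimes> z \<otimes> inv v) \<otimes> ?Y \<otimes> inv (v \<otimes> z \<otimes> inv v)"
    unfolding vz using conj_by_mult[of z "z [^] k" ?Y] zc Yc by simp
  also have "\<dots> = (v \<otimes> z \<otimes> inv v) \<otimes> (v \<otimes> y \<otimes> inv v) \<otimes> (v \<otimes> inv z \<otimes> inv v)"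
    unfolding conj_inv[OF vc zc] l ..
  also have "\<dots> = v \<otimes> (z \<otimes> y \<otimes> inv z) \<otimes> inv v"
    using conj_mult[OF vc, of "z \<otimes> y" "inv z"] conj_mult[OF vc zc yc] zc yc by simp
  also have "\<dots> = ?Y [^] r" unfolding r using conj_pow[OF vc yc] l by simp
  also have "\<dots> = z \<otimes> ?Y \<otimes> inv z"
  proof -
    have "z \<otimes> ?Y \<otimes> inv z = (y [^] r) [^] Suc l" using conj_pow[OF zc yc, of "Suc l"] r by simp
    then show ?thesis using yc by (simp only: nat_pow_pow mult.commute)
  qed
  finally have "z [^] k \<otimes> ?Y \<otimes> inv (z [^] k) = ?Y" using zc Yc by simp
  then have zY: "?Y \<otimes> z [^] k = z [^] k \<otimes> ?Y" using conj_eq_iff_commute[of "z [^] k" ?Y] zc Yc by (metis nat_pow_closed)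
  obtain j where j: "inv v \<otimes> ?Y \<otimes> v = ?Y [^] Suc j" using power_inv[OF vT YP] by blast
  have "y = ?Y [^] Suc j" using conj_conj_inv(2)[OF vc yc] l j by simp
  then have yz: "z [^] k \<otimes> y = y \<otimes> z [^] k"
    using commute_pow[of ?Y "z [^] k" "Suc j"] zY Yc zc by (metis nat_pow_closed)
  have "\<not> p dvd k * k" using pk p prime_dvd_mult_nat by blast
  then obtain i :: nat where "(x [^] (k * k)) [^] i = x" using coprime_pow_generates[OF x(2) _ p] by blast
  then have "x = (z [^] k) [^] i" using xc by (simp add: z_def nat_pow_pow)
  then show ?thesis using commute_pow[of "z [^] k" y i] yz yc zc by (metis nat_pow_closed)
qed

text \<open>As \<open>x\<close> is central, \<open>v\<close> maps \<open>x y\<close> both to \<open>x\<^sup>k\<^sup>+\<^sup>1 y\<close> and to a power \<open>(x y)\<^sup>m\<^sup>+\<^sup>1\<close>, whence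
\<open>x\<^sup>k = x\<^sup>m y\<^sup>m\<close>. Applying \<open>v\<close> again shows that \<open>x\<^sup>k\<close> and \<open>x\<^sup>m\<close> have the same \<open>k\<close>-th power, so
\<open>y\<^sup>m = \<one>\<close> and \<open>x\<^sup>k = x\<^sup>m\<close>, and \<open>m\<close> is prime to \<open>p\<close> along with \<open>k\<close>.\<close>
lemma fixed_trivial:
  assumes p: "Factorial_Ring.prime p" and v: "v \<in> V" and x: "x \<in> P" "x \<in> pi_elements {p}"
    and moved: "v \<otimes> x \<noteq> x \<otimes> v" and y: "y \<in> P" "y \<in> pi_elements {p}" and fixed: "v \<otimes> y = y \<otimes> v"
  shows "y = \<one>"
proof -
  note vT = V_T[OF v] and vc = V_carrier[OF v] and xc = P_carrier[OF x(1)] and yc = P_carrier[OF y(1)]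
  have xy: "x \<otimes> y = y \<otimes> x" using moved_central[OF p v x moved y(1)] .
  obtain k where k: "v \<otimes> x \<otimes> inv v = x [^] Suc k" using power[OF vT x(1)] by blast
  have pk: "\<not> p dvd k" using moved_exponent[OF p v x moved k] .
  have vy: "v \<otimes> y \<otimes> inv v = y" using fixed conj_eq_iff_commute[OF vc yc] by simp
  obtain m where m: "v \<otimes> (x \<otimes> y) \<otimes> inv v = (x \<otimes> y) [^] Suc m" using power[OF vT P_mult[OF x(1) y(1)]] by blast
  have "x [^] k \<otimes> (x \<otimes> y) = (x \<otimes> y) [^] m \<otimes> (x \<otimes> y)"
    using conj_mult[OF vc xc yc] m k vy xc yc by (simp add: m_assoc)
  then have "x [^] k = (x \<otimes> y) [^] m" using xc yc by simp
  then have e: "x [^] k = x [^] m \<otimes> y [^] m" using pow_mult_distrib[OF xy xc yc] by simp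
  have "(x [^] Suc k) [^] k = (x [^] Suc k) [^] m \<otimes> y [^] m"
    using arg_cong[OF e, of "\<lambda>w. v \<otimes> w \<otimes> inv v"] conj_mult[OF vc, of "x [^] m" "y [^] m"]
      conj_pow[OF vc xc] conj_pow[OF vc yc] k vy xc yc by simp
  also have "\<dots> = x [^] (k * m) \<otimes> (x [^] m \<otimes> y [^] m)"
  proof -
    have "(x [^] Suc k) [^] m = x [^] (k * m + m)" using nat_pow_pow[OF xc, of "Suc k" m] by (simp add: add.commute)
    then have "(x [^] Suc k) [^] m = x [^] (k * m) \<otimes> x [^] m" using nat_pow_mult[OF xc] by simp
    then show ?thesis using xc yc by (simp add: m_assoc)
  qed
  also have "\<dots> = x [^] (k * m) \<otimes> x [^] k" using e by simp
  finally have "(x [^] Suc k) [^] k = x [^] (k * m) \<otimes> x [^] k" .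
  moreover have "(x [^] Suc k) [^] k = x [^] (k * k) \<otimes> x [^] k"
    using nat_pow_pow[OF xc, of "Suc k" k] nat_pow_mult[OF xc, of "k * k" k] by (simp add: add.commute)
  ultimately have "x [^] (k * k) \<otimes> x [^] k = x [^] (k * m) \<otimes> x [^] k" by simp
  then have kk: "x [^] (k * k) = x [^] (k * m)" using xc by simp
  have "x [^] m \<otimes> y [^] m = y [^] m \<otimes> x [^] m"
    using commute_pow[OF xc, of "y [^] m" m] commute_pow[OF yc xc xy[symmetric], of m] yc by (metis nat_pow_closed)
  then have "(x [^] k) [^] k = (x [^] m) [^] k \<otimes> (y [^] m) [^] k"
    unfolding e using xc yc by (intro pow_mult_distrib) auto
  then have "(x [^] m) [^] k = (x [^] m) [^] k \<otimes> (y [^] m) [^] k"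
    using kk xc by (simp add: nat_pow_pow mult.commute)
  then have "(y [^] m) [^] k = \<one>" using xc yc by (metis l_cancel_one' nat_pow_closed)
  then have ym: "y [^] m = \<one>" using coprime_pow_eq_one pk p pi_elements_pow[OF y(2)] by blast
  show ?thesis
  proof (cases "p dvd m")
    case False
    then show ?thesis using coprime_pow_eq_one ym p y(2) by blast
  next
    case True
    then obtain d where d: "m = p * d" by blast
    have "x [^] k = x [^] (p * d)" using e ym xc d by simp
    moreover obtain i :: nat where "(x [^] k) [^] i = x" using coprime_pow_generates[OF x(2) pk p] by blast
    ultimately have "x = x [^] (p * (d * i))" using xc by (simp add: nat_pow_pow mult.assoc)
    then have "x = \<one>" using p_element_not_pth_power x(2) p by blast
    then show ?thesis using moved vc by simp
  qed
qed

definition moved_primes where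
  "moved_primes = {p. Factorial_Ring.prime p \<and> (\<exists>x\<in>P \<inter> pi_elements {p}. \<exists>v\<in>V. v \<otimes> x \<noteq> x \<otimes> v)}"

definition Z where "Z = P \<inter> pi_elements moved_primes"
definition C where "C = P \<inter> centraliser V"

lemma moved_primeD:
  assumes "p \<in> moved_primes"
  shows "\<exists>v\<in>V. \<forall>y\<in>P \<inter> pi_elements {p}. y \<noteq> \<one> \<longrightarrow> v \<otimes> y \<noteq> y \<otimes> v"
  using assms fixed_trivial unfolding moved_primes_def by blast

lemma moved_prime_cases:
  assumes "y \<in> pi_elements moved_primes" "y \<in> pi_elements {p}" "y \<noteq> \<one>"
  shows "p \<in> moved_primes"
  using assms pi_elements_disjoint[of y moved_primes "{p}"] by blast

text \<open>By \<open>fixed_trivial\<close> a single \<open>\<pi>'\<close>-element moves all nontrivial elements of order a power of a moved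
prime, so that \<open>moved_central\<close> applies to all of them.\<close>
lemma Z_central:
  assumes x: "x \<in> Z" and y: "y \<in> P"
  shows "x \<otimes> y = y \<otimes> x"
proof -
  note yc = P_carrier[OF y]
  have xP: "x \<in> P" using x by (simp add: Z_def)
  have "x \<in> centraliser {y}"
  proof (rule mem_by_prime_parts[OF P_carrier[OF xP]])
    show "subgroup (centraliser {y}) G" using yc by (intro centraliser_subgroup) simp
    fix p m assume p: "Factorial_Ring.prime p" "x [^] (m::nat) \<in> pi_elements {p}"
    show "x [^] m \<in> centraliser {y}"
    proof (cases "x [^] m = \<one>")
      case False
      have xm: "x [^] m \<in> P" "x [^] m \<in> pi_elements moved_primes"
        using x P_pow pi_elements_pow by (auto simp: Z_def)
      then have "p \<in> moved_primes" using moved_prime_cases p(2) False by blast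
      then obtain v where "v \<in> V" "v \<otimes> x [^] m \<noteq> x [^] m \<otimes> v"
        using moved_primeD xm(1) p(2) False by blast
      then have "x [^] m \<otimes> y = y \<otimes> x [^] m" using moved_central p xm(1) y by blast
      then show ?thesis using P_carrier[OF xm(1)] unfolding centraliser_def by blast
    qed (simp add: centraliser_def yc)
  qed
  then show ?thesis by (simp add: centraliser_def)
qed

lemma Z_normal: "Z \<lhd> G"
proof (rule normal_invI)
  show "subgroup Z G"
  proof (rule subgroup_of_mult_closed)
    show "Z \<subseteq> carrier G" using P_carrier by (auto simp: Z_def)
    show "\<one> \<in> Z" using subgroup.one_closed[OF P_subgroup] by (simp add: Z_def)
    fix x y assume xy: "x \<in> Z" "y \<in> Z"
    then have "x \<in> P" "y \<in> P" by (auto simp: Z_def)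
    then show "x \<otimes> y \<in> Z"
      using xy Z_central[OF xy(1)] P_mult pi_elements_commuting_mult[of x _ y] by (simp add: Z_def)
  qed
qed (auto simp: Z_def P_conj pi_elements_conj)

lemma C_normal: "C \<lhd> G"
  unfolding C_def using V_carrier V_conj by (intro normal_subgroup_intersect P_normal centraliser_normal) auto

lemma unmoved_in_C:
  assumes c: "c \<in> P" "c \<in> pi_elements (- moved_primes)"
  shows "c \<in> C"
proof -
  have "c \<otimes> v = v \<otimes> c" if v: "v \<in> V" for v
  proof -
    note vc = V_carrier[OF v]
    have "c \<in> centraliser {v}"
    proof (rule mem_by_prime_parts[OF P_carrier[OF c(1)]])
      show "subgroup (centraliser {v}) G" using vc by (intro centraliser_subgroup) simp
      fix p m assume p: "Factorial_Ring.prime p" "c [^] (m::nat) \<in> pi_elements {p}"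
      have cm: "c [^] m \<in> P" "c [^] m \<in> pi_elements (- moved_primes)"
        using c P_pow pi_elements_pow by auto
      have "v \<otimes> c [^] m = c [^] m \<otimes> v"
      proof (cases "p \<in> moved_primes")
        case True
        then have "c [^] m = \<one>" using cm(2) p(2) pi_elements_disjoint[of _ "- moved_primes" "{p}"] by blast
        then show ?thesis using vc by simp
      next
        case False
        then show ?thesis using p cm(1) v unfolding moved_primes_def by blast
      qed
      then show "c [^] m \<in> centraliser {v}" using P_carrier[OF cm(1)] by (simp add: centraliser_def)
    qed
    then show ?thesis by (simp add: centraliser_def)
  qed
  then show ?thesis using c(1) P_carrier by (simp add: C_def centraliser_def)
qed

text \<open>A part of order a power of a moved prime would be moved by some \<open>\<pi>'\<close>-element unless it is trivial.\<close>
lemma C_unmoved: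
  assumes c: "c \<in> C"
  shows "c \<in> pi_elements (- moved_primes)"
proof -
  have sC: "subgroup C G" using C_normal normal_imp_subgroup by blast
  have cP: "c \<in> P" using c by (simp add: C_def)
  obtain m m' where m: "c [^] (m::nat) \<in> pi_elements moved_primes" "c [^] (m'::nat) \<in> pi_elements (- moved_primes)"
      "c = c [^] m \<otimes> c [^] m'" using pi_decomposition[OF P_carrier[OF cP]] by blast
  have "c [^] m \<in> {\<one>}"
  proof (rule mem_by_prime_parts[OF _ triv_subgroup])
    show "c [^] m \<in> carrier G" using P_carrier[OF cP] by simp
    fix p j assume p: "Factorial_Ring.prime p" "(c [^] m) [^] (j::nat) \<in> pi_elements {p}"
    let ?d = "(c [^] m) [^] j"
    have d: "?d \<in> C" "?d \<in> pi_elements moved_primes" using c m(1) subgroup_pow_closed[OF sC] pi_elements_pow by auto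
    show "?d \<in> {\<one>}"
    proof (rule ccontr)
      assume "?d \<notin> {\<one>}"
      then have ne: "?d \<noteq> \<one>" by simp
      then obtain v where "v \<in> V" "v \<otimes> ?d \<noteq> ?d \<otimes> v"
        using moved_primeD[OF moved_prime_cases[OF d(2) p(2) ne]] d(1) p(2) by (auto simp: C_def)
      moreover have "?d \<in> centraliser V" using d(1) by (simp add: C_def)
      ultimately show False unfolding centraliser_def by auto
    qed
  qed
  then have "c = c [^] m'" using m(3) P_carrier[OF cP] by simp
  then show ?thesis using m(2) by simp
qed

lemma Z_Int_C: "Z \<inter> C = {\<one>}"
proof -
  have "x = \<one>" if "x \<in> Z" "x \<in> C" for x
    using that C_unmoved pi_elements_disjoint[of x moved_primes "- moved_primes"] by (auto simp: Z_def)
  then show ?thesis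
    using subgroup.one_closed[OF normal_imp_subgroup[OF Z_normal]] subgroup.one_closed[OF normal_imp_subgroup[OF C_normal]] by blast
qed

lemma P_decomposition:
  assumes e: "e \<in> P"
  shows "\<exists>m::nat. e [^] m \<in> Z \<and> e \<otimes> inv (e [^] m) \<in> C"
proof -
  obtain m m' where m: "e [^] (m::nat) \<in> pi_elements moved_primes" "e [^] (m'::nat) \<in> pi_elements (- moved_primes)"
      "e [^] m' = e \<otimes> inv (e [^] m)" using pi_decomposition[OF P_carrier[OF e]] by blast
  then have "e [^] m' \<in> C" using unmoved_in_C P_pow[OF e] by blast
  then show ?thesis using m P_pow[OF e] by (auto simp: Z_def)
qed

lemma Z_subgroup: "subgroup Z G" using Z_normal normal_imp_subgroup by blast
lemma Z_P: "x \<in> Z \<Longrightarrow> x \<in> P" by (simp add: Z_def)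
lemma C_P: "x \<in> C \<Longrightarrow> x \<in> P" by (simp add: C_def)

lemma C_commute_V: "c \<in> C \<Longrightarrow> v \<in> V \<Longrightarrow> c \<otimes> v = v \<otimes> c"
  by (simp add: C_def centraliser_def)

text \<open>The Hall-Higman argument for \<open>\<pi>\<close>-separable groups: otherwise there is a normal subgroup \<open>K\<close>
immediately above \<open>W = C(P) \<inter> P\<close> inside \<open>C(P)\<close>. It is not a \<open>\<pi>\<close>-group, and if \<open>K/W\<close> is a
\<open>\<pi>'\<close>-group, the central subgroup \<open>W\<close> has a complement in \<open>K\<close> that consists of all \<open>\<pi>'\<close>-elements of \<open>K\<close>;
this is a nontrivial normal \<open>\<pi>'\<close>-subgroup of the whole group.\<close>
lemma centraliser_P_subset: "centraliser P \<subseteq> P"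
proof (rule ccontr)
  assume not: "\<not> centraliser P \<subseteq> P"
  have nC: "centraliser P \<lhd> G" using P_carrier P_conj by (intro centraliser_normal) auto
  define W where "W = centraliser P \<inter> P"
  have nW: "W \<lhd> G" unfolding W_def using normal_subgroup_intersect nC P_normal by blast
  then have sW: "subgroup W G" by (rule normal_imp_subgroup)
  have "W \<subset> centraliser P" using not by (auto simp: W_def)
  then obtain K where K: "K \<lhd> G" "W \<subset> K" "K \<subseteq> centraliser P"
      "pi_number \<pi> (card K div card W) \<or> pi_number (- \<pi>) (card K div card W)"
    using separable nW nC unfolding pi_separable_def by blast
  have sK: "subgroup K G" using K(1) by (rule normal_imp_subgroup)
  have WK: "W \<subseteq> K" using K(2) by blast
  have "card W dvd card P" using card_subgroup_dvd[OF sW P_subgroup] by (simp add: W_def)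
  then have cW: "pi_number \<pi> (card W)" using P_card pi_number_dvd by blast
  show False
  proof (cases "pi_number \<pi> (card K div card W)")
    case True
    then have "pi_number \<pi> (card K)" using card_eq_index_mult[OF sW sK WK] cW pi_number_mult by metis
    then have "K \<subseteq> P" using P_greatest K(1) by blast
    then show False using K(2,3) unfolding W_def by blast
  next
    case False
    then have idx: "pi_number (- \<pi>) (card K div card W)" using K(4) by blast
    let ?K = "G\<lparr>carrier := K\<rparr>"
    interpret K: finite_group ?K using subgroup_finite_group[OF sK] .
    have "W \<lhd> ?K" using normal_restrict_supergroup[OF sK nW WK] .
    then obtain U where U: "subgroup U ?K" "W \<inter> U = {\<one>}" "W <#> U = K" "card U = card K div card W"
      using K.schur_zassenhaus[of W] pi_number_coprime[OF cW idx] by (auto simp: order_def)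
    have sU: "subgroup U G" using incl_subgroup[OF sK U(1)] .
    have U\<pi>: "U \<subseteq> pi_elements (- \<pi>)" using subgroup_pi_elements[OF sU] U(4) idx by simp
    have "K \<inter> pi_elements (- \<pi>) \<subseteq> U"
    proof clarify
      fix k assume k: "k \<in> K" "k \<in> pi_elements (- \<pi>)"
      obtain w u where wu: "w \<in> W" "u \<in> U" "k = w \<otimes> u" using k(1) U(3) by (auto simp: set_mult_def)
      have c: "w \<in> carrier G" "u \<in> carrier G" using wu sW sU subgroup.mem_carrier by metis+
      have "u \<in> K" using subgroup.subset[OF U(1)] wu(2) by auto
      then have com: "w \<otimes> u = u \<otimes> w"
        using K(3) wu(1) unfolding W_def centraliser_def by force
      obtain n where n: "pi_number (- \<pi>) n" "k [^] n = \<one>" using k(2) by (auto simp: pi_elements_def)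
      have "w [^] n \<otimes> u [^] n = \<one>" using n(2) wu(3) pow_mult_distrib[OF com c] by simp
      then have "w [^] n = inv (u [^] n)" using c by (simp add: inv_equality)
      then have "w [^] n \<in> U"
        using subgroup_pow_closed[OF sU wu(2)] subgroup.m_inv_closed[OF sU] by simp
      then have "w [^] n \<in> W \<inter> U" using subgroup_pow_closed[OF sW wu(1)] by blast
      then have "w \<in> pi_elements (- \<pi>)" using U(2) c(1) n(1) pi_elementsI by blast
      moreover have "w \<in> pi_elements \<pi>" using subgroup_pi_elements[OF sW cW] wu(1) by blast
      ultimately have "w = \<one>" using pi_elements_disjoint[of w \<pi> "- \<pi>"] by blast
      then show "k \<in> U" using wu c by simp
    qed
    then have Ueq: "U = K \<inter> pi_elements (- \<pi>)" using U\<pi> subgroup.subset[OF U(1)] by auto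
    have "U \<lhd> G"
    proof (rule normal_invI[OF sU])
      fix x h assume "x \<in> carrier G" "h \<in> U"
      then show "x \<otimes> h \<otimes> inv x \<in> U"
        unfolding Ueq using normal_invE(2)[OF K(1)] pi_elements_conj by blast
    qed
    then have "U \<subseteq> {\<one>}" using pi_core_greatest[of U "- \<pi>"] U(4) idx reduced by simp
    then have "U = {\<one>}" using subgroup.one_closed[OF sU] by blast
    then have "card K div card W = 1" using U(4) by simp
    then have "card K = card W" using card_eq_index_mult[OF sW sK WK] by (metis mult_1_right)
    then show False using K(2) psubset_card_mono[OF subgroup_finite[OF sK] K(2)] by simp
  qed
qed

lemma mem_P_if_commutes:
  assumes "g \<in> carrier G" "\<And>x. x \<in> P \<Longrightarrow> g \<otimes> x = x \<otimes> g"
  shows "g \<in> P"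
  using centraliser_P_subset assms unfolding centraliser_def by blast

text \<open>Since automorphisms of a cyclic group commute, \<open>s t\<close> and \<open>t s\<close> act alike on \<open>P\<close>; now
\<open>P\<close> contains its centraliser.\<close>
lemma T_commutator: 
  assumes s: "s \<in> T" and t: "t \<in> T"
  shows "(s \<otimes> t) \<otimes> inv (t \<otimes> s) \<in> P"
proof (rule mem_P_if_commutes)
  note sc = T_carrier[OF s] and tc = T_carrier[OF t]
  show "(s \<otimes> t) \<otimes> inv (t \<otimes> s) \<in> carrier G" using sc tc by simp
  fix y assume y: "y \<in> P"
  note yc = P_carrier[OF y]
  define x where "x = inv (t \<otimes> s) \<otimes> y \<otimes> (t \<otimes> s)"
  have x: "x \<in> P" using P_conj[of "inv (t \<otimes> s)" y] y sc tc by (simp add: x_def)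
  note xc = P_carrier[OF x]
  have yx: "y = (t \<otimes> s) \<otimes> x \<otimes> inv (t \<otimes> s)" unfolding x_def using conj_conj_inv(1)[of "t \<otimes> s" y] sc tc yc by simp
  obtain a b :: nat where ab: "s \<otimes> x \<otimes> inv s = x [^] a" "t \<otimes> x \<otimes> inv t = x [^] b" using power x s t by meson
  have "(s \<otimes> t) \<otimes> x \<otimes> inv (s \<otimes> t) = (x [^] a) [^] b"
    using conj_by_mult[OF sc tc xc] ab conj_pow[OF sc xc] by simp
  also have "\<dots> = (x [^] b) [^] a" using xc by (simp only: nat_pow_pow mult.commute)
  also have "\<dots> = (t \<otimes> s) \<otimes> x \<otimes> inv (t \<otimes> s)"
    using conj_by_mult[OF tc sc xc] ab conj_pow[OF tc xc] by simp
  finally have e: "(s \<otimes> t) \<otimes> x \<otimes> inv (s \<otimes> t) = y" using yx by simp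
  have xy: "inv (t \<otimes> s) \<otimes> y \<otimes> inv (inv (t \<otimes> s)) = x" unfolding x_def using sc tc by simp
  have "((s \<otimes> t) \<otimes> inv (t \<otimes> s)) \<otimes> y \<otimes> inv ((s \<otimes> t) \<otimes> inv (t \<otimes> s)) = y"
    using conj_by_mult[of "s \<otimes> t" "inv (t \<otimes> s)" y] xy e sc tc yc by simp
  then show "((s \<otimes> t) \<otimes> inv (t \<otimes> s)) \<otimes> y = y \<otimes> ((s \<otimes> t) \<otimes> inv (t \<otimes> s))"
    using conj_eq_iff_commute[of "(s \<otimes> t) \<otimes> inv (t \<otimes> s)" y] sc tc yc by simp
qed

text \<open>The group \<open>T P/P\<close> is abelian, so its \<open>\<pi>\<close>-elements form a normal \<open>\<pi>\<close>-subgroup of \<open>G/P\<close>, which is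
trivial by maximality of \<open>P\<close>.\<close>
lemma pi_elements_T_subset: "T \<inter> pi_elements \<pi> \<subseteq> P"
proof -
  interpret Q: surj_hom G "G Mod P" "\<lambda>x. P #> x" using quotient_surj_hom P_normal by blast
  have Ker: "Q.Ker = P" using quotient_surj_hom P_normal by blast
  define W where "W = {t \<in> T. P #> t \<in> Q.H.pi_elements \<pi>}"
  have sW: "subgroup W G"
  proof (rule subgroup_of_mult_closed)
    show "W \<subseteq> carrier G" using T_carrier by (auto simp: W_def)
    show "\<one> \<in> W" using subgroup.one_closed[OF T_subgroup] Q.hom_pi_elements[OF one_pi_element] by (simp add: W_def)
    fix s t assume st: "s \<in> W" "t \<in> W"
    then have sT: "s \<in> T" "t \<in> T" by (auto simp: W_def)
    then have c: "s \<in> carrier G" "t \<in> carrier G" using T_carrier by auto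
    have "P #> (s \<otimes> t) = P #> (t \<otimes> s)"
      using Q.h_eq_iff[of "s \<otimes> t" "t \<otimes> s"] T_commutator[OF sT] c Ker by simp
    then have "(P #> s) \<otimes>\<^bsub>G Mod P\<^esub> (P #> t) = (P #> t) \<otimes>\<^bsub>G Mod P\<^esub> (P #> s)"
      using Q.hom_mult[OF c] Q.hom_mult[OF c(2,1)] by simp
    then have "(P #> s) \<otimes>\<^bsub>G Mod P\<^esub> (P #> t) \<in> Q.H.pi_elements \<pi>"
      using st Q.H.pi_elements_commuting_mult by (simp add: W_def)
    then show "s \<otimes> t \<in> W" using T_mult[OF sT] Q.hom_mult[OF c] by (simp add: W_def)
  qed
  have nW: "W \<lhd> G"
  proof (rule normal_invI[OF sW])
    fix g t assume g: "g \<in> carrier G" and t: "t \<in> W"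
    then have tT: "t \<in> T" and tc: "t \<in> carrier G" using T_carrier by (auto simp: W_def)
    have "P #> (g \<otimes> t \<otimes> inv g) = (P #> g) \<otimes>\<^bsub>G Mod P\<^esub> (P #> t) \<otimes>\<^bsub>G Mod P\<^esub> inv\<^bsub>G Mod P\<^esub> (P #> g)"
      using Q.hom_mult[of "g \<otimes> t" "inv g"] Q.hom_mult[OF g tc] Q.hom_inv[OF g] g tc by simp
    moreover have "\<dots> \<in> Q.H.pi_elements \<pi>"
      using Q.H.pi_elements_conj[of "P #> g" "P #> t"] Q.hom_closed[OF g] t by (simp add: W_def)
    ultimately show "g \<otimes> t \<otimes> inv g \<in> W" using T_conj[OF g tT] by (simp add: W_def)
  qed
  have "W \<subseteq> pi_elements \<pi>"
  proof
    fix t assume t: "t \<in> W"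
    then have tc: "t \<in> carrier G" using T_carrier by (auto simp: W_def)
    obtain n where n: "pi_number \<pi> n" "(P #> t) [^]\<^bsub>G Mod P\<^esub> n = \<one>\<^bsub>G Mod P\<^esub>"
      using t by (auto simp: W_def Q.H.pi_elements_def)
    then have "t [^] n \<in> Q.Ker" using tc Q.hom_nat_pow[OF tc, of n] by (simp add: kernel_def)
    then have "t [^] n \<in> P" using Ker by simp
    then obtain m where m: "pi_number \<pi> m" "(t [^] n) [^] m = \<one>" using P_pi by (auto simp: pi_elements_def)
    then show "t \<in> pi_elements \<pi>" using tc n(1) by (intro pi_elementsI[of _ "n * m"]) (auto simp: nat_pow_pow pi_number_mult)
  qed
  then have "W \<subseteq> P" using P_greatest[OF nW] pi_subgroup_iff[OF sW] by blast
  then show ?thesis using Q.hom_pi_elements by (auto simp: W_def)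
qed

lemma T_power_in_P:
  assumes u: "u \<in> T" and p: "Factorial_Ring.prime p" "p \<in> \<pi>"
  shows "\<exists>n. \<not> p dvd n \<and> u [^] (n::nat) \<in> P"
proof -
  interpret T: finite_group "G\<lparr>carrier := T\<rparr>" using subgroup_finite_group[OF T_subgroup] .
  let ?n = "card T div card (P \<inter> T)"
  have "P \<inter> T \<lhd> G\<lparr>carrier := T\<rparr>" using normal_restrict[OF P_normal T_subgroup] .
  then have "u [^] ?n \<in> P \<inter> T"
    using T.pow_index_mem_normal[of "P \<inter> T" u] u by (simp add: order_def nat_pow_consistent[symmetric])
  moreover have "\<not> p dvd ?n"
  proof (rule prime_not_dvd_index[OF p(1) subgroups_Inter_pair[OF P_subgroup T_subgroup] T_subgroup])
    fix x assume "x \<in> T" "x \<in> pi_elements {p}"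
    then show "x \<in> P \<inter> T" using pi_elements_T_subset pi_elements_mono[of x "{p}" \<pi>] p(2) by blast
  qed simp
  ultimately show ?thesis by blast
qed

text \<open>Comparing the images of \<open>x\<close>, \<open>y\<close> and \<open>x y\<close> identifies the exponents modulo \<open>p\<close>, unless \<open>x\<close> is itself
a power of \<open>y\<close>, in which case there is nothing to compare.\<close>
lemma power_exponent_unique:
  fixes p :: nat
  assumes p: "Factorial_Ring.prime p" and v: "v \<in> T"
    and x: "x \<in> P" "x [^] p = \<one>" and y: "y \<in> P" "y [^] p = \<one>" "y \<noteq> \<one>" and comm: "x \<otimes> y = y \<otimes> x"
    and a: "v \<otimes> x \<otimes> inv v = x [^] (a::nat)" and b: "v \<otimes> y \<otimes> inv v = y [^] (b::nat)"
  shows "x [^] a = x [^] b"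
proof -
  note vc = T_carrier[OF v] and xc = P_carrier[OF x(1)] and yc = P_carrier[OF y(1)]
  have xp: "x \<in> pi_elements {p}" and yp: "y \<in> pi_elements {p}"
    using x y xc yc p pi_number_prime_self by (auto intro!: pi_elementsI[of _ p])
  obtain m where "v \<otimes> (x \<otimes> y) \<otimes> inv v = (x \<otimes> y) [^] Suc m" using power[OF v P_mult[OF x(1) y(1)]] by blast
  then obtain n :: nat where "v \<otimes> (x \<otimes> y) \<otimes> inv v = (x \<otimes> y) [^] n" by blast
  then have e: "x [^] a \<otimes> y [^] b = x [^] n \<otimes> y [^] n"
    using conj_mult[OF vc xc yc] a b pow_mult_distrib[OF comm xc yc] by simp
  show ?thesis
  proof (cases "y [^] b = y [^] n")
    case True
    then have xa: "x [^] a = x [^] n" using e xc yc by simp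
    have "ord y dvd p" using y(2) yc pow_eq_id by blast
    moreover have "ord y \<noteq> 1" using y(3) yc ord_eq_1 by blast
    ultimately have "ord y = p" using p prime_nat_iff by blast
    then have "int p dvd int n - int b"
      using True int_pow_eq[OF yc, of "int b" "int n"] by (simp add: int_pow_int)
    moreover have "int (ord x) dvd int p" using x(2) xc pow_eq_id by simp
    ultimately have "int (ord x) dvd int n - int b" using dvd_trans by blast
    then have "x [^] b = x [^] n" using int_pow_eq[OF xc, of "int b" "int n"] by (simp add: int_pow_int)
    then show ?thesis using xa by simp
  next
    case False
    define d where "d = inv (x [^] n) \<otimes> x [^] a"
    have dc: "d \<in> carrier G" using xc by (simp add: d_def)
    have d2: "d = y [^] n \<otimes> inv (y [^] b)"
    proof -
      have "inv (x [^] n) \<otimes> (x [^] a \<otimes> y [^] b) = y [^] n"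
        unfolding e using xc yc by (simp add: m_assoc[symmetric])
      then have "d \<otimes> y [^] b = y [^] n" unfolding d_def using xc yc by (simp add: m_assoc)
      then show ?thesis using dc yc by (simp add: inv_solve_right)
    qed
    have "d \<noteq> \<one>"
    proof
      assume "d = \<one>"
      then have "y [^] n = y [^] b" using d2 yc by (metis inv_solve_right' nat_pow_closed one_closed l_one)
      then show False using False by simp
    qed
    have "inv (x [^] n) = x [^] (n * (p - 1))"
    proof -
      have "n * (p - 1) + n = p * n" using prime_gt_0_nat[OF p] by (cases p) auto
      then have "x [^] (n * (p - 1)) \<otimes> x [^] n = (x [^] p) [^] n" using xc by (simp add: nat_pow_mult nat_pow_pow)
      then show ?thesis using x(2) xc by (intro inv_equality) auto
    qed
    then obtain r :: nat where r: "d = x [^] r" using xc by (auto simp: d_def nat_pow_mult)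
    have "inv (y [^] b) = y [^] (b * (p - 1))"
    proof -
      have "b * (p - 1) + b = p * b" using prime_gt_0_nat[OF p] by (cases p) auto
      then have "y [^] (b * (p - 1)) \<otimes> y [^] b = (y [^] p) [^] b" using yc by (simp add: nat_pow_mult nat_pow_pow)
      then show ?thesis using y(2) yc by (intro inv_equality) auto
    qed
    then obtain s :: nat where s: "d = y [^] s" using d2 yc by (auto simp: nat_pow_mult)
    have "\<not> p dvd r"
    proof
      assume "p dvd r"
      then obtain l where "r = p * l" by blast
      then have "d = (x [^] p) [^] l" using r xc by (simp add: nat_pow_pow)
      then show False using x(2) \<open>d \<noteq> \<one>\<close> by simp
    qed
    then obtain j :: nat where "(x [^] r) [^] j = x" using coprime_pow_generates[OF xp _ p] by blast
    then have xy: "x = y [^] (s * j)" using r s nat_pow_pow[OF yc, of s j] by simp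
    have "x [^] a = (v \<otimes> y \<otimes> inv v) [^] (s * j)" using a xy conj_pow[OF vc yc] by simp
    also have "\<dots> = (y [^] (s * j)) [^] b" unfolding b using yc by (simp add: nat_pow_pow mult.commute)
    finally show ?thesis using xy by simp
  qed
qed

lemma order_p_power:
  assumes "x \<in> pi_elements {p}" "x \<noteq> \<one>" "Factorial_Ring.prime p"
  shows "\<exists>i::nat. x [^] i \<noteq> \<one> \<and> (x [^] i) [^] p = \<one>"
proof -
  have xc: "x \<in> carrier G" using assms(1) pi_elements_carrier by blast
  have "ord x \<noteq> 1" using assms(2) xc ord_eq_1 by blast
  then obtain q where q: "Factorial_Ring.prime q" "q dvd ord x" using prime_factor_nat by blast
  have "q \<in> {p}" using assms(1) q pi_elements_ord pi_number_primeD by blast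
  then obtain i where i: "ord x = p * i" using q(2) by blast
  then have "i > 0" "i < ord x" using ord_pos[OF xc] prime_gt_1_nat[OF assms(3)] by auto
  then have "x [^] i \<noteq> \<one>" using xc pow_eq_id nat_dvd_not_less by blast
  moreover have "(x [^] i) [^] p = \<one>" using xc i pow_ord_eq_1[OF xc] by (simp add: nat_pow_pow mult.commute)
  ultimately show ?thesis by blast
qed

text \<open>The commutator is \<open>u = v w\<^sup>-\<^sup>1\<close> with the conjugate \<open>w = e v e\<^sup>-\<^sup>1\<close>. Both \<open>v\<close> and \<open>w\<close> centralise \<open>C\<close>. On
elements of order \<open>p\<close> of \<open>Z\<close> they have the same exponent by \<open>power_exponent_unique\<close>, so \<open>u\<close> fixes these
elements, and by coprimality \<open>u\<close> fixes all of \<open>Z\<close>. Thus \<open>u\<close> centralises \<open>P\<close>.\<close>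
lemma V_commutator:
  assumes v: "v \<in> V" and e: "e \<in> carrier G"
  shows "v \<otimes> e \<otimes> inv v \<otimes> inv e \<in> P"
proof (rule mem_P_if_commutes)
  define w where "w = e \<otimes> v \<otimes> inv e"
  define u where "u = v \<otimes> inv w"
  note vc = V_carrier[OF v]
  have w: "w \<in> V" unfolding w_def using V_conj[OF e v] .
  note wc = V_carrier[OF w]
  have ueq: "v \<otimes> e \<otimes> inv v \<otimes> inv e = u"
    unfolding u_def w_def using vc e by (simp add: inv_mult_group m_assoc)
  have uT: "u \<in> T" unfolding u_def using T_mult T_inv V_T v w by blast
  note uc = T_carrier[OF uT]
  show "v \<otimes> e \<otimes> inv v \<otimes> inv e \<in> carrier G" using ueq uc by simp
  have onC: "u \<otimes> c = c \<otimes> u" if c: "c \<in> C" for c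
  proof -
    note cc = P_carrier[OF C_P[OF c]]
    have "v \<otimes> c = c \<otimes> v" "w \<otimes> c = c \<otimes> w" using C_commute_V[OF c] v w by auto
    then have "v \<otimes> c \<otimes> inv v = c" "inv w \<otimes> c \<otimes> inv (inv w) = c"
      using conj_eq_iff_commute[OF vc cc] conj_eq_iff_commute[OF wc cc] conj_conj_inv(2)[OF wc cc] wc by auto
    then have "u \<otimes> c \<otimes> inv u = c" unfolding u_def using conj_by_mult[of v "inv w" c] vc wc cc by simp
    then show ?thesis using conj_eq_iff_commute[OF uc cc] by simp
  qed
  have order_p: "u \<otimes> x \<otimes> inv u = x" if x: "x \<in> Z" "x [^] p = \<one>" "x \<noteq> \<one>" and p: "Factorial_Ring.prime p" for x and p :: nat
  proof -
    have xP: "x \<in> P" using Z_P x(1) .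
    note xc = P_carrier[OF xP]
    define y where "y = inv e \<otimes> x \<otimes> e"
    have yP: "y \<in> P" unfolding y_def using P_conj[of "inv e" x] e xP by simp
    note yc = P_carrier[OF yP]
    have xy: "x = e \<otimes> y \<otimes> inv e" unfolding y_def using conj_conj_inv(1)[OF e xc] by simp
    have y1: "y \<noteq> \<one>" using xy x(3) conj_one_iff[OF e yc] by simp
    have "y [^] p = inv e \<otimes> x [^] p \<otimes> inv (inv e)" unfolding y_def using conj_pow[of "inv e" x p] e xc by simp
    then have yp: "y [^] p = \<one>" using x(2) e by simp
    obtain a where a: "v \<otimes> x \<otimes> inv v = x [^] Suc a" using power[OF V_T[OF v] xP] by blast
    obtain b where b: "v \<otimes> y \<otimes> inv v = y [^] Suc b" using power[OF V_T[OF v] yP] by blast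
    have "x [^] Suc a = x [^] Suc b"
      by (rule power_exponent_unique[OF p V_T[OF v] xP x(2) yP yp y1 Z_central[OF x(1) yP] a b])
    then have vx: "v \<otimes> x \<otimes> inv v = x [^] Suc b" using a by simp
    have wx: "w \<otimes> x \<otimes> inv w = x [^] Suc b"
    proof -
      have "w \<otimes> x \<otimes> inv w = e \<otimes> (v \<otimes> (inv e \<otimes> x \<otimes> inv (inv e)) \<otimes> inv v) \<otimes> inv e"
        unfolding w_def using conj_by_mult[of "e \<otimes> v" "inv e" x] conj_by_mult[of e v "inv e \<otimes> x \<otimes> inv (inv e)"] e vc xc by simp
      also have "inv e \<otimes> x \<otimes> inv (inv e) = y" using e by (simp add: y_def)
      also have "e \<otimes> (v \<otimes> y \<otimes> inv v) \<otimes> inv e = x [^] Suc b" unfolding b conj_pow[OF e yc] by (simp only: xy[symmetric])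
      finally show ?thesis .
    qed
    obtain c where c: "inv w \<otimes> x \<otimes> w = x [^] Suc c" using power_inv[OF V_T[OF w] xP] by blast
    have "u \<otimes> x \<otimes> inv u = v \<otimes> x [^] Suc c \<otimes> inv v"
      unfolding u_def using conj_by_mult[of v "inv w" x] c vc wc xc by simp
    also have "\<dots> = w \<otimes> x [^] Suc c \<otimes> inv w" using conj_pow[OF vc xc, of "Suc c"] conj_pow[OF wc xc, of "Suc c"] vx wx by simp
    also have "\<dots> = x" using conj_conj_inv(1)[OF wc xc] c by simp
    finally show ?thesis .
  qed
  have onZ: "u \<otimes> x = x \<otimes> u" if x: "x \<in> Z" for x
  proof -
    note xc = P_carrier[OF Z_P[OF x]]
    have "x \<in> centraliser {u}"
    proof (rule mem_by_prime_parts[OF xc])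
      show "subgroup (centraliser {u}) G" using uc by (intro centraliser_subgroup) simp
      fix p m assume p: "Factorial_Ring.prime p" "x [^] (m::nat) \<in> pi_elements {p}"
      let ?y = "x [^] m"
      have y: "?y \<in> Z" using subgroup_pow_closed[OF Z_subgroup x] .
      note yc = P_carrier[OF Z_P[OF y]]
      have "u \<otimes> ?y = ?y \<otimes> u"
      proof (rule ccontr)
        assume moved: "u \<otimes> ?y \<noteq> ?y \<otimes> u"
        then have y1: "?y \<noteq> \<one>" using uc by auto
        have p\<pi>: "p \<in> \<pi>" using prime_in_pi[OF Z_P[OF y] p(2) y1] .
        obtain k where k: "u \<otimes> ?y \<otimes> inv u = ?y [^] Suc k" using power[OF uT Z_P[OF y]] by blast
        obtain n where n: "\<not> p dvd n" "u [^] (n::nat) \<in> P" using T_power_in_P[OF uT p(1) p\<pi>] by blast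
        have pk: "\<not> p dvd k"
          using coprime_conj_exponent[OF p uc k _ n(1) moved] Z_central[OF y n(2)] by simp
        obtain i :: nat where i: "?y [^] i \<noteq> \<one>" "(?y [^] i) [^] p = \<one>" using order_p_power[OF p(2) y1 p(1)] by blast
        let ?z = "?y [^] i"
        have z: "?z \<in> Z" using subgroup_pow_closed[OF Z_subgroup y] .
        note zc = P_carrier[OF Z_P[OF z]]
        have "u \<otimes> ?z \<otimes> inv u = ?z" using order_p[OF z i(2,1) p(1)] .
        moreover have "u \<otimes> ?z \<otimes> inv u = (?y [^] Suc k) [^] i" using conj_pow[OF uc yc] k by simp
        moreover have "(?y [^] Suc k) [^] i = ?z [^] Suc k" using yc by (simp only: nat_pow_pow mult.commute)
        ultimately have "?z [^] k \<otimes> ?z = \<one> \<otimes> ?z" using zc by simp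
        then have "?z [^] k = \<one>" using zc by (metis nat_pow_closed one_closed right_cancel)
        then have "?z = \<one>" using coprime_pow_eq_one[OF pi_elements_pow[OF p(2)]] pk p(1) by blast
        then show False using i(1) by simp
      qed
      then show "?y \<in> centraliser {u}" using yc by (simp add: centraliser_def)
    qed
    then show ?thesis by (simp add: centraliser_def)
  qed
  fix x assume x: "x \<in> P"
  obtain m :: nat where m: "x [^] m \<in> Z" "x \<otimes> inv (x [^] m) \<in> C" using P_decomposition[OF x] by blast
  note xc = P_carrier[OF x]
  have "x = (x \<otimes> inv (x [^] m)) \<otimes> x [^] m" using xc by (simp add: m_assoc)
  moreover have "((x \<otimes> inv (x [^] m)) \<otimes> x [^] m) \<otimes> u = u \<otimes> ((x \<otimes> inv (x [^] m)) \<otimes> x [^] m)"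
    using commute_mult[of "x \<otimes> inv (x [^] m)" "x [^] m" u] onC[OF m(2)] onZ[OF m(1)] xc uc by simp
  ultimately have "x \<otimes> u = u \<otimes> x" by simp
  then show "v \<otimes> e \<otimes> inv v \<otimes> inv e \<otimes> x = x \<otimes> (v \<otimes> e \<otimes> inv v \<otimes> inv e)" unfolding ueq by simp
qed

text \<open>Modulo \<open>P\<close> the \<open>\<pi>'\<close>-elements are central, so a Hall \<open>\<pi>\<close>-subgroup is normalised by them and by itself,
hence is normal in the whole group and equal to \<open>P\<close>.\<close>
lemma P_hall: "pi_number (- \<pi>) (order G div card P)"
proof -
  obtain E where E: "hall_pi_subgroup \<pi> G E" using hall by blast
  then have sE: "subgroup E G" and cE: "pi_number \<pi> (card E)" "pi_number (- \<pi>) (order G div card E)"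
    by (auto simp: hall_pi_subgroup_iff)
  have PE: "P \<subseteq> E" using normal_pi_subgroup_subset_hall[OF E P_normal P_card] .
  let ?N = "normaliser E"
  have sN: "subgroup ?N G" using normaliser_subgroup subgroup.subset[OF sE] by blast
  have EN: "E \<subseteq> ?N" using subgroup_subset_normaliser[OF sE] .
  have VN: "v \<in> ?N" if v: "v \<in> V" for v
  proof -
    note vc = V_carrier[OF v]
    have "v \<otimes> e \<otimes> inv v \<in> E" if e: "e \<in> E" for e
    proof -
      have ec: "e \<in> carrier G" using subgroup.mem_carrier[OF sE e] .
      have "v \<otimes> e \<otimes> inv v \<otimes> inv e \<in> E" using V_commutator[OF v ec] PE by blast
      then have "v \<otimes> e \<otimes> inv v \<otimes> inv e \<otimes> e \<in> E" using subgroup.m_closed[OF sE _ e] by blast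
      then show ?thesis using vc ec by (simp add: m_assoc)
    qed
    then show ?thesis using vc by (simp add: normaliser_def)
  qed
  have "pi_number \<pi> (card (carrier G) div card ?N)"
  proof (rule pi_index[OF sN subgroup_self subgroup.subset[OF sN]])
    fix p x assume "p \<notin> \<pi>" "x \<in> pi_elements {p}"
    then show "x \<in> ?N" using VN pi_elements_mono[of x "{p}" "- \<pi>"] by (auto simp: V_def)
  qed
  moreover have "pi_number (- \<pi>) (card (carrier G) div card ?N)"
  proof -
    have "order G div card E = (card ?N div card E) * (card (carrier G) div card ?N)"
      using index_mult[OF sE sN subgroup_self EN subgroup.subset[OF sN]] by (simp add: order_def)
    then show ?thesis using cE(2) pi_number_dvd by (metis dvd_triv_right)
  qed
  ultimately have "card (carrier G) div card ?N = 1" using pi_number_both[of \<pi> _ "- \<pi>"] by blast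
  then have "card ?N = card (carrier G)"
    using card_eq_index_mult[OF sN subgroup_self subgroup.subset[OF sN]] by simp
  then have "?N = carrier G" using subgroup.subset[OF sN] by (simp add: card_subset_eq)
  then have "E \<lhd> G" using normal_iff_normaliser[OF sE] by simp
  then have "E \<subseteq> P" using P_greatest cE(1) by blast
  then have "E = P" using PE by blast
  then show ?thesis using cE(2) by simp
qed

lemma pi_elements_eq_P: "pi_elements \<pi> = P"
  using pi_elements_subset_normal[OF P_normal P_hall, of \<pi>] P_pi by blast

lemma hall_complement:
  obtains W where "subgroup W G" "P \<inter> W = {\<one>}" "P <#> W = carrier G" "card W = order G div card P" "W \<subseteq> V"
proof -
  obtain W where W: "subgroup W G" "P \<inter> W = {\<one>}" "P <#> W = carrier G" "card W = order G div card P"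
    using schur_zassenhaus[OF P_normal] pi_number_coprime[OF P_card P_hall] by blast
  moreover have "W \<subseteq> V" unfolding V_def using subgroup_pi_elements[OF W(1)] W(4) P_hall by simp
  ultimately show thesis using that by blast
qed

text \<open>If \<open>v\<close> moves \<open>y\<close>, the commutator of \<open>v\<close> with \<open>y\<close> generates \<open>\<langle>y\<rangle>\<close> and lies in the normal subgroup \<open>T\<close>.\<close>
lemma Z_subset_T: "Z \<subseteq> T"
proof
  fix x assume x: "x \<in> Z"
  show "x \<in> T"
  proof (rule mem_by_prime_parts[OF P_carrier[OF Z_P[OF x]] T_subgroup])
    fix p m assume p: "Factorial_Ring.prime p" "x [^] (m::nat) \<in> pi_elements {p}"
    let ?y = "x [^] m"
    have y: "?y \<in> Z" using subgroup_pow_closed[OF Z_subgroup x] .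
    note yP = Z_P[OF y]
    note yc = P_carrier[OF yP]
    show "?y \<in> T"
    proof (cases "?y = \<one>")
      case True
      then show ?thesis using subgroup.one_closed[OF T_subgroup] by simp
    next
      case False
      have "?y \<in> pi_elements moved_primes" using y by (simp add: Z_def)
      then have "p \<in> moved_primes" using moved_prime_cases p(2) False by blast
      then obtain v where v: "v \<in> V" "v \<otimes> ?y \<noteq> ?y \<otimes> v" using moved_primeD yP p(2) False by blast
      note vc = V_carrier[OF v(1)]
      obtain k where k: "v \<otimes> ?y \<otimes> inv v = ?y [^] Suc k" using power[OF V_T[OF v(1)] yP] by blast
      have "?y [^] k = v \<otimes> (?y \<otimes> inv v \<otimes> inv ?y)"
        using k vc yc by (simp add: inv_solve_right m_assoc[symmetric])
      moreover have "v \<otimes> (?y \<otimes> inv v \<otimes> inv ?y) \<in> T"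
        using T_mult[OF V_T[OF v(1)] T_conj[OF yc T_inv[OF V_T[OF v(1)]]]] .
      ultimately have "?y [^] k \<in> T" by simp
      moreover obtain j :: nat where "(?y [^] k) [^] j = ?y"
        using coprime_pow_generates[OF p(2) moved_exponent[OF p(1) v(1) yP p(2) v(2) k] p(1)] by blast
      ultimately show ?thesis using subgroup_pow_closed[OF T_subgroup] by metis
    qed
  qed
qed

text \<open>For a complement \<open>W\<close> of \<open>P\<close>, the product \<open>Z W\<close> is normal, as \<open>C\<close> centralises it, and its index is a
\<open>\<pi>\<close>-number; so it contains \<open>T\<close>, while \<open>Z W \<inter> P = Z\<close>.\<close>
lemma T_Int_P: "T \<inter> P \<subseteq> Z"
proof -
  obtain W where W: "subgroup W G" "P \<inter> W = {\<one>}" "P <#> W = carrier G" "card W = order G div card P" "W \<subseteq> V"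
    using hall_complement by blast
  let ?K = "Z <#> W"
  note K = set_mult_normal_subgroup[OF Z_normal W(1)]
  have N: "subgroup (normaliser ?K) G" using normaliser_subgroup subgroup.subset[OF K(1)] by blast
  have KN: "?K \<subseteq> normaliser ?K" using subgroup_subset_normaliser[OF K(1)] .
  have CN: "c \<in> normaliser ?K" if c: "c \<in> C" for c
  proof -
    note cc = P_carrier[OF C_P[OF c]]
    have "c \<otimes> k \<otimes> inv c \<in> ?K" if k: "k \<in> ?K" for k
    proof -
      obtain z w where zw: "z \<in> Z" "w \<in> W" "k = z \<otimes> w" using k by (auto simp: set_mult_def)
      have zc: "z \<in> carrier G" and wc: "w \<in> carrier G" using P_carrier[OF Z_P[OF zw(1)]] subgroup.mem_carrier[OF W(1) zw(2)] by auto
      have "w \<otimes> c = c \<otimes> w" "z \<otimes> c = c \<otimes> z" using C_commute_V[OF c] W(5) zw(2) Z_central[OF zw(1) C_P[OF c]] by auto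
      then have "k \<otimes> c = c \<otimes> k" using commute_mult[OF zc wc cc] zw(3) by simp
      then have "c \<otimes> k \<otimes> inv c = k" using conj_eq_iff_commute[OF cc, of k] zw(3) zc wc by simp
      then show ?thesis using k by simp
    qed
    then show ?thesis using cc by (simp add: normaliser_def)
  qed
  have PN: "x \<in> normaliser ?K" if x: "x \<in> P" for x
  proof -
    obtain m :: nat where m: "x [^] m \<in> Z" "x \<otimes> inv (x [^] m) \<in> C" using P_decomposition[OF x] by blast
    have "x = (x \<otimes> inv (x [^] m)) \<otimes> x [^] m" using P_carrier[OF x] by (simp add: m_assoc)
    moreover have "x [^] m \<in> normaliser ?K" using m(1) K(2) KN by blast
    ultimately show ?thesis using subgroup.m_closed[OF N CN[OF m(2)]] by metis
  qed
  have "carrier G \<subseteq> normaliser ?K"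
  proof
    fix g assume "g \<in> carrier G"
    then have "g \<in> P <#> W" using W(3) by simp
    then obtain x w where "x \<in> P" "w \<in> W" "g = x \<otimes> w" by (rule set_mult_obtain)
    then show "g \<in> normaliser ?K" using subgroup.m_closed[OF N PN] K(3) KN by blast
  qed
  then have nK: "?K \<lhd> G" using normal_iff_normaliser[OF K(1)] by simp
  have "pi_number \<pi> (order G div card ?K)"
  proof -
    have oG: "order G = card P * card W"
      using W(4) card_eq_index_mult[OF P_subgroup subgroup_self subgroup.subset[OF P_subgroup]] by (simp add: order_def)
    obtain k' where k': "card ?K = card W * k'" using card_subgroup_dvd[OF W(1) K(1,3)] by blast
    obtain j where j: "order G = card ?K * j"
      using card_subgroup_dvd[OF K(1) subgroup_self subgroup.subset[OF K(1)]] by (auto simp: order_def)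
    have "card P = k' * j" using oG k' j card_subgroup_pos[OF W(1)] by (simp add: ac_simps)
    then have "pi_number \<pi> j" using P_card pi_number_dvd by (metis dvd_triv_right)
    moreover have "order G div card ?K = j" using j card_subgroup_pos[OF K(1)] by simp
    ultimately show ?thesis by simp
  qed
  then have TK: "T \<subseteq> ?K" unfolding T_def using pi_residual_least_index nK by blast
  show ?thesis
  proof clarify
    fix t assume t: "t \<in> T" "t \<in> P"
    then obtain z w where zw: "z \<in> Z" "w \<in> W" "t = z \<otimes> w" using TK by (auto simp: set_mult_def)
    have zP: "z \<in> P" using Z_P zw(1) .
    have wc: "w \<in> carrier G" using subgroup.mem_carrier[OF W(1) zw(2)] .
    have "w = inv z \<otimes> t" using zw(3) P_carrier[OF zP] wc by (simp add: m_assoc[symmetric])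
    then have "w \<in> P" using P_mult[OF P_inv[OF zP] t(2)] by simp
    then have "w = \<one>" using W(2) zw(2) by blast
    then show "t \<in> Z" using zw P_carrier[OF zP] by simp
  qed
qed

text \<open>Both \<open>P\<close> and a complement of it, which consists of \<open>\<pi>'\<close>-elements, are central modulo \<open>P\<close>.\<close>
lemma commutator_in_P:
  assumes a: "a \<in> carrier G" and b: "b \<in> carrier G"
  shows "a \<otimes> b \<otimes> inv a \<otimes> inv b \<in> P"
proof -
  define B where "B = {g \<in> carrier G. \<forall>e\<in>carrier G. g \<otimes> e \<otimes> inv g \<otimes> inv e \<in> P}"
  have mult: "g \<otimes> k \<in> B" if "g \<in> B" "k \<in> B" for g k
  proof -
    have c: "g \<in> carrier G" "k \<in> carrier G" using that by (auto simp: B_def)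
    have "(g \<otimes> k) \<otimes> e \<otimes> inv (g \<otimes> k) \<otimes> inv e \<in> P" if e: "e \<in> carrier G" for e
    proof -
      have "(g \<otimes> k) \<otimes> e \<otimes> inv (g \<otimes> k) \<otimes> inv e =
          (g \<otimes> (k \<otimes> e \<otimes> inv k \<otimes> inv e) \<otimes> inv g) \<otimes> (g \<otimes> e \<otimes> inv g \<otimes> inv e)"
        using c e by (simp add: m_assoc inv_mult_group cancel_inv)
      moreover have "g \<otimes> (k \<otimes> e \<otimes> inv k \<otimes> inv e) \<otimes> inv g \<in> P" "g \<otimes> e \<otimes> inv g \<otimes> inv e \<in> P"
        using \<open>g \<in> B\<close> \<open>k \<in> B\<close> e P_conj by (auto simp: B_def)
      ultimately show ?thesis using P_mult by simp
    qed
    then show ?thesis using c by (simp add: B_def)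
  qed
  have VB: "v \<in> B" if "v \<in> V" for v using V_commutator[OF that] V_carrier[OF that] by (simp add: B_def)
  have PB: "x \<in> B" if x: "x \<in> P" for x
  proof -
    have "x \<otimes> (e \<otimes> inv x \<otimes> inv e) \<in> P" if "e \<in> carrier G" for e
      using P_mult[OF x P_conj[OF that P_inv[OF x]]] .
    then show ?thesis using P_carrier[OF x] by (simp add: B_def m_assoc)
  qed
  obtain W where W: "P <#> W = carrier G" "W \<subseteq> V" using hall_complement by metis
  have "a \<in> P <#> W" using a W(1) by simp
  then obtain x w where "x \<in> P" "w \<in> W" "a = x \<otimes> w" by (rule set_mult_obtain)
  then have "a \<in> B" using mult[OF PB VB] W(2) by auto
  then show ?thesis using b by (simp add: B_def)
qed

lemma Z_power:
  assumes x: "x \<in> Z" and g: "g \<in> carrier G"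
  shows "\<exists>k::nat. g \<otimes> x \<otimes> inv g = x [^] k"
proof -
  obtain W where W: "P <#> W = carrier G" "W \<subseteq> V" using hall_complement by metis
  have "g \<in> P <#> W" using g W(1) by simp
  then obtain y w where yw: "y \<in> P" "w \<in> W" "g = y \<otimes> w" by (rule set_mult_obtain)
  have w: "w \<in> V" using W(2) yw(2) by blast
  obtain k where k: "w \<otimes> x \<otimes> inv w = x [^] Suc k" using power[OF V_T[OF w] Z_P[OF x]] by blast
  note c = P_carrier[OF yw(1)] V_carrier[OF w] P_carrier[OF Z_P[OF x]]
  have "x [^] Suc k \<in> Z" using subgroup_pow_closed[OF Z_subgroup x] .
  then have "y \<otimes> x [^] Suc k = x [^] Suc k \<otimes> y" using Z_central yw(1) by metis
  then have "y \<otimes> x [^] Suc k \<otimes> inv y = x [^] Suc k"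
    using conj_eq_iff_commute[OF c(1), of "x [^] Suc k"] c(3) by (metis nat_pow_closed)
  then have "g \<otimes> x \<otimes> inv g = x [^] Suc k" using conj_by_mult[OF c(1,2,3)] k yw(3) by simp
  then show ?thesis by blast
qed

text \<open>Neither \<open>k\<close> nor \<open>k + 1\<close> is divisible by \<open>p\<close>, which excludes \<open>p = 2\<close>.\<close>
lemma Z_prime:
  assumes x: "x \<in> Z" "x \<in> pi_elements {p}" "x \<noteq> \<one>" and p: "Factorial_Ring.prime p"
  shows "odd p" "pi_elements {p} \<subseteq> Z"
proof -
  have xP: "x \<in> P" using Z_P x(1) .
  note xc = P_carrier[OF xP]
  have mp: "p \<in> moved_primes" using moved_prime_cases[of x p] x by (simp add: Z_def)
  then obtain v where v: "v \<in> V" "v \<otimes> x \<noteq> x \<otimes> v" using moved_primeD xP x by blast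
  note vc = V_carrier[OF v(1)]
  obtain k where k: "v \<otimes> x \<otimes> inv v = x [^] Suc k" using power[OF V_T[OF v(1)] xP] by blast
  have pk: "\<not> p dvd k" using moved_exponent[OF p v(1) xP x(2) v(2) k] .
  have pk': "\<not> p dvd Suc k"
  proof
    assume "p dvd Suc k"
    then obtain l where l: "Suc k = p * l" by blast
    obtain j where j: "inv v \<otimes> x \<otimes> v = x [^] Suc j" using power_inv[OF V_T[OF v(1)] xP] by blast
    have "x = inv v \<otimes> x [^] Suc k \<otimes> v" using conj_conj_inv(2)[OF vc xc] k by simp
    also have "\<dots> = (x [^] Suc j) [^] Suc k" using conj_pow[of "inv v" x "Suc k"] vc xc j by simp
    also have "\<dots> = x [^] (p * (l * Suc j))" unfolding l using xc by (simp only: nat_pow_pow ac_simps)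
    finally have "x = \<one>" using p_element_not_pth_power x(2) p by blast
    then show False using x(3) by simp
  qed
  show "odd p"
  proof
    assume "even p"
    then have "p = 2" using p prime_odd_nat prime_gt_1_nat by (metis le_neq_implies_less prime_ge_2_nat)
    then show False using pk pk' by simp
  qed
  have "p \<in> \<pi>" using prime_in_pi xP x by blast
  then show "pi_elements {p} \<subseteq> Z"
    using pi_elements_mono[of _ "{p}" \<pi>] pi_elements_mono[of _ "{p}" moved_primes] pi_elements_eq_P mp
    by (auto simp: Z_def)
qed

end

section \<open>The quotient by the largest normal \<open>\<pi>'\<close>-subgroup\<close>

context finite_group
begin

lemma set_mult_absorb:
  assumes A: "subgroup A G" and H: "H \<subseteq> A" "\<one> \<in> H"
  shows "A <#> H = A" "H <#> A = A"
proof -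
  have "a \<otimes> h \<in> A" "h \<otimes> a \<in> A" if "a \<in> A" "h \<in> H" for a h
    using that H subgroup.m_closed[OF A] by auto
  moreover have "a \<in> A <#> H" "a \<in> H <#> A" if "a \<in> A" for a
    using that H(2) subgroup.mem_carrier[OF A that]
    unfolding set_mult_def by (force intro: bexI[of _ \<one>])+
  ultimately show "A <#> H = A" "H <#> A = A" by (auto simp: set_mult_def)
qed

lemma sigma_permutable_normal:
  assumes "N \<lhd> G" "complete_hall_sigma_set \<sigma> G \<H>"
  shows "sigma_permutable \<sigma> G N"
  unfolding sigma_permutable_def
  using assms normal_imp_subgroup commut_normal[of _ N] by (auto simp: hall_pi_subgroup_def)

lemma sigma_soluble_normal_hall:
  assumes "sigma_soluble \<sigma> G" "partition_on {p. Factorial_Ring.prime p} \<sigma>" "\<pi> \<in> \<sigma>" "N \<lhd> G"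
  shows "\<exists>H. hall_pi_subgroup \<pi> (G\<lparr>carrier := N\<rparr>) H"
  using pi_separable_normal_hall[OF sigma_soluble_imp_pi_separable] assms by blast

lemma sigma_soluble_hall:
  assumes "sigma_soluble \<sigma> G" "partition_on {p. Factorial_Ring.prime p} \<sigma>" "\<pi> \<in> \<sigma>"
  shows "\<exists>H. hall_pi_subgroup \<pi> G H"
  using sigma_soluble_normal_hall[OF assms carrier_normal] by simp

end

text \<open>For a normal subgroup \<open>A\<close> these are the elements that induce power automorphisms on \<open>A\<close>.\<close>
definition (in group) power_normaliser :: "'a set \<Rightarrow> 'a set" where
  "power_normaliser A = {g \<in> carrier G. \<forall>x\<in>A. \<exists>k::nat. g \<otimes> x \<otimes> inv g = x [^] k}"

lemma (in finite_group) power_normaliser_normal: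
  assumes N: "N \<lhd> G"
  shows "power_normaliser N \<lhd> G"
proof -
  have Nc: "x \<in> carrier G" if "x \<in> N" for x
    using subgroup.mem_carrier[OF normal_imp_subgroup[OF N] that] .
  show ?thesis
  proof (rule normal_invI)
    show "subgroup (power_normaliser N) G"
    proof (rule subgroup_of_mult_closed)
      show "\<one> \<in> power_normaliser N"
        using Nc by (auto simp: power_normaliser_def intro!: exI[of _ "1::nat"])
      fix a b assume ab: "a \<in> power_normaliser N" "b \<in> power_normaliser N"
      then have c: "a \<in> carrier G" "b \<in> carrier G" by (auto simp: power_normaliser_def)
      have "\<exists>k::nat. (a \<otimes> b) \<otimes> x \<otimes> inv (a \<otimes> b) = x [^] k" if x: "x \<in> N" for x
      proof -
        obtain i j :: nat where "a \<otimes> x \<otimes> inv a = x [^] i" "b \<otimes> x \<otimes> inv b = x [^] j"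
          using ab x unfolding power_normaliser_def by blast
        then have "(a \<otimes> b) \<otimes> x \<otimes> inv (a \<otimes> b) = x [^] (i * j)"
          using conj_by_mult[OF c Nc[OF x]] conj_pow[OF c(1) Nc[OF x]] Nc[OF x] by (simp add: nat_pow_pow)
        then show ?thesis by blast
      qed
      then show "a \<otimes> b \<in> power_normaliser N" using c unfolding power_normaliser_def by blast
    qed (auto simp: power_normaliser_def)
  next
    fix a g assume a: "a \<in> carrier G" and g: "g \<in> power_normaliser N"
    have gc: "g \<in> carrier G" using g by (simp add: power_normaliser_def)
    have "\<exists>k::nat. (a \<otimes> g \<otimes> inv a) \<otimes> x \<otimes> inv (a \<otimes> g \<otimes> inv a) = x [^] k" if x: "x \<in> N" for x
    proof -
      note xc = Nc[OF x]
      define y where "y = inv a \<otimes> x \<otimes> a"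
      have y: "y \<in> N" unfolding y_def using normal.inv_op_closed1[OF N a x] .
      have xy: "a \<otimes> y \<otimes> inv a = x" unfolding y_def using conj_conj_inv(1)[OF a xc] .
      obtain k :: nat where k: "g \<otimes> y \<otimes> inv g = y [^] k" using g y unfolding power_normaliser_def by blast
      have "(a \<otimes> g \<otimes> inv a) \<otimes> x \<otimes> inv (a \<otimes> g \<otimes> inv a) = (a \<otimes> g) \<otimes> y \<otimes> inv (a \<otimes> g)"
        using conj_by_mult[of "a \<otimes> g" "inv a" x] a gc xc by (simp add: y_def)
      also have "\<dots> = a \<otimes> y [^] k \<otimes> inv a" using conj_by_mult[OF a gc Nc[OF y]] k by simp
      also have "\<dots> = x [^] k" unfolding conj_pow[OF a Nc[OF y]] xy ..
      finally show ?thesis by blast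
    qed
    then show "a \<otimes> g \<otimes> inv a \<in> power_normaliser N" using a gc unfolding power_normaliser_def by blast
  qed
qed

context surj_hom
begin

lemma pi_core_of_quotient:
  assumes "Ker = pi_core \<pi> G"
  shows "pi_core \<pi> H = {\<one>\<^bsub>H\<^esub>}"
proof -
  let ?N = "pi_core \<pi> H"
  have sN: "subgroup ?N H" using H.pi_core_normal by (rule normal_imp_subgroup)
  have "pi_number \<pi> (card (pre ?N))"
    using card_pre[OF sN] assms G.pi_core_card H.pi_core_card pi_number_mult by simp
  then have "pre ?N \<subseteq> Ker"
    unfolding assms using G.pi_core_greatest pre_normal[OF H.pi_core_normal] by blast
  then have "h ` pre ?N \<subseteq> {\<one>\<^bsub>H\<^esub>}" by (auto simp: kernel_def)
  then have "?N \<subseteq> {\<one>\<^bsub>H\<^esub>}" using image_pre subgroup.subset[OF sN] by simp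
  then show ?thesis using subgroup.one_closed[OF sN] by blast
qed

lemma pi_separable_image:
  assumes sep: "G.pi_separable \<pi>"
  shows "H.pi_separable \<pi>"
  unfolding H.pi_separable_def
proof (intro allI impI)
  fix Z C assume "Z \<lhd> H \<and> C \<lhd> H \<and> Z \<subset> C"
  then have ZC: "Z \<lhd> H" "C \<lhd> H" "Z \<subset> C" by auto
  have sZ: "subgroup Z H" and sC: "subgroup C H" using ZC normal_imp_subgroup by auto
  have iZ: "h ` pre Z = Z" and iC: "h ` pre C = C"
    using image_pre subgroup.subset[OF sZ] subgroup.subset[OF sC] by auto
  have "pre Z \<subseteq> pre C" using ZC(3) unfolding pre_def by blast
  moreover have "pre Z \<noteq> pre C"
  proof
    assume "pre Z = pre C"
    then have "h ` pre Z = h ` pre C" by (rule arg_cong)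
    then show False using ZC(3) unfolding iZ iC by blast
  qed
  ultimately have "pre Z \<subset> pre C" by (rule psubsetI)
  then obtain K where K: "K \<lhd> G" "pre Z \<subset> K" "K \<subseteq> pre C"
      "pi_number \<pi> (card K div card (pre Z)) \<or> pi_number (- \<pi>) (card K div card (pre Z))"
    using G.pi_separableD[OF sep pre_normal[OF ZC(1)] pre_normal[OF ZC(2)]] by metis
  have sK: "subgroup K G" using K(1) by (rule normal_imp_subgroup)
  have KK: "Ker \<subseteq> K" using Ker_subset_pre[OF sZ] K(2) by blast
  have "card (h ` K) * card Ker = card K" using card_image[OF sK] KK by (simp add: Int_absorb1)
  then have idx: "card K div card (pre Z) = card (h ` K) div card Z"
    using card_pre[OF sZ] G.card_subgroup_pos[OF subgroup_kernel] by (metis div_mult_mult2 less_not_refl)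
  have "h ` pre Z \<subseteq> h ` K" "h ` K \<subseteq> h ` pre C" using K(2,3) by blast+
  then have ZK: "Z \<subseteq> h ` K" "h ` K \<subseteq> C" unfolding iZ iC .
  have "h ` K \<noteq> Z"
  proof
    assume "h ` K = Z"
    then have "pre Z = K" using pre_image[OF sK KK] by simp
    then show False using K(2) by simp
  qed
  then have "Z \<subset> h ` K" using ZK(1) by blast
  then show "\<exists>K. K \<lhd> H \<and> Z \<subset> K \<and> K \<subseteq> C \<and>
      (pi_number \<pi> (card K div card Z) \<or> pi_number (- \<pi>) (card K div card Z))"
    using K(4) image_normal[OF K(1)] ZK(2) unfolding idx by (intro exI[of _ "h ` K"] conjI)
qed

lemma hall_image:
  assumes E: "hall_pi_subgroup \<pi> G E"
  shows "hall_pi_subgroup \<pi> H (h ` E)"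
proof -
  have sE: "subgroup E G" "pi_number \<pi> (card E)" "pi_number (- \<pi>) (order G div card E)"
    using E by (auto simp: G.hall_pi_subgroup_iff)
  have sI: "subgroup (E \<inter> Ker) G" using G.subgroups_Inter_pair[OF sE(1) subgroup_kernel] .
  have sh: "subgroup (h ` E) H" using image_subgroup[OF sE(1)] .
  have cE: "card (h ` E) * card (E \<inter> Ker) = card E" using card_image[OF sE(1)] .
  obtain i where i: "order H = card (h ` E) * i"
    using H.card_subgroup_dvd[OF sh H.subgroup_self subgroup.subset[OF sh]] by (auto simp: order_def)
  obtain j where j: "card Ker = card (E \<inter> Ker) * j"
    using G.card_subgroup_dvd[OF sI subgroup_kernel] by auto
  have "order G = card E * (i * j)" unfolding order_eq i j cE[symmetric] by (simp add: ac_simps)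
  then have "order G div card E = i * j" using G.card_subgroup_pos[OF sE(1)] by simp
  then have "pi_number (- \<pi>) i" using sE(3) pi_number_dvd by (metis dvd_triv_left)
  moreover have "order H div card (h ` E) = i" using i H.card_subgroup_pos[OF sh] by simp
  moreover have "pi_number \<pi> (card (h ` E))" using cE sE(2) pi_number_dvd by (metis dvd_triv_left)
  ultimately show ?thesis using sh by (simp add: H.hall_pi_subgroup_iff)
qed

lemma pi_residual_image: "H.pi_residual \<pi> = h ` G.pi_residual \<pi>"
proof
  show "H.pi_residual \<pi> \<subseteq> h ` G.pi_residual \<pi>"
    using H.pi_residual_least[OF image_normal[OF G.pi_residual_normal]]
      lift_pi_element[of _ "- \<pi>"] G.pi_elements_subset_residual by blast
  have "G.pi_elements (- \<pi>) \<subseteq> pre (H.pi_residual \<pi>)"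
    using hom_pi_elements[of _ "- \<pi>"] H.pi_elements_subset_residual[of \<pi>] G.pi_elements_carrier
    unfolding pre_def by blast
  then have "G.pi_residual \<pi> \<subseteq> pre (H.pi_residual \<pi>)"
    using G.pi_residual_least[OF pre_normal[OF H.pi_residual_normal]] by blast
  then show "h ` G.pi_residual \<pi> \<subseteq> H.pi_residual \<pi>" by (auto simp: pre_def)
qed

end

locale soluble_psigmat = finite_group +
  fixes \<sigma> :: "nat set set"
  assumes part: "partition_on {p. Factorial_Ring.prime p} \<sigma>"
    and soluble: "sigma_soluble \<sigma> G"
    and transitive: "PsigmaT_group \<sigma> G"
begin

text \<open>This is where the transitivity hypothesis is used: \<open>A\<close> is \<open>\<sigma>\<close>-permutable in \<open>N\<close>, and \<open>N\<close>, being
normal, is \<open>\<sigma>\<close>-permutable in \<open>G\<close>.\<close>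
lemma subnormal_permutes:
  assumes N: "N \<lhd> G" and A: "subgroup A G" "A \<subseteq> N"
    and hallN: "\<And>\<pi> H. \<pi> \<in> \<sigma> \<Longrightarrow> hall_pi_subgroup \<pi> (G\<lparr>carrier := N\<rparr>) H \<Longrightarrow> A <#> H = H <#> A"
    and E: "\<rho> \<in> \<sigma>" "hall_pi_subgroup \<rho> G E"
  shows "A <#> E = E <#> A"
proof -
  have sN: "subgroup N G" using N by (rule normal_imp_subgroup)
  interpret N: finite_group "G\<lparr>carrier := N\<rparr>" using subgroup_finite_group[OF sN] .
  obtain \<H> where "complete_hall_sigma_set \<sigma> G \<H>"
    using complete_hall_sigma_set_exists[OF part] sigma_soluble_hall[OF soluble part] by blast
  then have 1: "sigma_permutable \<sigma> G N" using sigma_permutable_normal N by blast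
  have "\<exists>\<H>. complete_hall_sigma_set \<sigma> (G\<lparr>carrier := N\<rparr>) \<H>"
    using N.complete_hall_sigma_set_exists[OF part] sigma_soluble_normal_hall[OF soluble part _ N] by blast
  then have 2: "sigma_permutable \<sigma> (G\<lparr>carrier := N\<rparr>) A"
    unfolding sigma_permutable_def using subgroup_incl[OF A(1) sN A(2)] hallN by simp
  have "sigma_permutable \<sigma> G A" using transitive 1 2 unfolding PsigmaT_group_def by blast
  then show ?thesis using E unfolding sigma_permutable_def by blast
qed

text \<open>Let \<open>Q = O\<^bsub>\<pi>'\<^esub>(G)\<close>, let \<open>P1/Q\<close> be the largest normal \<open>\<pi>\<close>-subgroup of \<open>G/Q\<close>, and let
\<open>Q \<subseteq> A \<subseteq> P1\<close>. In \<open>P1\<close>, Hall subgroups for \<open>\<rho> \<noteq> \<pi>\<close> lie in \<open>Q\<close> and Hall \<open>\<pi>\<close>-subgroups supplement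
\<open>Q\<close>, so \<open>A\<close> permutes with all of them and hence with every Hall subgroup \<open>E\<close> of \<open>G\<close>. If \<open>E\<close> belongs to
\<open>\<rho> \<noteq> \<pi>\<close>, then \<open>A E \<inter> P1 = A (E \<inter> P1) = A\<close>, so \<open>E\<close> normalises \<open>A\<close>. The elements that
normalise all such \<open>A\<close> form a normal subgroup containing these \<open>E\<close>; its index is a
\<open>\<pi>\<close>-number, so it contains \<open>O\<^sup>\<pi>(G)\<close>.\<close>
lemma reduced_quotient:
  assumes \<pi>: "\<pi> \<in> \<sigma>"
  shows "reduced_power_group (G Mod pi_core (- \<pi>) G) \<pi>"
proof -
  let ?Q = "pi_core (- \<pi>) G"
  let ?L = "G Mod ?Q"
  interpret L: surj_hom G ?L "\<lambda>x. ?Q #> x" using quotient_surj_hom pi_core_normal by blast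
  have Ker: "L.Ker = ?Q" using quotient_surj_hom pi_core_normal by blast
  let ?h = "\<lambda>x. ?Q #> x"
  have sQ: "subgroup ?Q G" using pi_core_normal normal_imp_subgroup by blast
  note posQ = card_subgroup_pos[OF sQ]
  let ?P = "pi_core \<pi> ?L"
  have nP: "?P \<lhd> ?L" by (rule L.H.pi_core_normal)
  have sP: "subgroup ?P ?L" using nP by (rule normal_imp_subgroup)
  have P\<pi>: "?P \<subseteq> L.H.pi_elements \<pi>" using L.H.subgroup_pi_elements[OF sP L.H.pi_core_card] .
  define P1 where "P1 = L.pre ?P"
  have nP1: "P1 \<lhd> G" unfolding P1_def using L.pre_normal[OF nP] .
  then have sP1: "subgroup P1 G" by (rule normal_imp_subgroup)
  have QP1: "?Q \<subseteq> P1" unfolding P1_def using L.Ker_subset_pre[OF sP] Ker by simp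
  have P1Q: "x \<in> L.Ker" if "x \<in> P1" "x \<in> pi_elements \<rho>" "\<rho> \<in> \<sigma>" "\<rho> \<noteq> \<pi>" for x \<rho>
  proof -
    have "?h x \<in> L.H.pi_elements \<pi>" "?h x \<in> L.H.pi_elements \<rho>"
      using that P\<pi> L.hom_pi_elements by (auto simp: P1_def L.pre_def)
    moreover have "\<pi> \<inter> \<rho> = {}" using partition_on_compl[OF part \<pi> that(3)] that(4) by blast
    ultimately have "?h x = \<one>\<^bsub>?L\<^esub>" by (rule L.H.pi_elements_disjoint)
    then show ?thesis using that(2) pi_elements_carrier by (auto simp: kernel_def)
  qed
  have permutes: "A <#> E = E <#> A"
    if A: "subgroup A G" "?Q \<subseteq> A" "A \<subseteq> P1" and E: "\<rho> \<in> \<sigma>" "hall_pi_subgroup \<rho> G E" for A E \<rho>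
  proof (rule subnormal_permutes[OF nP1 A(1,3) _ E])
    fix \<tau> H assume \<tau>: "\<tau> \<in> \<sigma>" and H: "hall_pi_subgroup \<tau> (G\<lparr>carrier := P1\<rparr>) H"
    interpret P1: finite_group "G\<lparr>carrier := P1\<rparr>" using subgroup_finite_group[OF sP1] .
    have H': "subgroup H (G\<lparr>carrier := P1\<rparr>)" "pi_number \<tau> (card H)" "pi_number (- \<tau>) (card P1 div card H)"
      using H by (auto simp: P1.hall_pi_subgroup_iff order_def)
    have sH: "subgroup H G" "H \<subseteq> P1" using incl_subgroup[OF sP1 H'(1)] subgroup.subset[OF H'(1)] by auto
    show "A <#> H = H <#> A"
    proof (cases "\<tau> = \<pi>")
      case False
      have "H \<subseteq> A" using P1Q[OF _ _ \<tau> False] subgroup_pi_elements[OF sH(1) H'(2)] sH(2) A(2) Ker by blast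
      then show ?thesis using set_mult_absorb[OF A(1)] subgroup.one_closed[OF sH(1)] by simp
    next
      case True
      note QH = set_mult_normal_subgroup[OF pi_core_normal[of "- \<pi>"] sH(1)]
      have QHP: "?Q <#> H \<subseteq> P1"
        using QP1 sH(2) subgroup.m_closed[OF sP1] by (auto simp: set_mult_def)
      have "card P1 div card ?Q = card ?P" unfolding P1_def using L.card_pre[OF sP] Ker posQ by simp
      then have "pi_number \<pi> (card P1 div card ?Q)" using L.H.pi_core_card by simp
      then have "pi_number \<pi> (card P1 div card (?Q <#> H))"
        using index_mult[OF sQ QH(1) sP1 QH(2) QHP] pi_number_dvd by (metis dvd_triv_right)
      moreover have "pi_number (- \<pi>) (card P1 div card (?Q <#> H))"
        using index_mult[OF sH(1) QH(1) sP1 QH(3) QHP] pi_number_dvd H'(3) True by (metis dvd_triv_right)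
      ultimately have "card P1 div card (?Q <#> H) = 1" using pi_number_both[of \<pi> _ "- \<pi>"] by blast
      then have "card (?Q <#> H) = card P1" using card_eq_index_mult[OF QH(1) sP1 QHP] by simp
      then have eq: "?Q <#> H = P1" using QHP subgroup_finite[OF sP1] by (simp add: card_subset_eq)
      have eq2: "H <#> ?Q = P1" using commut_normal[OF sH(1) pi_core_normal] eq by simp
      have "P1 \<subseteq> A <#> H" unfolding eq[symmetric] using mono_set_mult[OF A(2)] by blast
      moreover have "P1 \<subseteq> H <#> A" unfolding eq2[symmetric] using mono_set_mult[OF _ A(2)] by blast
      moreover have "A <#> H \<subseteq> P1" "H <#> A \<subseteq> P1"
        using A(3) sH(2) subgroup.m_closed[OF sP1] by (auto simp: set_mult_def)
      ultimately show ?thesis by blast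
    qed
  qed
  define T1 where "T1 = L.pre (L.H.power_normaliser ?P)"
  have nT1: "T1 \<lhd> G" unfolding T1_def using L.pre_normal[OF L.H.power_normaliser_normal[OF nP]] .
  then have sT1: "subgroup T1 G" by (rule normal_imp_subgroup)
  have Pc: "x \<in> carrier ?L" if "x \<in> ?P" for x using subgroup.mem_carrier[OF sP that] .
  have ET1: "E \<subseteq> T1" if \<rho>: "\<rho> \<in> \<sigma>" "\<rho> \<noteq> \<pi>" and E: "hall_pi_subgroup \<rho> G E" for E \<rho>
  proof
    fix e assume e: "e \<in> E"
    have sE: "subgroup E G" "pi_number \<rho> (card E)" using E by (auto simp: hall_pi_subgroup_iff)
    have ec: "e \<in> carrier G" using subgroup.mem_carrier[OF sE(1) e] .
    have "\<exists>k::nat. ?h e \<otimes>\<^bsub>?L\<^esub> x \<otimes>\<^bsub>?L\<^esub> inv\<^bsub>?L\<^esub> ?h e = x [^]\<^bsub>?L\<^esub> k" if x: "x \<in> ?P" for x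
    proof -
      let ?X = "{x [^]\<^bsub>?L\<^esub> (k::nat) | k. True}"
      have sX: "subgroup ?X ?L" using L.H.powers_subgroup Pc[OF x] .
      define A where "A = L.pre ?X"
      have sA: "subgroup A G" unfolding A_def using L.pre_subgroup[OF sX] .
      have QA: "?Q \<subseteq> A" unfolding A_def using L.Ker_subset_pre[OF sX] Ker by simp
      have "?X \<subseteq> ?P" using L.H.subgroup_pow_closed[OF sP x] by blast
      then have AP: "A \<subseteq> P1" unfolding A_def P1_def L.pre_def by blast
      have "x \<in> ?h ` carrier G" using Pc[OF x] unfolding L.surj .
      then obtain a where a: "a \<in> carrier G" "?h a = x" by blast
      have "x \<in> ?X" using L.H.nat_pow_eone[OF Pc[OF x]] by (intro CollectI exI[of _ "1::nat"]) simp
      then have aA: "a \<in> A" using a by (simp add: A_def L.pre_def)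
      have "e \<otimes> a \<in> E <#> A" using set_mult_mem e aA by blast
      then have "e \<otimes> a \<in> A <#> E" using permutes[OF sA QA AP \<rho>(1) E] by simp
      then obtain a' e' where ae: "a' \<in> A" "e' \<in> E" "e \<otimes> a = a' \<otimes> e'" by (rule set_mult_obtain)
      have c': "a' \<in> carrier G" "e' \<in> carrier G" using subgroup.mem_carrier[OF sA ae(1)] subgroup.mem_carrier[OF sE(1) ae(2)] by auto
      let ?d = "e' \<otimes> inv e"
      have eq: "e \<otimes> a \<otimes> inv e = a' \<otimes> ?d" unfolding ae(3) using c' ec by (simp add: m_assoc)
      then have "?d = inv a' \<otimes> (e \<otimes> a \<otimes> inv e)" using c' ec by (simp add: cancel_inv)
      moreover have "e \<otimes> a \<otimes> inv e \<in> P1" using normal_invE(2)[OF nP1 ec] aA AP by blast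
      moreover have "inv a' \<in> P1" using subgroup.m_inv_closed[OF sP1] ae(1) AP by blast
      ultimately have "?d \<in> P1" using subgroup.m_closed[OF sP1] by simp
      moreover have "?d \<in> E" using subgroup.m_closed[OF sE(1) ae(2) subgroup.m_inv_closed[OF sE(1) e]] .
      ultimately have "?d \<in> L.Ker" using P1Q subgroup_pi_elements[OF sE] \<rho> by blast
      then have hd: "?h ?d = \<one>\<^bsub>?L\<^esub>" by (simp add: kernel_def)
      have "?h (a' \<otimes> ?d) = ?h a' \<otimes>\<^bsub>?L\<^esub> ?h ?d" using c' ec by (intro L.hom_mult) auto
      also have "\<dots> = ?h a'" unfolding hd by (rule L.H.r_one[OF L.hom_closed[OF c'(1)]])
      finally have "?h (e \<otimes> a \<otimes> inv e) = ?h a'" unfolding eq .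
      moreover have "?h (e \<otimes> a \<otimes> inv e) = ?h e \<otimes>\<^bsub>?L\<^esub> x \<otimes>\<^bsub>?L\<^esub> inv\<^bsub>?L\<^esub> ?h e"
        using L.hom_mult[of "e \<otimes> a" "inv e"] L.hom_mult[OF ec a(1)] L.hom_inv[OF ec] a ec by simp
      moreover have "?h a' \<in> ?X" using ae(1) by (simp add: A_def L.pre_def)
      ultimately show ?thesis by auto
    qed
    then show "e \<in> T1" using ec L.hom_closed[OF ec] unfolding T1_def L.pre_def L.H.power_normaliser_def by blast
  qed
  have "pi_number \<pi> (order G div card T1)"
  proof (rule pi_numberI)
    show "0 < order G div card T1"
      using card_div_subgroup_pos[OF sT1 subgroup_self subgroup.subset[OF sT1]] by (simp add: order_def)
    fix p assume p: "Factorial_Ring.prime p" "p dvd order G div card T1"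
    obtain \<rho> where \<rho>: "\<rho> \<in> \<sigma>" "p \<in> \<rho>" using partition_on_class[OF part] p(1) by blast
    show "p \<in> \<pi>"
    proof (rule ccontr)
      assume "p \<notin> \<pi>"
      then have "\<rho> \<noteq> \<pi>" using \<rho>(2) by blast
      obtain E where E: "hall_pi_subgroup \<rho> G E" using sigma_soluble_hall[OF soluble part \<rho>(1)] by blast
      then have sE: "subgroup E G" and cE: "pi_number (- \<rho>) (order G div card E)" by (auto simp: hall_pi_subgroup_iff)
      have "order G div card E = (card T1 div card E) * (order G div card T1)"
        unfolding order_def using index_mult[OF sE sT1 subgroup_self ET1[OF \<rho>(1) \<open>\<rho> \<noteq> \<pi>\<close> E] subgroup.subset[OF sT1]] .
      then have "p dvd order G div card E" using p(2) by simp
      then show False using cE p(1) \<rho>(2) pi_number_primeD by blast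
    qed
  qed
  then have RT1: "pi_residual \<pi> \<subseteq> T1" using pi_residual_least_index[OF nT1] by blast
  show ?thesis
  proof (intro reduced_power_group.intro reduced_power_group_axioms.intro L.H.finite_group_axioms)
    show "pi_core (- \<pi>) ?L = {\<one>\<^bsub>?L\<^esub>}" using L.pi_core_of_quotient Ker by blast
    show "L.H.pi_separable \<pi>"
      using L.pi_separable_image[OF sigma_soluble_imp_pi_separable[OF soluble part \<pi>]] .
    show "\<exists>E. hall_pi_subgroup \<pi> ?L E" using sigma_soluble_hall[OF soluble part \<pi>] L.hall_image by blast
    fix t x assume t: "t \<in> L.H.pi_residual \<pi>" and x: "x \<in> ?P"
    have "t \<in> ?h ` T1" using t RT1 unfolding L.pi_residual_image by blast
    then have "t \<in> L.H.power_normaliser ?P" unfolding T1_def L.pre_def by auto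
    then obtain k :: nat where k: "t \<otimes>\<^bsub>?L\<^esub> x \<otimes>\<^bsub>?L\<^esub> inv\<^bsub>?L\<^esub> t = x [^]\<^bsub>?L\<^esub> k"
      using x unfolding L.H.power_normaliser_def by blast
    \<comment> \<open>Adding the group order makes the exponent a successor.\<close>
    have "x [^]\<^bsub>?L\<^esub> Suc (k + (order ?L - 1)) = x [^]\<^bsub>?L\<^esub> (k + order ?L)" using L.H.order_pos by simp
    also have "\<dots> = x [^]\<^bsub>?L\<^esub> k \<otimes>\<^bsub>?L\<^esub> x [^]\<^bsub>?L\<^esub> order ?L"
      using L.H.nat_pow_mult[OF Pc[OF x]] by simp
    also have "\<dots> = x [^]\<^bsub>?L\<^esub> k"
      unfolding L.H.pow_order_eq_1[OF Pc[OF x]] by (rule L.H.r_one[OF L.H.nat_pow_closed[OF Pc[OF x]]])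
    finally show "\<exists>k. t \<otimes>\<^bsub>?L\<^esub> x \<otimes>\<^bsub>?L\<^esub> inv\<^bsub>?L\<^esub> t = x [^]\<^bsub>?L\<^esub> Suc k" using k by metis
  qed
qed

end

section \<open>The residual of a \<open>\<sigma>\<close>-soluble group with transitive \<open>\<sigma>\<close>-permutability\<close>

context soluble_psigmat
begin

text \<open>The structure of \<open>G/O\<^bsub>\<pi>'\<^esub>(G)\<close>, pulled back to \<open>G\<close>: \<open>Q\<close> is \<open>O\<^bsub>\<pi>'\<^esub>(G)\<close>, and \<open>A\<close> and \<open>C\<close> are the preimages
of the two factors \<open>Z\<close> and \<open>C\<close> of the \<open>\<pi>\<close>-radical. The residual lies in \<open>A\<close> because
\<open>G\<close> is abelian modulo the preimage of \<open>P\<close> and \<open>T \<inter> P = Z\<close>.\<close>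
lemma class_structure:
  assumes \<pi>: "\<pi> \<in> \<sigma>"
  obtains Q A C where "Q \<lhd> G" "A \<lhd> G" "C \<lhd> G" "Q \<inter> pi_elements \<pi> = {\<one>}" "A \<inter> C \<subseteq> Q"
    and "A \<subseteq> pi_residual \<pi>" "sigma_residual \<sigma> \<subseteq> A"
    and "\<And>a b. a \<in> A \<Longrightarrow> b \<in> A \<Longrightarrow> (a \<otimes> b) \<otimes> inv (b \<otimes> a) \<in> Q"
    and "\<And>p x. Factorial_Ring.prime p \<Longrightarrow> x \<in> A \<Longrightarrow> x \<in> pi_elements {p} \<Longrightarrow> x \<notin> Q
           \<Longrightarrow> odd p \<and> pi_elements {p} \<subseteq> A"
    and "\<And>x g. x \<in> A \<Longrightarrow> g \<in> carrier G \<Longrightarrow> \<exists>k::nat. (g \<otimes> x \<otimes> inv g) \<otimes> inv (x [^] k) \<in> Q"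
    and "\<And>e. e \<in> pi_elements \<pi> \<Longrightarrow> \<exists>m::nat. e [^] m \<in> A \<and> e \<otimes> inv (e [^] m) \<in> C"
proof -
  let ?Q = "pi_core (- \<pi>) G"
  let ?L = "G Mod ?Q"
  let ?h = "\<lambda>x. ?Q #> x"
  interpret L: surj_hom G ?L ?h using quotient_surj_hom pi_core_normal by blast
  have Ker: "L.Ker = ?Q" using quotient_surj_hom pi_core_normal by blast
  interpret R: reduced_power_group ?L \<pi> "pi_core \<pi> ?L" "L.H.pi_residual \<pi>" "L.H.pi_elements (- \<pi>)"
    using reduced_quotient[OF \<pi>] by simp_all
  note res = L.pi_residual_image[of \<pi>]
  have sQ: "subgroup ?Q G" using pi_core_normal normal_imp_subgroup by blast
  have Q\<pi>: "?Q \<subseteq> pi_elements (- \<pi>)" using subgroup_pi_elements[OF sQ pi_core_card] .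
  have sRes: "subgroup (pi_residual \<pi>) G" using pi_residual_normal normal_imp_subgroup by blast
  have QT: "L.Ker \<subseteq> pi_residual \<pi>" unfolding Ker using Q\<pi> pi_elements_subset_residual by blast
  have preT: "L.pre (L.H.pi_residual \<pi>) = pi_residual \<pi>" unfolding res using L.pre_image[OF sRes QT] .
  define A where "A = L.pre R.Z"
  define C where "C = L.pre R.C"
  have memA: "x \<in> A \<longleftrightarrow> x \<in> carrier G \<and> ?h x \<in> R.Z" for x by (simp add: A_def L.pre_def)
  have memC: "x \<in> C \<longleftrightarrow> x \<in> carrier G \<and> ?h x \<in> R.C" for x by (simp add: C_def L.pre_def)
  have memQ: "x \<in> ?Q" if "x \<in> carrier G" "?h x = \<one>\<^bsub>?L\<^esub>" for x
  proof -
    have "x \<in> L.Ker" using that by (simp add: kernel_def)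
    then show ?thesis unfolding Ker .
  qed
  have nA: "A \<lhd> G" unfolding A_def using L.pre_normal[OF R.Z_normal] .
  have nC: "C \<lhd> G" unfolding C_def using L.pre_normal[OF R.C_normal] .
  show thesis
  proof (rule that[of ?Q A C])
    show "?Q \<lhd> G" by (rule pi_core_normal)
    show "A \<lhd> G" "C \<lhd> G" by fact+
    show "?Q \<inter> pi_elements \<pi> = {\<one>}"
    proof -
      have "x = \<one>" if "x \<in> ?Q" "x \<in> pi_elements \<pi>" for x
        using that Q\<pi> pi_elements_disjoint[of x \<pi> "- \<pi>"] by blast
      then show ?thesis using subgroup.one_closed[OF sQ] one_pi_element by blast
    qed
    show "A \<inter> C \<subseteq> ?Q"
    proof
      fix x assume "x \<in> A \<inter> C"
      then have "x \<in> carrier G" "?h x \<in> R.Z \<inter> R.C" using memA memC by blast+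
      then have "x \<in> carrier G" "?h x = \<one>\<^bsub>?L\<^esub>" unfolding R.Z_Int_C by simp_all
      then show "x \<in> ?Q" by (rule memQ)
    qed
    have "A \<subseteq> L.pre (L.H.pi_residual \<pi>)" using memA R.Z_subset_T L.pre_mem by blast
    then show "A \<subseteq> pi_residual \<pi>" unfolding preT .
    show "sigma_residual \<sigma> \<subseteq> A"
    proof
      fix x assume x: "x \<in> sigma_residual \<sigma>"
      then have xT: "x \<in> L.pre (L.H.pi_residual \<pi>)" unfolding preT using \<pi> by (auto simp: sigma_residual_def)
      have "sigma_residual \<sigma> \<subseteq> L.pre (pi_core \<pi> ?L)"
      proof (rule sigma_residual_subset_of_commutative[OF part L.pre_normal[OF R.P_normal]])
        fix a b assume ab: "a \<in> carrier G" "b \<in> carrier G"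
        have "?h (a \<otimes> b \<otimes> inv a \<otimes> inv b) = ?h a \<otimes>\<^bsub>?L\<^esub> ?h b \<otimes>\<^bsub>?L\<^esub> inv\<^bsub>?L\<^esub> ?h a \<otimes>\<^bsub>?L\<^esub> inv\<^bsub>?L\<^esub> ?h b"
          using L.hom_mult[of "a \<otimes> b \<otimes> inv a" "inv b"] L.hom_mult[of "a \<otimes> b" "inv a"] L.hom_mult[OF ab]
            L.hom_inv[OF ab(1)] L.hom_inv[OF ab(2)] ab by simp
        then show "a \<otimes> b \<otimes> inv a \<otimes> inv b \<in> L.pre (pi_core \<pi> ?L)"
          using R.commutator_in_P[OF L.hom_closed[OF ab(1)] L.hom_closed[OF ab(2)]] ab by (simp add: L.pre_def)
      qed
      then have "?h x \<in> pi_core \<pi> ?L" using x L.pre_mem by blast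
      then show "x \<in> A" using R.T_Int_P xT memA L.pre_mem by blast
    qed
  next
    fix a b assume ab: "a \<in> A" "b \<in> A"
    then have c: "a \<in> carrier G" "b \<in> carrier G" and z: "?h a \<in> R.Z" "?h b \<in> R.Z" using memA by blast+
    have "?h (a \<otimes> b) = ?h (b \<otimes> a)"
      unfolding L.hom_mult[OF c] L.hom_mult[OF c(2,1)] using R.Z_central[OF z(1) R.Z_P[OF z(2)]] .
    then show "(a \<otimes> b) \<otimes> inv (b \<otimes> a) \<in> ?Q" using L.h_eq_iff[of "a \<otimes> b" "b \<otimes> a"] c unfolding Ker by simp
  next
    fix p x assume p: "Factorial_Ring.prime p" and x: "x \<in> A" "x \<in> pi_elements {p}" "x \<notin> ?Q"
    have z: "?h x \<in> R.Z" "?h x \<in> L.H.pi_elements {p}" "?h x \<noteq> \<one>\<^bsub>?L\<^esub>"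
      using x memA L.hom_pi_elements memQ by blast+
    note zp = R.Z_prime[OF z p]
    have "pi_elements {p} \<subseteq> A" using zp(2) L.hom_pi_elements[of _ "{p}"] memA pi_elements_carrier by blast
    then show "odd p \<and> pi_elements {p} \<subseteq> A" using zp(1) by blast
  next
    fix x g assume x: "x \<in> A" and g: "g \<in> carrier G"
    have xc: "x \<in> carrier G" and z: "?h x \<in> R.Z" using x memA by blast+
    obtain k :: nat where k: "?h g \<otimes>\<^bsub>?L\<^esub> ?h x \<otimes>\<^bsub>?L\<^esub> inv\<^bsub>?L\<^esub> ?h g = ?h x [^]\<^bsub>?L\<^esub> k"
      using R.Z_power[OF z L.hom_closed[OF g]] by blast
    have "?h (g \<otimes> x \<otimes> inv g) = ?h (x [^] k)"
      using k L.hom_mult[of "g \<otimes> x" "inv g"] L.hom_mult[OF g xc] L.hom_inv[OF g] L.hom_nat_pow[OF xc] g xc by simp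
    then have "(g \<otimes> x \<otimes> inv g) \<otimes> inv (x [^] k) \<in> ?Q"
      using L.h_eq_iff[of "g \<otimes> x \<otimes> inv g" "x [^] k"] g xc unfolding Ker by simp
    then show "\<exists>k::nat. (g \<otimes> x \<otimes> inv g) \<otimes> inv (x [^] k) \<in> ?Q" by blast
  next
    fix e assume e: "e \<in> pi_elements \<pi>"
    have ec: "e \<in> carrier G" using e pi_elements_carrier by blast
    have "?h e \<in> pi_core \<pi> ?L" using L.hom_pi_elements[OF e] R.pi_elements_eq_P by blast
    then obtain m :: nat where m: "?h e [^]\<^bsub>?L\<^esub> m \<in> R.Z" "?h e \<otimes>\<^bsub>?L\<^esub> inv\<^bsub>?L\<^esub> (?h e [^]\<^bsub>?L\<^esub> m) \<in> R.C"
      using R.P_decomposition by blast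
    have "?h (e [^] m) = ?h e [^]\<^bsub>?L\<^esub> m" using L.hom_nat_pow[OF ec] .
    moreover have "?h (e \<otimes> inv (e [^] m)) = ?h e \<otimes>\<^bsub>?L\<^esub> inv\<^bsub>?L\<^esub> ?h (e [^] m)"
      using L.hom_mult[OF ec, of "inv (e [^] m)"] L.hom_inv[of "e [^] m"] ec by simp
    ultimately have "e [^] m \<in> A \<and> e \<otimes> inv (e [^] m) \<in> C" using m ec memA memC by simp
    then show "\<exists>m::nat. e [^] m \<in> A \<and> e \<otimes> inv (e [^] m) \<in> C" by blast
  qed
qed

lemma residual_normal: "sigma_residual \<sigma> \<lhd> G"
  using sigma_residual_normal[OF part] .

lemma residual_subgroup: "subgroup (sigma_residual \<sigma>) G"
  using residual_normal by (rule normal_imp_subgroup)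

text \<open>Commutators of elements of \<open>D\<close> lie in \<open>O\<^bsub>\<pi>'\<^esub>(G)\<close> for every class \<open>\<pi>\<close>, and these subgroups intersect
trivially.\<close>
lemma residual_abelian:
  assumes "a \<in> sigma_residual \<sigma>" "b \<in> sigma_residual \<sigma>"
  shows "a \<otimes> b = b \<otimes> a"
proof -
  have c: "a \<in> carrier G" "b \<in> carrier G" using assms subgroup.mem_carrier[OF residual_subgroup] by auto
  let ?c = "(a \<otimes> b) \<otimes> inv (b \<otimes> a)"
  have "?c \<in> {\<one>}"
  proof (rule mem_by_prime_parts[OF _ triv_subgroup])
    fix p m assume p: "Factorial_Ring.prime p" "?c [^] (m::nat) \<in> pi_elements {p}"
    obtain \<pi> where \<pi>: "\<pi> \<in> \<sigma>" "p \<in> \<pi>" using partition_on_class[OF part] p(1) by blast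
    obtain Q A C where Q: "Q \<lhd> G" "A \<lhd> G" "C \<lhd> G" "Q \<inter> pi_elements \<pi> = {\<one>}" "A \<inter> C \<subseteq> Q"
      "A \<subseteq> pi_residual \<pi>" "sigma_residual \<sigma> \<subseteq> A"
      "\<And>a b. a \<in> A \<Longrightarrow> b \<in> A \<Longrightarrow> (a \<otimes> b) \<otimes> inv (b \<otimes> a) \<in> Q"
      using class_structure[OF \<pi>(1)] by metis
    have "?c \<in> Q" using Q(7,8) assms by blast
    then have "?c [^] m \<in> Q" using subgroup_pow_closed Q(1) normal_imp_subgroup by blast
    moreover have "?c [^] m \<in> pi_elements \<pi>" using p(2) pi_elements_mono \<pi>(2) by blast
    ultimately show "?c [^] m \<in> {\<one>}" using Q(4) by blast
  qed (use c in simp)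
  then show ?thesis using c inv_solve_right[of "\<one>" "a \<otimes> b" "b \<otimes> a"] by simp
qed

lemma residual_prime:
  assumes p: "Factorial_Ring.prime p" and x: "x \<in> sigma_residual \<sigma>" "x \<in> pi_elements {p}" "x \<noteq> \<one>"
  shows "odd p" "pi_elements {p} \<subseteq> sigma_residual \<sigma>"
proof -
  obtain \<pi> where \<pi>: "\<pi> \<in> \<sigma>" "p \<in> \<pi>" using partition_on_class[OF part] p(1) by blast
  obtain Q A C where Q: "Q \<inter> pi_elements \<pi> = {\<one>}" "A \<subseteq> pi_residual \<pi>" "sigma_residual \<sigma> \<subseteq> A"
    and A: "\<And>p x. Factorial_Ring.prime p \<Longrightarrow> x \<in> A \<Longrightarrow> x \<in> pi_elements {p} \<Longrightarrow> x \<notin> Q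
           \<Longrightarrow> odd p \<and> pi_elements {p} \<subseteq> A"
    by (rule class_structure[OF \<pi>(1)]) blast
  have mono: "y \<in> pi_elements \<pi>" if "y \<in> pi_elements {p}" for y using that pi_elements_mono \<pi>(2) by blast
  have "x \<notin> Q" using Q(1) mono x by blast
  then have "odd p" "pi_elements {p} \<subseteq> A" using A[OF p _ x(2)] Q(3) x(1) by blast+
  then show "odd p" "pi_elements {p} \<subseteq> sigma_residual \<sigma>"
    using pi_element_in_sigma_residual[OF part \<pi>(1)] mono Q(2) by blast+
qed

text \<open>For a \<open>\<pi>\<close>-element \<open>y\<close> of \<open>D\<close>, the conjugate by \<open>g\<close> is a power of \<open>y\<close> up to a factor in \<open>O\<^bsub>\<pi>'\<^esub>(G)\<close>.
This factor is a \<open>\<pi>\<close>-element of the abelian group \<open>D\<close>, hence trivial.\<close>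
lemma residual_subgroups_normal:
  assumes K: "subgroup K G" "K \<subseteq> sigma_residual \<sigma>"
  shows "K \<lhd> G"
proof (rule normal_invI[OF K(1)])
  fix g a assume g: "g \<in> carrier G" and a: "a \<in> K"
  have cK: "x \<in> carrier G" if "x \<in> K" for x using subgroup.mem_carrier[OF K(1) that] .
  define H where "H = {x \<in> K. g \<otimes> x \<otimes> inv g \<in> K}"
  have "subgroup H G"
  proof (rule subgroup_of_mult_closed)
    show "H \<subseteq> carrier G" using cK by (auto simp: H_def)
    show "\<one> \<in> H" using subgroup.one_closed[OF K(1)] g by (simp add: H_def)
    fix x y assume "x \<in> H" "y \<in> H"
    then show "x \<otimes> y \<in> H" using conj_mult[OF g cK cK] subgroup.m_closed[OF K(1)] by (simp add: H_def)
  qed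
  have "a \<in> H"
  proof (rule mem_by_prime_parts[OF cK[OF a] \<open>subgroup H G\<close>])
    fix p m assume p: "Factorial_Ring.prime p" "a [^] (m::nat) \<in> pi_elements {p}"
    let ?y = "a [^] m"
    have y: "?y \<in> K" using subgroup_pow_closed[OF K(1) a] .
    note yc = cK[OF y]
    obtain \<pi> where \<pi>: "\<pi> \<in> \<sigma>" "p \<in> \<pi>" using partition_on_class[OF part] p(1) by blast
    obtain Q A C where Q: "Q \<inter> pi_elements \<pi> = {\<one>}" "sigma_residual \<sigma> \<subseteq> A"
      and A: "\<And>x g. x \<in> A \<Longrightarrow> g \<in> carrier G \<Longrightarrow> \<exists>k::nat. (g \<otimes> x \<otimes> inv g) \<otimes> inv (x [^] k) \<in> Q"
      by (rule class_structure[OF \<pi>(1)]) blast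
    obtain k :: nat where k: "(g \<otimes> ?y \<otimes> inv g) \<otimes> inv (?y [^] k) \<in> Q" using A[OF _ g, of ?y] Q(2) y K(2) by blast
    have y\<pi>: "?y \<in> pi_elements \<pi>" using p(2) pi_elements_mono \<pi>(2) by blast
    have d1: "g \<otimes> ?y \<otimes> inv g \<in> sigma_residual \<sigma>" using normal_invE(2)[OF residual_normal g] y K(2) by blast
    have yk: "?y [^] k \<in> K" using subgroup_pow_closed[OF K(1) y] .
    have d2: "inv (?y [^] k) \<in> K" using subgroup.m_inv_closed[OF K(1) yk] .
    have "inv (?y [^] k) \<in> sigma_residual \<sigma>" using d2 K(2) by blast
    then have "(g \<otimes> ?y \<otimes> inv g) \<otimes> inv (?y [^] k) \<in> pi_elements \<pi>"
      by (rule pi_elements_commuting_mult[OF pi_elements_conj[OF g y\<pi>] pi_elements_inv[OF pi_elements_pow[OF y\<pi>]]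
          residual_abelian[OF d1]])
    then have "(g \<otimes> ?y \<otimes> inv g) \<otimes> inv (?y [^] k) = \<one>" using k Q(1) by blast
    then have "g \<otimes> ?y \<otimes> inv g = ?y [^] k"
      using inv_solve_right[of "\<one>" "g \<otimes> ?y \<otimes> inv g" "?y [^] k"] g yc by simp
    then show "?y \<in> H" using y yk by (simp add: H_def)
  qed
  then show "g \<otimes> a \<otimes> inv g \<in> K" by (simp add: H_def)
qed

lemma residual_hall: "hall_subgroup G (sigma_residual \<sigma>)" and residual_odd: "odd (card (sigma_residual \<sigma>))"
proof -
  let ?D = "sigma_residual \<sigma>"
  have *: "odd p \<and> \<not> p dvd order G div card ?D" if p: "Factorial_Ring.prime p" "p dvd card ?D" for p
  proof -
    obtain x where x: "x \<in> ?D" "x \<in> pi_elements {p}" "x \<noteq> \<one>" using cauchy[OF p(1) residual_subgroup p(2)] by blast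
    note xp = residual_prime[OF p(1) x]
    then show ?thesis
      using prime_not_dvd_index[OF p(1) residual_subgroup subgroup_self subgroup.subset[OF residual_subgroup]]
      by (auto simp: order_def)
  qed
  have "coprime (card ?D) (order G div card ?D)"
  proof (rule coprimeI)
    fix c assume c: "c dvd card ?D" "c dvd order G div card ?D"
    show "is_unit c"
    proof (rule ccontr)
      assume "\<not> is_unit c"
      then obtain p where "Factorial_Ring.prime p" "p dvd c" by (metis nat_dvd_1_iff_1 prime_factor_nat)
      then show False using * c dvd_trans by blast
    qed
  qed
  then show "hall_subgroup G ?D"
    using residual_subgroup card_rcosets_subgroup[OF residual_subgroup] by (simp add: hall_subgroup_def)
  show "odd (card ?D)" using *[of 2] two_is_prime_nat by auto
qed

end

text \<open>All subgroups of \<open>D\<close> being normal in \<open>G\<close> is the form in which the power automorphism condition is both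
verified and used.\<close>
lemma (in finite_group) power_automorphism_conj_iff:
  assumes D: "D \<lhd> G"
  shows "(\<forall>g\<in>carrier G. power_automorphism (G\<lparr>carrier := D\<rparr>) (\<lambda>x\<in>D. inv g \<otimes> x \<otimes> g)) \<longleftrightarrow>
    (\<forall>K. subgroup K G \<and> K \<subseteq> D \<longrightarrow> K \<lhd> G)" (is "?l \<longleftrightarrow> ?r")
proof
  have sD: "subgroup D G" using D by (rule normal_imp_subgroup)
  have cD: "x \<in> carrier G" if "x \<in> D" for x using subgroup.mem_carrier[OF sD that] .
  {
    assume l: ?l
    show ?r
    proof clarify
      fix K assume K: "subgroup K G" "K \<subseteq> D"
      show "K \<lhd> G"
      proof (rule normal_invI[OF K(1)])
        fix g k assume g: "g \<in> carrier G" and k: "k \<in> K"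
        have "subgroup K (G\<lparr>carrier := D\<rparr>)" using subgroup_incl[OF K(1) sD K(2)] .
        moreover have "power_automorphism (G\<lparr>carrier := D\<rparr>) (\<lambda>x\<in>D. inv (inv g) \<otimes> x \<otimes> inv g)"
          using l g by blast
        ultimately have "(\<lambda>x\<in>D. inv (inv g) \<otimes> x \<otimes> inv g) ` K = K" unfolding power_automorphism_def by blast
        moreover have "g \<otimes> k \<otimes> inv g = (\<lambda>x\<in>D. inv (inv g) \<otimes> x \<otimes> inv g) k" using k K(2) g by auto
        ultimately show "g \<otimes> k \<otimes> inv g \<in> K" using k by blast
      qed
    qed
  }
  {
    assume r: ?r
    show ?l
    proof
      fix g assume g: "g \<in> carrier G"
      let ?f = "\<lambda>x\<in>D. inv g \<otimes> x \<otimes> g"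
      have inj: "inj_on ?f D" using g cD by (auto intro!: inj_onI)
      have img: "?f ` K = K" if K: "subgroup K G" "K \<subseteq> D" for K
      proof -
        have "?f ` K \<subseteq> K"
        proof
          fix y assume "y \<in> ?f ` K"
          then obtain k where k: "k \<in> K" "y = inv g \<otimes> k \<otimes> g" using K(2) by auto
          have "inv g \<otimes> k \<otimes> inv (inv g) \<in> K" using r K normal_invE(2)[of K "inv g" k] g k(1) by blast
          then show "y \<in> K" using k(2) g by simp
        qed
        moreover have "inj_on ?f K" using inj K(2) inj_on_subset by blast
        ultimately show ?thesis by (intro endo_inj_surj subgroup_finite[OF K(1)])
      qed
      have "?f \<in> hom (G\<lparr>carrier := D\<rparr>) (G\<lparr>carrier := D\<rparr>)"
      proof (rule homI)
        fix x assume "x \<in> carrier (G\<lparr>carrier := D\<rparr>)"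
        then show "?f x \<in> carrier (G\<lparr>carrier := D\<rparr>)" using img[OF sD] by auto
      next
        fix x y assume "x \<in> carrier (G\<lparr>carrier := D\<rparr>)" "y \<in> carrier (G\<lparr>carrier := D\<rparr>)"
        then have xy: "x \<in> D" "y \<in> D" by auto
        then show "?f (x \<otimes>\<^bsub>G\<lparr>carrier := D\<rparr>\<^esub> y) = ?f x \<otimes>\<^bsub>G\<lparr>carrier := D\<rparr>\<^esub> ?f y"
          using conj_mult[of "inv g" x y] g cD subgroup.m_closed[OF sD] by simp
      qed
      moreover have "?f \<in> Bij (carrier (G\<lparr>carrier := D\<rparr>))"
        using inj img[OF sD] by (auto simp: Bij_def bij_betw_def)
      ultimately have "?f \<in> auto (G\<lparr>carrier := D\<rparr>)" by (simp add: auto_def)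
      moreover have "?f ` K = K" if "subgroup K (G\<lparr>carrier := D\<rparr>)" for K
        using img incl_subgroup[OF sD that] subgroup.subset[OF that] by auto
      ultimately show "power_automorphism (G\<lparr>carrier := D\<rparr>) ?f" unfolding power_automorphism_def by blast
    qed
  }
qed

lemma (in finite_group) commutative_pi_core:
  assumes "\<And>x y. x \<in> carrier G \<Longrightarrow> y \<in> carrier G \<Longrightarrow> x \<otimes> y = y \<otimes> x"
  shows "pi_core \<pi> G = pi_elements \<pi>"
proof
  have n: "pi_elements \<pi> \<lhd> G" using commutative_pi_elements_normal assms by blast
  then show "pi_elements \<pi> \<subseteq> pi_core \<pi> G"
    using pi_core_greatest[OF n] pi_subgroup_iff[OF normal_imp_subgroup[OF n]] by blast
  show "pi_core \<pi> G \<subseteq> pi_elements \<pi>"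
    using subgroup_pi_elements[OF normal_imp_subgroup[OF pi_core_normal] pi_core_card] .
qed

lemma (in finite_group) pi_core_of_abelian_subgroup:
  assumes D: "subgroup D G" and "\<And>x y. x \<in> D \<Longrightarrow> y \<in> D \<Longrightarrow> x \<otimes> y = y \<otimes> x"
  shows "pi_core \<pi> (G\<lparr>carrier := D\<rparr>) = D \<inter> pi_elements \<pi>" "subgroup (D \<inter> pi_elements \<pi>) G"
proof -
  interpret D: finite_group "G\<lparr>carrier := D\<rparr>" using subgroup_finite_group[OF D] .
  show e: "pi_core \<pi> (G\<lparr>carrier := D\<rparr>) = D \<inter> pi_elements \<pi>"
    using D.commutative_pi_core[of \<pi>] assms(2) pi_elements_restrict[OF D, of \<pi>] by (simp add: Int_commute)
  show "subgroup (D \<inter> pi_elements \<pi>) G"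
    using incl_subgroup[OF D normal_imp_subgroup[OF D.pi_core_normal[of \<pi>]]] unfolding e .
qed

context soluble_psigmat
begin

theorem residual_conditions:
  "\<exists>M. subgroup M G \<and> condition_i \<sigma> G (sigma_residual \<sigma>) M \<and> condition_ii \<sigma> G (sigma_residual \<sigma>)"
proof -
  let ?D = "sigma_residual \<sigma>"
  have "coprime (card ?D) (order G div card ?D)"
    using residual_hall card_rcosets_subgroup[OF residual_subgroup] by (simp add: hall_subgroup_def)
  then obtain M where M: "subgroup M G" "?D \<inter> M = {\<one>}" "?D <#> M = carrier G"
    using schur_zassenhaus[OF residual_normal] by blast
  have i: "condition_i \<sigma> G ?D M"
    unfolding condition_i_def inner_semidirect_def complement_in_def
  proof (intro conjI)
    show "comm_group (G\<lparr>carrier := ?D\<rparr>)"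
      using residual_abelian subgroup_imp_group[OF residual_subgroup] by (intro group.group_comm_groupI) auto
    show "\<forall>g\<in>carrier G. power_automorphism (G\<lparr>carrier := ?D\<rparr>) (\<lambda>x\<in>?D. inv g \<otimes> x \<otimes> g)"
      unfolding power_automorphism_conj_iff[OF residual_normal] using residual_subgroups_normal by blast
  qed (use M residual_normal residual_subgroup residual_hall residual_odd
      residual_complement_sigma_nilpotent[OF part M(1,2)] in blast)+
  have "condition_ii \<sigma> G ?D"
    unfolding condition_ii_def
  proof
    fix \<pi> assume \<pi>: "\<pi> \<in> \<sigma>"
    obtain Q A C where Q: "C \<lhd> G" "Q \<inter> pi_elements \<pi> = {\<one>}" "A \<inter> C \<subseteq> Q" "A \<subseteq> pi_residual \<pi>" "?D \<subseteq> A"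
      and A: "\<And>e. e \<in> pi_elements \<pi> \<Longrightarrow> \<exists>m::nat. e [^] m \<in> A \<and> e \<otimes> inv (e [^] m) \<in> C"
      by (rule class_structure[OF \<pi>]) blast
    obtain E where E: "hall_pi_subgroup \<pi> G E" using sigma_soluble_hall[OF soluble part \<pi>] by blast
    then have sE: "subgroup E G" "pi_number \<pi> (card E)" by (auto simp: hall_pi_subgroup_iff)
    have E\<pi>: "E \<subseteq> pi_elements \<pi>" using subgroup_pi_elements[OF sE] .
    define B where "B = ?D \<inter> pi_elements \<pi>"
    have B: "pi_core \<pi> (G\<lparr>carrier := ?D\<rparr>) = B" "subgroup B G"
      unfolding B_def using pi_core_of_abelian_subgroup[OF residual_subgroup residual_abelian] by auto
    have nB: "B \<lhd> G" using residual_subgroups_normal[OF B(2)] by (simp add: B_def)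
    have "pi_number \<pi> (card B)" using pi_subgroup_iff[OF B(2)] by (simp add: B_def)
    then have BE: "B \<subseteq> E" using normal_pi_subgroup_subset_hall[OF E nB] by blast
    let ?N = "C \<inter> E"
    have nN: "?N \<lhd> G\<lparr>carrier := E\<rparr>" using normal_restrict[OF Q(1) sE(1)] .
    have "complement_in (G\<lparr>carrier := E\<rparr>) B ?N"
      unfolding complement_in_def
    proof (intro conjI)
      show "subgroup B (G\<lparr>carrier := E\<rparr>)" using subgroup_incl[OF B(2) sE(1) BE] .
      show "subgroup ?N (G\<lparr>carrier := E\<rparr>)" using nN by (rule normal_imp_subgroup)
      show "B \<inter> ?N = {\<one>\<^bsub>G\<lparr>carrier := E\<rparr>\<^esub>}"
      proof -
        have "B \<inter> ?N \<subseteq> {\<one>}" using Q(2,3,5) unfolding B_def by blast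
        moreover have "\<one> \<in> B \<inter> ?N"
          using subgroup.one_closed[OF B(2)] subgroup.one_closed[OF sE(1)] subgroup.one_closed[OF normal_imp_subgroup[OF Q(1)]] by blast
        ultimately show ?thesis by auto
      qed
      show "B <#>\<^bsub>G\<lparr>carrier := E\<rparr>\<^esub> ?N = carrier (G\<lparr>carrier := E\<rparr>)"
      proof
        show "B <#>\<^bsub>G\<lparr>carrier := E\<rparr>\<^esub> ?N \<subseteq> carrier (G\<lparr>carrier := E\<rparr>)"
          using BE subgroup.m_closed[OF sE(1)] by (auto simp: set_mult_def)
        show "carrier (G\<lparr>carrier := E\<rparr>) \<subseteq> B <#>\<^bsub>G\<lparr>carrier := E\<rparr>\<^esub> ?N"
        proof
          fix e assume "e \<in> carrier (G\<lparr>carrier := E\<rparr>)"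
          then have e: "e \<in> E" by simp
          have ec: "e \<in> carrier G" using subgroup.mem_carrier[OF sE(1) e] .
          obtain m :: nat where m: "e [^] m \<in> A" "e \<otimes> inv (e [^] m) \<in> C" using A E\<pi> e by blast
          have em: "e [^] m \<in> E" using subgroup_pow_closed[OF sE(1) e] .
          then have "e [^] m \<in> B"
            using m(1) Q(4) E\<pi> pi_element_in_sigma_residual[OF part \<pi>] unfolding B_def by blast
          moreover have "e \<otimes> inv (e [^] m) \<in> ?N"
            using m(2) subgroup.m_closed[OF sE(1) e subgroup.m_inv_closed[OF sE(1) em]] by blast
          moreover have "e = e [^] m \<otimes> (e \<otimes> inv (e [^] m))"
          proof -
            have "e [^] m \<otimes> e = e \<otimes> e [^] m" using commute_pow[OF ec ec] by simp
            then have "e [^] m \<otimes> (e \<otimes> inv (e [^] m)) = e \<otimes> e [^] m \<otimes> inv (e [^] m)"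
              using ec by (simp add: m_assoc[symmetric])
            then show ?thesis using ec by (simp add: m_assoc)
          qed
          ultimately show "e \<in> B <#>\<^bsub>G\<lparr>carrier := E\<rparr>\<^esub> ?N" unfolding set_mult_consistent using set_mult_mem by metis
        qed
      qed
    qed
    then show "\<exists>H N. hall_pi_subgroup \<pi> G H \<and> N \<lhd> G\<lparr>carrier := H\<rparr> \<and>
        complement_in (G\<lparr>carrier := H\<rparr>) (pi_core \<pi> (G\<lparr>carrier := ?D\<rparr>)) N"
      unfolding B(1) using E nN by blast
  qed
  then show ?thesis using M(1) i by blast
qed

end

section \<open>Transitivity from a normal abelian Hall subgroup\<close>

text \<open>Modulo \<open>N\<close> the elements \<open>a\<close> and \<open>c\<close> commute, so the powers can be taken factor by factor.\<close>
lemma (in finite_group) pow_mem_of_commuting_mod: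
  assumes N: "N \<lhd> G" and c: "a \<in> carrier G" "c \<in> carrier G" and comm: "(a \<otimes> c) \<otimes> inv (c \<otimes> a) \<in> N"
    and one: "a [^] n = \<one>" "(a \<otimes> c) [^] (n::nat) = \<one>"
  shows "c [^] n \<in> N"
proof -
  interpret L: surj_hom G "G Mod N" "\<lambda>x. N #> x" using quotient_surj_hom N by blast
  have Ker: "L.Ker = N" using quotient_surj_hom N by blast
  let ?h = "\<lambda>x. N #> x"
  note hc = L.hom_closed[OF c(1)] L.hom_closed[OF c(2)]
  have "?h (a \<otimes> c) = ?h (c \<otimes> a)" using L.h_eq_iff[of "a \<otimes> c" "c \<otimes> a"] comm c unfolding Ker by simp
  then have com: "?h a \<otimes>\<^bsub>G Mod N\<^esub> ?h c = ?h c \<otimes>\<^bsub>G Mod N\<^esub> ?h a"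
    unfolding L.hom_mult[OF c] L.hom_mult[OF c(2,1)] .
  have "?h ((a \<otimes> c) [^] n) = ?h (a [^] n) \<otimes>\<^bsub>G Mod N\<^esub> ?h (c [^] n)"
    unfolding L.hom_nat_pow[OF m_closed[OF c]] L.hom_mult[OF c] L.hom_nat_pow[OF c(1)] L.hom_nat_pow[OF c(2)]
    by (rule L.H.pow_mult_distrib[OF com hc])
  then have e: "\<one>\<^bsub>G Mod N\<^esub> = \<one>\<^bsub>G Mod N\<^esub> \<otimes>\<^bsub>G Mod N\<^esub> ?h (c [^] n)" unfolding one L.hom_one .
  have "?h (c [^] n) = \<one>\<^bsub>G Mod N\<^esub> \<otimes>\<^bsub>G Mod N\<^esub> ?h (c [^] n)"
    by (rule L.H.l_one[OF L.hom_closed[OF nat_pow_closed[OF c(2)]], symmetric])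
  also have "\<dots> = \<one>\<^bsub>G Mod N\<^esub>" by (rule e[symmetric])
  finally have "?h (c [^] n) = \<one>\<^bsub>G Mod N\<^esub>" .
  then have "c [^] n \<in> L.Ker" using c by (simp add: kernel_def)
  then show ?thesis using Ker by simp
qed

lemma (in finite_group) mem_of_coprime_pow:
  assumes N: "subgroup N G" and c: "c \<in> pi_elements \<rho>" "c [^] n \<in> N" and n: "pi_number \<tau> n" "\<tau> \<inter> \<rho> = {}"
  shows "c \<in> N"
proof -
  obtain m where m: "pi_number \<rho> m" "c [^] m = \<one>" "c \<in> carrier G" using c(1) by (auto simp: pi_elements_def)
  then obtain j :: nat where "(c [^] n) [^] j = c"
    using pow_coprime_generates[OF m(3,2) pi_number_coprime[OF n(1) m(1) n(2)]] by (auto simp: pi_number_def)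
  then show ?thesis using subgroup_pow_closed[OF N c(2), of j] by simp
qed

lemma (in finite_group) hall_conj:
  assumes E: "hall_pi_subgroup \<pi> G E" and g: "g \<in> carrier G"
  shows "hall_pi_subgroup \<pi> G ((\<lambda>x. g \<otimes> x \<otimes> inv g) ` E)"
proof -
  have sE: "subgroup E G" using E by (simp add: hall_pi_subgroup_iff)
  have c: "x \<in> carrier G" if "x \<in> E" for x using subgroup.mem_carrier[OF sE that] .
  have "inj_on (\<lambda>x. g \<otimes> x \<otimes> inv g) E" using g c by (auto intro!: inj_onI)
  then have "card ((\<lambda>x. g \<otimes> x \<otimes> inv g) ` E) = card E" by (rule card_image)
  moreover have "subgroup ((\<lambda>x. g \<otimes> x \<otimes> inv g) ` E) G"
  proof (rule subgroup_of_mult_closed)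
    show "(\<lambda>x. g \<otimes> x \<otimes> inv g) ` E \<subseteq> carrier G" using g c by auto
    show "\<one> \<in> (\<lambda>x. g \<otimes> x \<otimes> inv g) ` E"
      using g subgroup.one_closed[OF sE] by (intro image_eqI[of _ _ \<one>]) auto
    fix x y assume "x \<in> (\<lambda>x. g \<otimes> x \<otimes> inv g) ` E" "y \<in> (\<lambda>x. g \<otimes> x \<otimes> inv g) ` E"
    then obtain a b where ab: "a \<in> E" "b \<in> E" "x = g \<otimes> a \<otimes> inv g" "y = g \<otimes> b \<otimes> inv g" by blast
    have "x \<otimes> y = g \<otimes> (a \<otimes> b) \<otimes> inv g" unfolding ab(3,4) using conj_mult[OF g c[OF ab(1)] c[OF ab(2)]] by simp
    then show "x \<otimes> y \<in> (\<lambda>x. g \<otimes> x \<otimes> inv g) ` E" using subgroup.m_closed[OF sE ab(1,2)] by blast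
  qed
  ultimately show ?thesis using E by (simp add: hall_pi_subgroup_iff)
qed

text \<open>Both products have the same cardinality.\<close>
lemma (in finite_group) set_mult_commute_of_subset:
  assumes A: "subgroup A G" and E: "subgroup E G" and sub: "A <#> E \<subseteq> E <#> A"
  shows "A <#> E = E <#> A"
proof (rule card_subset_eq[OF _ sub])
  show "finite (E <#> A)"
    using finite_subset[OF setmult_subset_G finite_carrier] subgroup.subset[OF A] subgroup.subset[OF E] by blast
  have "card (A <#> E) * card (A \<inter> E) = card (E <#> A) * card (A \<inter> E)"
    using card_set_mult[OF A E] card_set_mult[OF E A] by (simp add: Int_commute mult.commute)
  then show "card (A <#> E) = card (E <#> A)"
    using card_subgroup_pos[OF subgroups_Inter_pair[OF A E]] by simp
qed

text \<open>The index of \<open>D E\<close> in \<open>R\<close> divides the index of \<open>E\<close>, a \<open>\<pi>'\<close>-number, and is a \<open>\<pi>\<close>-number, because \<open>D\<close>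
contains the elements of \<open>R\<close> whose order is a power of a prime outside \<open>\<pi>\<close>.\<close>
lemma (in finite_group) normal_hall_supplement:
  assumes E: "hall_pi_subgroup \<pi> G E" and R: "subgroup R G" "E \<subseteq> R" and D: "D \<lhd> G" "D \<subseteq> R"
    and elts: "\<And>p x. Factorial_Ring.prime p \<Longrightarrow> p \<notin> \<pi> \<Longrightarrow> x \<in> R \<Longrightarrow> x \<in> pi_elements {p} \<Longrightarrow> x \<in> D"
  shows "D <#> E = R"
proof -
  have sE: "subgroup E G" and cE: "pi_number (- \<pi>) (order G div card E)" using E by (auto simp: hall_pi_subgroup_iff)
  note S = set_mult_normal_subgroup[OF D(1) sE]
  have SR: "D <#> E \<subseteq> R" using R D(2) subgroup.m_closed[OF R(1)] by (auto simp: set_mult_def)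
  have 1: "pi_number \<pi> (card R div card (D <#> E))"
    by (rule pi_index[OF S(1) R(1) SR]) (use elts S(2) in blast)
  have "order G div card E = (card (D <#> E) div card E) * (order G div card (D <#> E))"
    unfolding order_def by (rule index_mult[OF sE S(1) subgroup_self S(3) subgroup.subset[OF S(1)]])
  also have "order G div card (D <#> E) = (card R div card (D <#> E)) * (order G div card R)"
    unfolding order_def by (rule index_mult[OF S(1) R(1) subgroup_self SR subgroup.subset[OF R(1)]])
  finally have "card R div card (D <#> E) dvd order G div card E" by simp
  then have 2: "pi_number (- \<pi>) (card R div card (D <#> E))" using cE pi_number_dvd by blast
  have "card R div card (D <#> E) = 1" using pi_number_both[OF 1 2] by blast
  then have "card (D <#> E) = card R" using card_eq_index_mult[OF S(1) R(1) SR] by simp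
  then show ?thesis using SR subgroup_finite[OF R(1)] by (simp add: card_subset_eq)
qed

text \<open>The two conditions, rephrased: \<open>R \<pi>\<close> is the preimage of the Hall \<open>\<pi>\<close>-subgroup of the
\<open>\<sigma>\<close>-nilpotent group \<open>G/D\<close>, and it centralises the \<open>\<pi>\<close>-part of \<open>D\<close>.\<close>
locale power_normal_hall = finite_group +
  fixes \<sigma> :: "nat set set" and D :: "'a set" and R :: "nat set \<Rightarrow> 'a set"
  assumes part: "partition_on {p. Factorial_Ring.prime p} \<sigma>"
    and D_normal: "D \<lhd> G"
    and D_abelian: "\<And>x y. x \<in> D \<Longrightarrow> y \<in> D \<Longrightarrow> x \<otimes> y = y \<otimes> x"
    and D_hall: "\<And>p. Factorial_Ring.prime p \<Longrightarrow> p dvd card D \<Longrightarrow> pi_elements {p} \<subseteq> D"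
    and D_subgroups: "\<And>K. subgroup K G \<Longrightarrow> K \<subseteq> D \<Longrightarrow> K \<lhd> G"
    and R_normal: "\<And>\<pi>. \<pi> \<in> \<sigma> \<Longrightarrow> R \<pi> \<lhd> G"
    and R_pi: "\<And>\<pi>. \<pi> \<in> \<sigma> \<Longrightarrow> pi_elements \<pi> \<subseteq> R \<pi>"
    and D_R: "\<And>\<pi>. \<pi> \<in> \<sigma> \<Longrightarrow> D \<subseteq> R \<pi>"
    and R_other: "\<And>\<pi> p x. \<pi> \<in> \<sigma> \<Longrightarrow> Factorial_Ring.prime p \<Longrightarrow> p \<notin> \<pi> \<Longrightarrow> x \<in> R \<pi> \<Longrightarrow> x \<in> pi_elements {p} \<Longrightarrow> x \<in> D"
    and R_central: "\<And>\<pi> g d. \<pi> \<in> \<sigma> \<Longrightarrow> g \<in> R \<pi> \<Longrightarrow> d \<in> D \<Longrightarrow> d \<in> pi_elements \<pi> \<Longrightarrow> g \<otimes> d = d \<otimes> g"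
begin

lemma D_subgroup: "subgroup D G" using D_normal by (rule normal_imp_subgroup)
lemma D_carrier: "x \<in> D \<Longrightarrow> x \<in> carrier G" using subgroup.mem_carrier[OF D_subgroup] .
lemma D_mult: "x \<in> D \<Longrightarrow> y \<in> D \<Longrightarrow> x \<otimes> y \<in> D" using subgroup.m_closed[OF D_subgroup] .
lemma D_inv: "x \<in> D \<Longrightarrow> inv x \<in> D" using subgroup.m_inv_closed[OF D_subgroup] .
lemma D_conj: "g \<in> carrier G \<Longrightarrow> x \<in> D \<Longrightarrow> g \<otimes> x \<otimes> inv g \<in> D" using normal_invE(2)[OF D_normal] .
lemma R_subgroup: "\<pi> \<in> \<sigma> \<Longrightarrow> subgroup (R \<pi>) G" using R_normal normal_imp_subgroup by blast

lemma D_coprime_element: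
  assumes "Factorial_Ring.prime p" "\<not> p dvd card D" "c \<in> D"
  shows "c \<in> pi_elements (- {p})"
  using subgroup_pi_elements[OF D_subgroup pi_number_not_dvd[OF assms(1) card_subgroup_pos[OF D_subgroup] assms(2)]] assms(3) by blast

text \<open>Put \<open>B = K \<inter> R \<pi>\<close> and let \<open>C\<close> be the \<open>\<pi>'\<close>-part of \<open>K \<inter> D\<close>. Then \<open>B E\<close> is a subgroup, \<open>C E\<close> is a
subgroup of it, and the index \<open>j\<close> is a \<open>\<pi>\<close>-number since \<open>|B : C|\<close> is one, and a \<open>\<pi>'\<close>-number since
\<open>E\<close> is a Hall subgroup. So \<open>B E = C E\<close>, and \<open>k\<close>, which lies in \<open>B\<close>, factors accordingly.\<close>
lemma hall_factor:
  assumes Y: "subgroup Y G" and K: "subgroup K G" "K \<subseteq> Y" and \<pi>: "\<pi> \<in> \<sigma>"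
    and E: "hall_pi_subgroup \<pi> (G\<lparr>carrier := Y\<rparr>) E" and KE: "K <#> E = E <#> K"
    and k: "k \<in> K" "k \<in> pi_elements \<pi>"
  shows "\<exists>c\<in>K \<inter> D. c \<in> pi_elements (- \<pi>) \<and> inv c \<otimes> k \<in> E"
proof -
  interpret Y: finite_group "G\<lparr>carrier := Y\<rparr>" using subgroup_finite_group[OF Y] .
  have E': "subgroup E (G\<lparr>carrier := Y\<rparr>)" "pi_number \<pi> (card E)" "pi_number (- \<pi>) (card Y div card E)"
    using E by (auto simp: Y.hall_pi_subgroup_iff order_def)
  have sE: "subgroup E G" "E \<subseteq> Y" using incl_subgroup[OF Y E'(1)] subgroup.subset[OF E'(1)] by auto
  have E\<pi>: "E \<subseteq> pi_elements \<pi>" using subgroup_pi_elements[OF sE(1) E'(2)] .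
  then have ER: "E \<subseteq> R \<pi>" using R_pi[OF \<pi>] by blast
  note sR = R_subgroup[OF \<pi>]
  define B where "B = K \<inter> R \<pi>"
  define C where "C = (K \<inter> D) \<inter> pi_elements (- \<pi>)"
  have sB: "subgroup B G" unfolding B_def using subgroups_Inter_pair[OF K(1) sR] .
  have sC: "subgroup C G"
    unfolding C_def using D_abelian by (intro pi_core_of_abelian_subgroup(2) subgroups_Inter_pair K(1) D_subgroup) auto
  have nC: "C \<lhd> G" using D_subgroups[OF sC] by (auto simp: C_def)
  have CB: "C \<subseteq> B" using D_R[OF \<pi>] by (auto simp: B_def C_def)
  define S where "S = B <#> E"
  have cB: "b \<in> carrier G" if "b \<in> B" for b using subgroup.mem_carrier[OF sB that] .
  have cE: "e \<in> carrier G" if "e \<in> E" for e using subgroup.mem_carrier[OF sE(1) that] .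
  have sS: "subgroup S G"
  proof (rule subgroup_of_mult_closed)
    show "S \<subseteq> carrier G" unfolding S_def using setmult_subset_G subgroup.subset[OF sB] subgroup.subset[OF sE(1)] by blast
    show "\<one> \<in> S" unfolding S_def
      using set_mult_mem[OF subgroup.one_closed[OF sB] subgroup.one_closed[OF sE(1)]] by simp
    fix x y assume "x \<in> S" "y \<in> S"
    then obtain b e b' e' where be: "b \<in> B" "e \<in> E" "x = b \<otimes> e" "b' \<in> B" "e' \<in> E" "y = b' \<otimes> e'"
      unfolding S_def by (metis set_mult_obtain)
    have "e \<otimes> b' \<in> E <#> K" using set_mult_mem be(2,4) unfolding B_def by blast
    then have "e \<otimes> b' \<in> K <#> E" using KE by simp
    then obtain k1 e1 where ke: "k1 \<in> K" "e1 \<in> E" "e \<otimes> b' = k1 \<otimes> e1" by (rule set_mult_obtain)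
    have k1c: "k1 \<in> carrier G" using subgroup.mem_carrier[OF K(1) ke(1)] .
    have "k1 = (e \<otimes> b') \<otimes> inv e1" unfolding ke(3) using k1c cE[OF ke(2)] by (simp add: m_assoc)
    moreover have "(e \<otimes> b') \<otimes> inv e1 \<in> R \<pi>"
    proof (rule subgroup.m_closed[OF sR subgroup.m_closed[OF sR] subgroup.m_inv_closed[OF sR]])
      show "e \<in> R \<pi>" "b' \<in> R \<pi>" "e1 \<in> R \<pi>" using ER be(2,4) ke(2) by (auto simp: B_def)
    qed
    ultimately have k1: "k1 \<in> B" using ke(1) by (simp add: B_def)
    have "x \<otimes> y = b \<otimes> (e \<otimes> b') \<otimes> e'" unfolding be(3,6) using be cB cE by (simp add: m_assoc)
    also have "\<dots> = (b \<otimes> k1) \<otimes> (e1 \<otimes> e')" unfolding ke(3) using be cB cE k1c ke(2) by (simp add: m_assoc)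
    finally show "x \<otimes> y \<in> S" unfolding S_def
      using set_mult_mem[OF subgroup.m_closed[OF sB be(1) k1] subgroup.m_closed[OF sE(1) ke(2) be(5)]] by simp
  qed
  define S' where "S' = C <#> E"
  have sS': "subgroup S' G" and ES': "E \<subseteq> S'"
    unfolding S'_def using set_mult_normal_subgroup[OF nC sE(1)] by auto
  have S'S: "S' \<subseteq> S" unfolding S'_def S_def using mono_set_mult[OF CB] by blast
  have SX: "S \<subseteq> Y" unfolding S_def B_def using K(2) sE(2) subgroup.m_closed[OF Y] by (auto simp: set_mult_def)
  have CE: "C \<inter> E = {\<one>}"
  proof -
    have "x = \<one>" if "x \<in> C" "x \<in> E" for x
      using that E\<pi> pi_elements_disjoint[of x \<pi> "- \<pi>"] unfolding C_def by blast
    then show ?thesis using subgroup.one_closed[OF sC] subgroup.one_closed[OF sE(1)] by blast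
  qed
  define b j where "b = card B div card C" and "j = card S div card S'"
  have b: "card B = card C * b" "pi_number \<pi> b"
  proof -
    show "card B = card C * b" unfolding b_def by (rule card_eq_index_mult[OF sC sB CB])
    show "pi_number \<pi> b" unfolding b_def
    proof (rule pi_index[OF sC sB CB])
      fix p x assume p: "Factorial_Ring.prime p" "p \<notin> \<pi>" and x: "x \<in> B" "x \<in> pi_elements {p}"
      have "x \<in> D" using R_other[OF \<pi> p _ x(2)] x(1) unfolding B_def by blast
      moreover have "x \<in> pi_elements (- \<pi>)" using x(2) pi_elements_mono p(2) by blast
      ultimately show "x \<in> C" using x(1) unfolding B_def C_def by blast
    qed
  qed
  have j: "card S = card S' * j" unfolding j_def by (rule card_eq_index_mult[OF sS' sS S'S])
  have "card S * card (B \<inter> E) = card B * card E" unfolding S_def by (rule card_set_mult[OF sB sE(1)])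
  moreover have "card S' = card C * card E" unfolding S'_def using card_set_mult[OF sC sE(1)] CE by simp
  ultimately have "(card C * card E) * (j * card (B \<inter> E)) = (card C * card E) * b"
    using b(1) j by (simp add: ac_simps)
  then have "j * card (B \<inter> E) = b" using card_subgroup_pos[OF sC] card_subgroup_pos[OF sE(1)] by simp
  then have j1: "pi_number \<pi> j" using b(2) pi_number_dvd by (metis dvd_triv_left)
  have "card Y div card E = (card S' div card E) * (card Y div card S')"
    using index_mult[OF sE(1) sS' Y ES'] S'S SX by blast
  also have "card Y div card S' = j * (card Y div card S)"
    unfolding j_def by (rule index_mult[OF sS' sS Y S'S SX])
  finally have "j dvd card Y div card E" by simp
  then have j2: "pi_number (- \<pi>) j" using E'(3) pi_number_dvd by blast
  have "j = 1" using pi_number_both[OF j1 j2] by blast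
  then have "S' = S" using j S'S subgroup_finite[OF sS] by (simp add: card_subset_eq)
  moreover have "k \<in> S"
  proof -
    have "k \<in> B" using k R_pi[OF \<pi>] unfolding B_def by blast
    then have "k \<otimes> \<one> \<in> S" unfolding S_def using set_mult_mem subgroup.one_closed[OF sE(1)] by blast
    then show ?thesis using subgroup.mem_carrier[OF K(1) k(1)] by simp
  qed
  ultimately have "k \<in> C <#> E" by (simp add: S'_def)
  then obtain c e where ce: "c \<in> C" "e \<in> E" "k = c \<otimes> e" by (rule set_mult_obtain)
  have "inv c \<otimes> k = e" unfolding ce(3) using subgroup.mem_carrier[OF sC ce(1)] cE[OF ce(2)] by (simp add: cancel_inv)
  then show ?thesis using ce unfolding C_def by blast
qed

text \<open>Let \<open>k\<close> be a \<open>p\<close>-element of \<open>K\<close> with \<open>p \<in> \<pi>\<close>. The \<open>\<pi>\<close>-part of \<open>d\<close> commutes with \<open>k\<close>; let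
\<open>d2\<close> be the \<open>\<pi>'\<close>-part. By \<open>hall_factor\<close>, applied to a Hall subgroup \<open>E\<close> and to its conjugate
\<open>E2\<close> by \<open>d2\<close>, the element \<open>k\<close> lies modulo \<open>K \<inter> D\<close> in both. Then the commutator of \<open>d2\<close> and \<open>k\<close>
is, up to factors from \<open>K \<inter> D\<close>, in \<open>E2\<close> as well as a \<open>\<pi>'\<close>-element of \<open>D\<close>.\<close>
lemma sigma_permutable_normalised:
  assumes Y: "subgroup Y G" and perm: "sigma_permutable \<sigma> (G\<lparr>carrier := Y\<rparr>) K"
    and "d \<in> D" "d \<in> Y" "k \<in> K"
  shows "d \<otimes> k \<otimes> inv d \<in> K"
proof -
  interpret Y: finite_group "G\<lparr>carrier := Y\<rparr>" using subgroup_finite_group[OF Y] .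
  have sK': "subgroup K (G\<lparr>carrier := Y\<rparr>)" using perm by (simp add: sigma_permutable_def)
  have sK: "subgroup K G" "K \<subseteq> Y" using incl_subgroup[OF Y sK'] subgroup.subset[OF sK'] by auto
  have cK: "x \<in> carrier G" if "x \<in> K" for x using subgroup.mem_carrier[OF sK(1) that] .
  have permutes: "K <#> E = E <#> K" if "\<pi> \<in> \<sigma>" "hall_pi_subgroup \<pi> (G\<lparr>carrier := Y\<rparr>) E" for \<pi> E
    using perm that unfolding sigma_permutable_def by simp
  define H where "H = {k \<in> K. \<forall>d\<in>D \<inter> Y. d \<otimes> k \<otimes> inv d \<in> K}"
  have sH: "subgroup H G"
  proof (rule subgroup_of_mult_closed)
    show "H \<subseteq> carrier G" using cK by (auto simp: H_def)
    show "\<one> \<in> H" using subgroup.one_closed[OF sK(1)] D_carrier by (simp add: H_def)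
    fix x y assume "x \<in> H" "y \<in> H"
    then show "x \<otimes> y \<in> H"
      using conj_mult[OF D_carrier cK cK] subgroup.m_closed[OF sK(1)] by (simp add: H_def)
  qed
  have "K \<subseteq> H"
  proof (rule subgroup_subset_by_prime_elements[OF sH sK(1)])
    fix p k assume p: "Factorial_Ring.prime p" and k: "k \<in> K" "k \<in> pi_elements {p}"
    note kc = cK[OF k(1)]
    obtain \<pi> where \<pi>: "\<pi> \<in> \<sigma>" "p \<in> \<pi>" using partition_on_class[OF part] p by blast
    have k\<pi>: "k \<in> pi_elements \<pi>" using k(2) pi_elements_mono \<pi>(2) by blast
    have "d \<otimes> k \<otimes> inv d \<in> K" if d: "d \<in> D" "d \<in> Y" for d
    proof -
      obtain m m' where m: "d [^] (m::nat) \<in> pi_elements \<pi>" "d [^] (m'::nat) \<in> pi_elements (- \<pi>)"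
          "d = d [^] m \<otimes> d [^] m'" using pi_decomposition[OF D_carrier[OF d(1)]] by blast
      define d1 d2 where "d1 = d [^] m" and "d2 = d [^] m'"
      have d12: "d1 \<in> D" "d2 \<in> D" "d2 \<in> Y"
        unfolding d1_def d2_def using d subgroup_pow_closed[OF D_subgroup] subgroup_pow_closed[OF Y] by auto
      note c1 = D_carrier[OF d12(1)] and c2 = D_carrier[OF d12(2)]
      have d2\<pi>: "d2 \<in> pi_elements (- \<pi>)" using m(2) by (simp add: d2_def)
      define k2 where "k2 = d2 \<otimes> k \<otimes> inv d2"
      have k2c: "k2 \<in> carrier G" using c2 kc by (simp add: k2_def)
      have "k \<otimes> d1 = d1 \<otimes> k" using R_central[OF \<pi>(1) _ d12(1)] R_pi[OF \<pi>(1)] k\<pi> m(1) unfolding d1_def by blast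
      then have "k2 \<otimes> d1 = d1 \<otimes> k2"
        unfolding k2_def using D_abelian[OF d12(2,1)] D_abelian[OF D_inv[OF d12(2)] d12(1)] c1 c2 kc
        by (intro commute_mult) auto
      then have "d1 \<otimes> k2 \<otimes> inv d1 = k2" using conj_eq_iff_commute[OF c1 k2c] by simp
      then have dk: "d \<otimes> k \<otimes> inv d = k2"
        using conj_by_mult[OF c1 c2 kc] m(3) unfolding d1_def[symmetric] d2_def[symmetric] k2_def[symmetric] by simp
      obtain \<H> where "complete_hall_sigma_set \<sigma> (G\<lparr>carrier := Y\<rparr>) \<H>" using perm by (auto simp: sigma_permutable_def)
      then obtain E where E: "hall_pi_subgroup \<pi> (G\<lparr>carrier := Y\<rparr>) E"
        using Y.complete_hall_sigma_set_imp_hall \<pi>(1) by blast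
      then have sE': "subgroup E (G\<lparr>carrier := Y\<rparr>)" "pi_number \<pi> (card E)" by (auto simp: Y.hall_pi_subgroup_iff)
      define E2 where "E2 = (\<lambda>x. d2 \<otimes> x \<otimes> inv d2) ` E"
      have E2: "hall_pi_subgroup \<pi> (G\<lparr>carrier := Y\<rparr>) E2"
        using Y.hall_conj[OF E, of d2] d12(3) m_inv_consistent[OF Y d12(3)] by (simp add: E2_def)
      then have sE2': "subgroup E2 (G\<lparr>carrier := Y\<rparr>)" "pi_number \<pi> (card E2)" by (auto simp: Y.hall_pi_subgroup_iff)
      have sE2: "subgroup E2 G" using incl_subgroup[OF Y sE2'(1)] .
      obtain a where a: "a \<in> K \<inter> D" "a \<in> pi_elements (- \<pi>)" "inv a \<otimes> k \<in> E"
        using hall_factor[OF Y sK \<pi>(1) E permutes[OF \<pi>(1) E] k(1) k\<pi>] by blast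
      obtain b where b: "b \<in> K \<inter> D" "b \<in> pi_elements (- \<pi>)" "inv b \<otimes> k \<in> E2"
        using hall_factor[OF Y sK \<pi>(1) E2 permutes[OF \<pi>(1) E2] k(1) k\<pi>] by blast
      have aD: "a \<in> D" and bD: "b \<in> D" using a b by auto
      note ac = D_carrier[OF aD] and bc = D_carrier[OF bD]
      have "d2 \<otimes> (inv a \<otimes> k) \<otimes> inv d2 \<in> E2" unfolding E2_def using a(3) by blast
      moreover have "d2 \<otimes> (inv a \<otimes> k) \<otimes> inv d2 = inv a \<otimes> k2"
      proof -
        have "d2 \<otimes> inv a \<otimes> inv d2 = inv a"
          using conj_eq_iff_commute[OF c2, of "inv a"] D_abelian[OF d12(2) D_inv[OF aD]] ac by simp
        then show ?thesis using conj_mult[OF c2 _ kc, of "inv a"] ac unfolding k2_def by simp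
      qed
      ultimately have "(inv a \<otimes> k2) \<otimes> inv (inv b \<otimes> k) \<in> E2"
        using subgroup.m_closed[OF sE2 _ subgroup.m_inv_closed[OF sE2 b(3)]] by simp
      moreover define w where "w = (inv a \<otimes> k2) \<otimes> inv (inv b \<otimes> k)"
      ultimately have w\<pi>: "w \<in> pi_elements \<pi>" using subgroup_pi_elements[OF sE2 sE2'(2)] by blast
      have t: "k \<otimes> inv d2 \<otimes> inv k \<in> D" "k \<otimes> inv d2 \<otimes> inv k \<in> pi_elements (- \<pi>)"
        using D_conj[OF kc D_inv[OF d12(2)]] pi_elements_conj[OF kc pi_elements_inv[OF d2\<pi>]] by auto
      have u: "d2 \<otimes> (k \<otimes> inv d2 \<otimes> inv k) \<in> D" "d2 \<otimes> (k \<otimes> inv d2 \<otimes> inv k) \<in> pi_elements (- \<pi>)"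
        using D_mult[OF d12(2) t(1)] pi_elements_commuting_mult[OF d2\<pi> t(2) D_abelian[OF d12(2) t(1)]] by auto
      have v: "inv a \<otimes> (d2 \<otimes> (k \<otimes> inv d2 \<otimes> inv k)) \<in> D" "inv a \<otimes> (d2 \<otimes> (k \<otimes> inv d2 \<otimes> inv k)) \<in> pi_elements (- \<pi>)"
        using D_mult[OF D_inv[OF aD] u(1)]
          pi_elements_commuting_mult[OF pi_elements_inv[OF a(2)] u(2) D_abelian[OF D_inv[OF aD] u(1)]] by auto
      have weq: "w = inv a \<otimes> (d2 \<otimes> (k \<otimes> inv d2 \<otimes> inv k)) \<otimes> b"
        unfolding w_def k2_def using ac bc c2 kc by (simp add: inv_mult_group m_assoc)
      have "w \<in> pi_elements (- \<pi>)"
        unfolding weq using pi_elements_commuting_mult[OF v(2) b(2) D_abelian[OF v(1) bD]] .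
      then have "w = \<one>" using w\<pi> pi_elements_disjoint[of w \<pi> "- \<pi>"] by blast
      then have "inv a \<otimes> k2 = inv b \<otimes> k"
        unfolding w_def using ac bc kc k2c inv_solve_right[of "\<one>" "inv a \<otimes> k2" "inv b \<otimes> k"] by simp
      then have "k2 = a \<otimes> (inv b \<otimes> k)" using ac bc kc k2c by (metis cancel_inv(2))
      then have "k2 \<in> K" using a(1) b(1) k(1) subgroup.m_closed[OF sK(1)] subgroup.m_inv_closed[OF sK(1)] by auto
      then show ?thesis using dk by simp
    qed
    then show "k \<in> H" using k(1) by (simp add: H_def)
  qed
  then show ?thesis using assms(3-5) unfolding H_def by blast
qed

text \<open>It is enough to move a \<open>p\<close>-element \<open>a\<close> of \<open>A\<close> past an element \<open>e\<close> of a Hall \<open>\<pi>\<close>-subgroup \<open>E\<close>. Elements of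
\<open>D\<close> commute with \<open>a\<close> modulo \<open>A0 = A \<inter> D\<close>, which is normal in \<open>G\<close>; this settles the case \<open>a \<in> D\<close>. Otherwise
\<open>p\<close> does not divide \<open>|D|\<close>, as \<open>D\<close> is a Hall subgroup. If \<open>p \<notin> \<pi>\<close>, the commutator of \<open>a\<close> and \<open>e\<close> lies in \<open>D\<close> and has
order prime to \<open>p\<close>, so it lies in \<open>A0\<close>. If \<open>p \<in> \<pi>\<close>, write \<open>a = e0 d\<close> with \<open>e0 \<in> E\<close> and a
\<open>\<pi>'\<close>-element \<open>d\<close> of \<open>D\<close>; comparing orders again puts \<open>d\<close> into \<open>A0\<close>.\<close>
lemma normalised_imp_sigma_permutable:
  assumes A: "subgroup A G" and norm: "\<And>d a. d \<in> D \<Longrightarrow> a \<in> A \<Longrightarrow> d \<otimes> a \<otimes> inv d \<in> A"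
    and hall: "complete_hall_sigma_set \<sigma> G \<H>"
  shows "sigma_permutable \<sigma> G A"
  unfolding sigma_permutable_def
proof (intro conjI ballI allI impI)
  show "subgroup A G" by fact
  show "\<exists>\<H>. complete_hall_sigma_set \<sigma> G \<H>" using hall by blast
  fix \<pi> E assume \<pi>: "\<pi> \<in> \<sigma>" and E: "hall_pi_subgroup \<pi> G E"
  have sE: "subgroup E G" "pi_number \<pi> (card E)" using E by (auto simp: hall_pi_subgroup_iff)
  have E\<pi>: "E \<subseteq> pi_elements \<pi>" using subgroup_pi_elements[OF sE] .
  have cA: "x \<in> carrier G" if "x \<in> A" for x using subgroup.mem_carrier[OF A that] .
  have cE: "x \<in> carrier G" if "x \<in> E" for x using subgroup.mem_carrier[OF sE(1) that] .
  define A0 where "A0 = A \<inter> D"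
  have sA0: "subgroup A0 G" unfolding A0_def using subgroups_Inter_pair[OF A D_subgroup] .
  have nA0: "A0 \<lhd> G" using D_subgroups[OF sA0] by (simp add: A0_def)
  have conjA0: "inv e \<otimes> x \<otimes> e \<in> A" if "x \<in> A0" "e \<in> E" for x e
    using normal.inv_op_closed1[OF nA0 cE[OF that(2)] that(1)] by (simp add: A0_def)
  have modcomm: "(a \<otimes> c) \<otimes> inv (c \<otimes> a) \<in> A0" if a: "a \<in> A" and c: "c \<in> D" for a c
  proof -
    note cc = D_carrier[OF c] and ac = cA[OF a]
    have "(a \<otimes> c) \<otimes> inv (c \<otimes> a) = (a \<otimes> c \<otimes> inv a) \<otimes> inv c" using cc ac by (simp add: inv_mult_group m_assoc)
    then have 1: "(a \<otimes> c) \<otimes> inv (c \<otimes> a) \<in> D" using D_mult[OF D_conj[OF ac c] D_inv[OF c]] by simp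
    have "(a \<otimes> c) \<otimes> inv (c \<otimes> a) = a \<otimes> (c \<otimes> inv a \<otimes> inv c)" using cc ac by (simp add: inv_mult_group m_assoc)
    then have 2: "(a \<otimes> c) \<otimes> inv (c \<otimes> a) \<in> A"
      using subgroup.m_closed[OF A a norm[OF c subgroup.m_inv_closed[OF A a]]] by simp
    show ?thesis using 1 2 by (simp add: A0_def)
  qed
  define H where "H = {a \<in> A. \<forall>e\<in>E. a \<otimes> e \<in> E <#> A}"
  have sH: "subgroup H G"
  proof (rule subgroup_of_mult_closed)
    show "H \<subseteq> carrier G" using cA by (auto simp: H_def)
    show "\<one> \<in> H"
    proof -
      have "\<one> \<otimes> e \<in> E <#> A" if "e \<in> E" for e
        using set_mult_mem[OF that subgroup.one_closed[OF A]] cE[OF that] by simp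
      then show ?thesis using subgroup.one_closed[OF A] by (simp add: H_def)
    qed
    fix x y assume x: "x \<in> H" and y: "y \<in> H"
    then have xy: "x \<in> A" "y \<in> A" by (auto simp: H_def)
    have "(x \<otimes> y) \<otimes> e \<in> E <#> A" if e: "e \<in> E" for e
    proof -
      have "y \<otimes> e \<in> E <#> A" using y e by (simp add: H_def)
      then obtain e1 a1 where 1: "e1 \<in> E" "a1 \<in> A" "y \<otimes> e = e1 \<otimes> a1" by (rule set_mult_obtain)
      have "x \<otimes> e1 \<in> E <#> A" using x 1(1) by (simp add: H_def)
      then obtain e2 a2 where 2: "e2 \<in> E" "a2 \<in> A" "x \<otimes> e1 = e2 \<otimes> a2" by (rule set_mult_obtain)
      have "(x \<otimes> y) \<otimes> e = x \<otimes> (y \<otimes> e)" using xy e cA cE by (simp add: m_assoc)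
      also have "\<dots> = (x \<otimes> e1) \<otimes> a1" unfolding 1(3) using xy 1 cA cE by (simp add: m_assoc)
      also have "\<dots> = e2 \<otimes> (a2 \<otimes> a1)" unfolding 2(3) using 1 2 cA cE by (simp add: m_assoc)
      finally show ?thesis using set_mult_mem[OF 2(1) subgroup.m_closed[OF A 2(2) 1(2)]] by simp
    qed
    then show "x \<otimes> y \<in> H" using subgroup.m_closed[OF A xy] by (simp add: H_def)
  qed
  have "A \<subseteq> H"
  proof (rule subgroup_subset_by_prime_elements[OF sH A])
    fix p a assume p: "Factorial_Ring.prime p" and a: "a \<in> A" "a \<in> pi_elements {p}"
    note ac = cA[OF a(1)]
    obtain n where n: "pi_number {p} n" "a [^] n = \<one>" using a(2) by (auto simp: pi_elements_def)
    obtain \<rho> where \<rho>: "\<rho> \<in> \<sigma>" "p \<in> \<rho>" using partition_on_class[OF part] p by blast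
    have a\<rho>: "a \<in> pi_elements \<rho>" using a(2) pi_elements_mono \<rho>(2) by blast
    have "a \<otimes> e \<in> E <#> A" if e: "e \<in> E" for e
    proof -
      note ec = cE[OF e]
      define y where "y = inv e \<otimes> a \<otimes> e"
      have yc: "y \<in> carrier G" using ac ec by (simp add: y_def)
      have ae: "a \<otimes> e = e \<otimes> y" unfolding y_def using ac ec by (simp add: m_assoc cancel_inv)
      consider "a \<in> D" | "a \<notin> D" "\<rho> \<noteq> \<pi>" | "a \<notin> D" "\<rho> = \<pi>" by blast
      then show ?thesis
      proof cases
        case 1
        then have "y \<in> A" unfolding y_def using conjA0[OF _ e] a(1) by (simp add: A0_def)
        then show ?thesis unfolding ae using set_mult_mem[OF e] by blast
      next
        case 2
        have pD: "\<not> p dvd card D" using D_hall[OF p] a(2) 2(1) by blast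
        define c where "c = inv a \<otimes> y"
        have cc: "c \<in> carrier G" using ac yc by (simp add: c_def)
        have yac: "y = a \<otimes> c" unfolding c_def using ac yc by (simp add: cancel_inv)
        have aR: "a \<in> R \<rho>" using R_pi[OF \<rho>(1)] a\<rho> by blast
        have eR: "e \<in> R \<pi>" using R_pi[OF \<pi>] E\<pi> e by blast
        have "y \<in> R \<rho>" unfolding y_def using normal.inv_op_closed1[OF R_normal[OF \<rho>(1)] ec aR] .
        then have c1: "c \<in> R \<rho>" unfolding c_def
          using subgroup.m_closed[OF R_subgroup[OF \<rho>(1)] subgroup.m_inv_closed[OF R_subgroup[OF \<rho>(1)] aR]] by blast
        have "inv a \<otimes> inv e \<otimes> a \<in> R \<pi>"
          using normal.inv_op_closed1[OF R_normal[OF \<pi>] ac subgroup.m_inv_closed[OF R_subgroup[OF \<pi>] eR]] .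
        moreover have "c = (inv a \<otimes> inv e \<otimes> a) \<otimes> e" unfolding c_def y_def using ac ec by (simp add: m_assoc)
        ultimately have c2: "c \<in> R \<pi>" using subgroup.m_closed[OF R_subgroup[OF \<pi>] _ eR] by simp
        have "R \<rho> \<inter> R \<pi> \<subseteq> D"
        proof (rule subgroup_subset_by_prime_elements[OF D_subgroup subgroups_Inter_pair[OF R_subgroup[OF \<rho>(1)] R_subgroup[OF \<pi>]]])
          fix q x assume q: "Factorial_Ring.prime q" and x: "x \<in> R \<rho> \<inter> R \<pi>" "x \<in> pi_elements {q}"
          have "q \<notin> \<rho> \<or> q \<notin> \<pi>" using partition_on_eq[OF part \<rho>(1) \<pi>] 2(2) by blast
          then show "x \<in> D" using R_other[OF \<rho>(1) q _ _ x(2)] R_other[OF \<pi> q _ _ x(2)] x(1) by blast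
        qed
        then have cD: "c \<in> D" using c1 c2 by blast
        have "y [^] n = inv e \<otimes> a [^] n \<otimes> inv (inv e)"
          unfolding y_def using conj_pow[of "inv e" a n] ac ec by simp
        then have "(a \<otimes> c) [^] n = \<one>" unfolding yac[symmetric] n(2) using ec by simp
        then have "c [^] n \<in> A0" using pow_mem_of_commuting_mod[OF nA0 ac cc modcomm[OF a(1) cD] n(2)] by blast
        then have "c \<in> A0" using mem_of_coprime_pow[OF sA0 D_coprime_element[OF p pD cD] _ n(1)] by blast
        then have "y \<in> A" unfolding yac using subgroup.m_closed[OF A a(1)] by (simp add: A0_def)
        then show ?thesis unfolding ae using set_mult_mem[OF e] by blast
      next
        case 3
        define D' where "D' = D \<inter> pi_elements (- \<pi>)"
        have sD': "subgroup D' G"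
          unfolding D'_def using pi_core_of_abelian_subgroup(2)[OF D_subgroup D_abelian] by blast
        have nD': "D' \<lhd> G" using D_subgroups[OF sD'] by (simp add: D'_def)
        have "D' <#> E = R \<pi>"
        proof (rule normal_hall_supplement[OF E R_subgroup[OF \<pi>] _ nD'])
          show "E \<subseteq> R \<pi>" using E\<pi> R_pi[OF \<pi>] by blast
          show "D' \<subseteq> R \<pi>" using D_R[OF \<pi>] by (auto simp: D'_def)
          fix q x assume "Factorial_Ring.prime q" "q \<notin> \<pi>" "x \<in> R \<pi>" "x \<in> pi_elements {q}"
          then show "x \<in> D'" using R_other[OF \<pi>] pi_elements_mono[of x "{q}" "- \<pi>"] by (simp add: D'_def)
        qed
        then have "E <#> D' = R \<pi>" using commut_normal[OF sE(1) nD'] by simp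
        then have "a \<in> E <#> D'" using R_pi[OF \<pi>] a\<rho> 3(2) by blast
        then obtain e0 d where ed: "e0 \<in> E" "d \<in> D'" "a = e0 \<otimes> d" by (rule set_mult_obtain)
        have dD: "d \<in> D" "d \<in> pi_elements (- \<pi>)" using ed(2) by (auto simp: D'_def)
        note e0c = cE[OF ed(1)] and dc = D_carrier[OF dD(1)]
        have e0: "e0 = a \<otimes> inv d" unfolding ed(3) using e0c dc by (simp add: m_assoc)
        obtain n2 where n2: "pi_number \<pi> n2" "e0 [^] n2 = \<one>" using E\<pi> ed(1) by (auto simp: pi_elements_def)
        obtain n1 where n1: "pi_number \<pi> n1" "a [^] n1 = \<one>" using a\<rho> 3(2) by (auto simp: pi_elements_def)
        have "a [^] (n1 * n2) = (a [^] n1) [^] n2" using ac by (simp add: nat_pow_pow)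
        then have p1: "a [^] (n1 * n2) = \<one>" using n1 by simp
        have "e0 [^] (n1 * n2) = (e0 [^] n2) [^] n1" using e0c by (simp add: nat_pow_pow mult.commute)
        then have p2: "(a \<otimes> inv d) [^] (n1 * n2) = \<one>" using n2 unfolding e0[symmetric] by simp
        have "inv d [^] (n1 * n2) \<in> A0"
          using pow_mem_of_commuting_mod[OF nA0 ac inv_closed[OF dc] modcomm[OF a(1) D_inv[OF dD(1)]] p1 p2] .
        then have "inv d \<in> A0"
          using mem_of_coprime_pow[OF sA0 pi_elements_inv[OF dD(2)] _ pi_number_mult[OF n1(1) n2(1)]] by blast
        then have "d \<in> A0" using subgroup.m_inv_closed[OF sA0, of "inv d"] dc by simp
        then have "inv e \<otimes> d \<otimes> e \<in> A" using conjA0[OF _ e] by blast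
        moreover have "a \<otimes> e = (e0 \<otimes> e) \<otimes> (inv e \<otimes> d \<otimes> e)"
          unfolding ed(3) using e0c dc ec by (simp add: m_assoc cancel_inv)
        ultimately show ?thesis using set_mult_mem[OF subgroup.m_closed[OF sE(1) ed(1) e]] by simp
      qed
    qed
    then show "a \<in> H" using a(1) by (simp add: H_def)
  qed
  then have "A <#> E \<subseteq> E <#> A" unfolding H_def by (auto elim!: set_mult_obtain)
  then show "A <#> E = E <#> A" using set_mult_commute_of_subset[OF A sE(1)] by blast
qed

text \<open>With \<open>K\<close> \<open>\<sigma>\<close>-permutable in \<open>H\<close> and \<open>H\<close> in \<open>G\<close>, the group \<open>D\<close> normalises \<open>H\<close> and \<open>D \<inter> H\<close>
normalises \<open>K\<close>. For a \<open>p\<close>-element \<open>k\<close> of \<open>K\<close> and \<open>d \<in> D\<close> the commutator \<open>c\<close> lies in \<open>D \<inter> H\<close>, so it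
commutes with \<open>k\<close> modulo \<open>K \<inter> D\<close>. Unless \<open>k \<in> D\<close>, the order of \<open>c\<close> is prime to \<open>p\<close>, and comparing it
with the orders of \<open>k\<close> and \<open>k c\<close> gives \<open>c \<in> K\<close>.\<close>
theorem psigmat: "PsigmaT_group \<sigma> G"
  unfolding PsigmaT_group_def
proof (intro allI impI, elim conjE)
  fix H K
  assume K: "sigma_permutable \<sigma> (G\<lparr>carrier := H\<rparr>) K" and H: "sigma_permutable \<sigma> G H"
  have sH: "subgroup H G" using H by (simp add: sigma_permutable_def)
  have sK': "subgroup K (G\<lparr>carrier := H\<rparr>)" using K by (simp add: sigma_permutable_def)
  have sK: "subgroup K G" "K \<subseteq> H" using incl_subgroup[OF sH sK'] subgroup.subset[OF sK'] by auto
  have cK: "x \<in> carrier G" if "x \<in> K" for x using subgroup.mem_carrier[OF sK(1) that] .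
  have DH: "d \<otimes> h \<otimes> inv d \<in> H" if "d \<in> D" "h \<in> H" for d h
    using sigma_permutable_normalised[OF subgroup_self, of H d h] H that D_carrier by simp
  have DHK: "d \<otimes> k \<otimes> inv d \<in> K" if "d \<in> D" "d \<in> H" "k \<in> K" for d k
    using sigma_permutable_normalised[OF sH K that] .
  define K0 where "K0 = K \<inter> D"
  have sK0: "subgroup K0 G" unfolding K0_def using subgroups_Inter_pair[OF sK(1) D_subgroup] .
  have nK0: "K0 \<lhd> G" using D_subgroups[OF sK0] by (simp add: K0_def)
  define N where "N = {k \<in> K. \<forall>d\<in>D. d \<otimes> k \<otimes> inv d \<in> K}"
  have sN: "subgroup N G"
  proof (rule subgroup_of_mult_closed)
    show "N \<subseteq> carrier G" using cK by (auto simp: N_def)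
    show "\<one> \<in> N" using subgroup.one_closed[OF sK(1)] D_carrier by (simp add: N_def)
    fix x y assume "x \<in> N" "y \<in> N"
    then show "x \<otimes> y \<in> N"
      using conj_mult[OF D_carrier cK cK] subgroup.m_closed[OF sK(1)] by (simp add: N_def)
  qed
  have "K \<subseteq> N"
  proof (rule subgroup_subset_by_prime_elements[OF sN sK(1)])
    fix p k assume p: "Factorial_Ring.prime p" and k: "k \<in> K" "k \<in> pi_elements {p}"
    note kc = cK[OF k(1)]
    obtain n where n: "pi_number {p} n" "k [^] n = \<one>" using k(2) by (auto simp: pi_elements_def)
    have "d \<otimes> k \<otimes> inv d \<in> K" if d: "d \<in> D" for d
    proof (cases "k \<in> D")
      case True
      then have "d \<otimes> k \<otimes> inv d = k" using conj_eq_iff_commute[OF D_carrier[OF d] kc] D_abelian[OF d True] by simp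
      then show ?thesis using k by simp
    next
      case False
      note dc = D_carrier[OF d]
      have pD: "\<not> p dvd card D" using D_hall[OF p] k(2) False by blast
      define c where "c = inv k \<otimes> (d \<otimes> k \<otimes> inv d)"
      have cc: "c \<in> carrier G" using kc dc by (simp add: c_def)
      have kceq: "k \<otimes> c = d \<otimes> k \<otimes> inv d" unfolding c_def using kc dc by (simp add: cancel_inv)
      have "c = (inv k \<otimes> d \<otimes> k) \<otimes> inv d" unfolding c_def using kc dc by (simp add: m_assoc)
      then have cD: "c \<in> D"
        using D_mult[OF normal.inv_op_closed1[OF D_normal kc d] D_inv[OF d]] by simp
      have kH: "k \<in> H" using k(1) sK(2) by blast
      have cH: "c \<in> H" unfolding c_def
        using subgroup.m_closed[OF sH subgroup.m_inv_closed[OF sH kH] DH[OF d kH]] .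
      have "(k \<otimes> c) \<otimes> inv (c \<otimes> k) = (k \<otimes> c \<otimes> inv k) \<otimes> inv c" using kc cc by (simp add: inv_mult_group m_assoc)
      then have 1: "(k \<otimes> c) \<otimes> inv (c \<otimes> k) \<in> D" using D_mult[OF D_conj[OF kc cD] D_inv[OF cD]] by simp
      have "(k \<otimes> c) \<otimes> inv (c \<otimes> k) = k \<otimes> (c \<otimes> inv k \<otimes> inv c)" using kc cc by (simp add: inv_mult_group m_assoc)
      then have 2: "(k \<otimes> c) \<otimes> inv (c \<otimes> k) \<in> K"
        using subgroup.m_closed[OF sK(1) k(1) DHK[OF cD cH subgroup.m_inv_closed[OF sK(1) k(1)]]] by simp
      have mc: "(k \<otimes> c) \<otimes> inv (c \<otimes> k) \<in> K0" using 1 2 by (simp add: K0_def)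
      have "(k \<otimes> c) [^] n = \<one>" unfolding kceq using conj_pow[OF dc kc, of n] n(2) dc by simp
      then have "c [^] n \<in> K0" using pow_mem_of_commuting_mod[OF nK0 kc cc mc n(2)] by blast
      then have "c \<in> K0" using mem_of_coprime_pow[OF sK0 D_coprime_element[OF p pD cD] _ n(1)] by blast
      then show ?thesis unfolding kceq[symmetric] using subgroup.m_closed[OF sK(1) k(1)] by (simp add: K0_def)
    qed
    then show "k \<in> N" using k(1) by (simp add: N_def)
  qed
  then have "d \<otimes> k \<otimes> inv d \<in> K" if "d \<in> D" "k \<in> K" for d k using that unfolding N_def by blast
  moreover obtain \<H> where "complete_hall_sigma_set \<sigma> G \<H>" using H by (auto simp: sigma_permutable_def)
  ultimately show "sigma_permutable \<sigma> G K" using normalised_imp_sigma_permutable[OF sK(1)] by blast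
qed

end

section \<open>The characterisation\<close>

text \<open>The normal Hall \<open>\<rho>'\<close>-subgroup \<open>K \<rho>\<close> of \<open>M\<close> gives the preimage \<open>N \<rho> = D K \<rho>\<close> of the Hall \<open>\<rho>'\<close>-subgroup of
\<open>G/D\<close>; the intersection of these over all \<open>\<rho> \<noteq> \<pi>\<close> is \<open>R \<pi>\<close>. If \<open>H\<close> is the Hall
\<open>\<pi>\<close>-subgroup of the second condition, then \<open>R \<pi> = D H\<close>, and \<open>H\<close> centralises the \<open>\<pi>\<close>-part of \<open>D\<close>,
which is abelian and a direct factor of \<open>H\<close>.\<close>
lemma (in finite_group) conditions_power_normal_hall:
  assumes part: "partition_on {p. Factorial_Ring.prime p} \<sigma>"
    and i: "condition_i \<sigma> G D M" and ii: "condition_ii \<sigma> G D"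
  shows "\<exists>R. power_normal_hall G \<sigma> D R"
proof -
  have nD: "D \<lhd> G" and sM: "subgroup M G" and DM: "D <#> M = carrier G" "D \<inter> M = {\<one>}"
    and hallD: "hall_subgroup G D" and comm: "comm_group (G\<lparr>carrier := D\<rparr>)"
    and snil: "sigma_nilpotent \<sigma> (G\<lparr>carrier := M\<rparr>)"
    and pow: "\<forall>g\<in>carrier G. power_automorphism (G\<lparr>carrier := D\<rparr>) (\<lambda>x\<in>D. inv g \<otimes> x \<otimes> g)"
    using i by (auto simp: condition_i_def inner_semidirect_def complement_in_def)
  have sD: "subgroup D G" using nD by (rule normal_imp_subgroup)
  have cD: "x \<in> carrier G" if "x \<in> D" for x using subgroup.mem_carrier[OF sD that] .
  have D_abelian: "x \<otimes> y = y \<otimes> x" if "x \<in> D" "y \<in> D" for x y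
  proof -
    interpret D: comm_group "G\<lparr>carrier := D\<rparr>" by (rule comm)
    show ?thesis using D.m_comm that by simp
  qed
  have D_hall: "pi_elements {p} \<subseteq> D" if p: "Factorial_Ring.prime p" "p dvd card D" for p
  proof -
    have "coprime (card D) (order G div card D)"
      using hallD card_rcosets_subgroup[OF sD] by (simp add: hall_subgroup_def)
    then have "\<not> p dvd order G div card D" using p coprime_common_divisor not_prime_unit by blast
    moreover have "order G div card D > 0"
      using card_div_subgroup_pos[OF sD subgroup_self subgroup.subset[OF sD]] by (simp add: order_def)
    ultimately have "pi_number (- {p}) (order G div card D)" using pi_number_not_dvd p(1) by blast
    then show ?thesis using pi_elements_subset_normal[OF nD, of "- {p}" "{p}"] by blast
  qed
  have D_subgroups: "K \<lhd> G" if "subgroup K G" "K \<subseteq> D" for K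
    using pow that unfolding power_automorphism_conj_iff[OF nD] by blast
  interpret M: finite_group "G\<lparr>carrier := M\<rparr>" using subgroup_finite_group[OF sM] .
  have "\<forall>\<rho>\<in>\<sigma>. \<exists>K. K \<lhd> G\<lparr>carrier := M\<rparr> \<and> M.pi_elements (- \<rho>) \<subseteq> K \<and> K \<inter> M.pi_elements \<rho> = {\<one>}"
    using snil unfolding M.sigma_nilpotent_iff[OF part] by simp
  then obtain K where K: "\<And>\<rho>. \<rho> \<in> \<sigma> \<Longrightarrow> K \<rho> \<lhd> G\<lparr>carrier := M\<rparr>"
      "\<And>\<rho>. \<rho> \<in> \<sigma> \<Longrightarrow> M.pi_elements (- \<rho>) \<subseteq> K \<rho>" "\<And>\<rho>. \<rho> \<in> \<sigma> \<Longrightarrow> K \<rho> \<inter> M.pi_elements \<rho> = {\<one>}"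
    by metis
  define N where "N \<rho> = D <#> K \<rho>" for \<rho>
  have N: "N \<rho> \<lhd> G" "D \<subseteq> N \<rho>" "pi_elements (- \<rho>) \<subseteq> N \<rho>" "N \<rho> \<inter> pi_elements \<rho> \<subseteq> D" if \<rho>: "\<rho> \<in> \<sigma>" for \<rho>
  proof -
    have sK': "subgroup (K \<rho>) (G\<lparr>carrier := M\<rparr>)" using K(1)[OF \<rho>] by (rule normal_imp_subgroup)
    have sK: "subgroup (K \<rho>) G" "K \<rho> \<subseteq> M" using incl_subgroup[OF sM sK'] subgroup.subset[OF sK'] by auto
    note DK = set_mult_normal_subgroup[OF nD sK(1), folded N_def]
    show "D \<subseteq> N \<rho>" by (rule DK(2))
    have "carrier G \<subseteq> normaliser (N \<rho>)"
    proof
      fix g assume "g \<in> carrier G"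
      then have "g \<in> D <#> M" using DM by simp
      then obtain d m where dm: "d \<in> D" "m \<in> M" "g = d \<otimes> m" by (rule set_mult_obtain)
      have sNN: "subgroup (normaliser (N \<rho>)) G" using normaliser_subgroup subgroup.subset[OF DK(1)] by blast
      have d: "d \<in> normaliser (N \<rho>)" using subgroup_subset_normaliser[OF DK(1)] DK(2) dm(1) by blast
      have mc: "m \<in> carrier G" using subgroup.mem_carrier[OF sM dm(2)] .
      have "m \<otimes> x \<otimes> inv m \<in> N \<rho>" if x: "x \<in> N \<rho>" for x
      proof -
        obtain e k where ek: "e \<in> D" "k \<in> K \<rho>" "x = e \<otimes> k" using x unfolding N_def by (rule set_mult_obtain)
        have kc: "k \<in> carrier G" using subgroup.mem_carrier[OF sK(1) ek(2)] .
        have "m \<otimes> k \<otimes> inv m \<in> K \<rho>"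
          using M.normal_invE(2)[OF K(1)[OF \<rho>], of m k] dm(2) ek(2) m_inv_consistent[OF sM dm(2)] by simp
        then show ?thesis
          unfolding ek(3) N_def conj_mult[OF mc cD[OF ek(1)] kc]
          using set_mult_mem[OF normal_invE(2)[OF nD mc ek(1)]] by blast
      qed
      then have "m \<in> normaliser (N \<rho>)" using mc by (simp add: normaliser_def)
      then show "g \<in> normaliser (N \<rho>)" unfolding dm(3) using subgroup.m_closed[OF sNN d] by blast
    qed
    then show nN: "N \<rho> \<lhd> G" using normal_iff_normaliser[OF DK(1)] by simp
    have DiK: "D \<inter> K \<rho> = {\<one>}"
      using DM(2) sK(2) subgroup.one_closed[OF sD] subgroup.one_closed[OF sK(1)] by blast
    have cN: "card (N \<rho>) = card D * card (K \<rho>)"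
      unfolding N_def using card_set_mult[OF sD sK(1)] DiK by simp
    have cG: "order G = card D * card M" using card_set_mult[OF sD sM] DM by (simp add: order_def)
    have "pi_number \<rho> (card M div card (K \<rho>))"
    proof (rule pi_index[OF sK(1) sM sK(2)])
      fix p x assume "p \<notin> \<rho>" "x \<in> M" "x \<in> pi_elements {p}"
      then have "x \<in> M.pi_elements (- \<rho>)"
        unfolding pi_elements_restrict[OF sM] using pi_elements_mono[of x "{p}" "- \<rho>"] by blast
      then show "x \<in> K \<rho>" using K(2)[OF \<rho>] by blast
    qed
    then have "pi_number \<rho> (order G div card (N \<rho>))"
      unfolding cN cG using card_subgroup_pos[OF sD] by simp
    then show "pi_elements (- \<rho>) \<subseteq> N \<rho>" using pi_elements_subset_normal[OF nN, of \<rho> "- \<rho>"] by blast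
    have "pi_number (- \<rho>) (card (K \<rho>))"
    proof (rule pi_numberI)
      fix p assume p: "Factorial_Ring.prime p" "p dvd card (K \<rho>)"
      then obtain x where x: "x \<in> K \<rho>" "x \<in> pi_elements {p}" "x \<noteq> \<one>" using cauchy[OF p(1) sK(1)] by blast
      have "x \<notin> M.pi_elements \<rho>" using K(3)[OF \<rho>] x(1,3) by blast
      then have "p \<notin> \<rho>"
        using pi_elements_mono[OF x(2), of \<rho>] x(1) sK(2) unfolding pi_elements_restrict[OF sM] by blast
      then show "p \<in> - \<rho>" by simp
    qed (rule card_subgroup_pos[OF sK(1)])
    then have idx: "pi_number (- \<rho>) (card (N \<rho>) div card D)" unfolding cN using card_subgroup_pos[OF sD] by simp
    interpret N: finite_group "G\<lparr>carrier := N \<rho>\<rparr>" using subgroup_finite_group[OF DK(1)] .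
    have "N.pi_elements \<rho> \<subseteq> D"
      using N.pi_elements_subset_normal[OF normal_restrict_supergroup[OF DK(1) nD DK(2)], of "- \<rho>" \<rho>] idx
      by (simp add: order_def)
    then show "N \<rho> \<inter> pi_elements \<rho> \<subseteq> D" unfolding pi_elements_restrict[OF DK(1)] by blast
  qed
  define R where "R \<pi> = \<Inter>(insert (carrier G) (N ` (\<sigma> - {\<pi>})))" for \<pi>
  have R_normal: "R \<pi> \<lhd> G" for \<pi>
    unfolding R_def using N(1) carrier_normal by (intro normal_Inter) auto
  have D_R: "D \<subseteq> R \<pi>" for \<pi> using N(2) cD by (auto simp: R_def)
  have R_pi: "pi_elements \<pi> \<subseteq> R \<pi>" if \<pi>: "\<pi> \<in> \<sigma>" for \<pi>
  proof
    fix x assume x: "x \<in> pi_elements \<pi>"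
    have "x \<in> N \<rho>" if "\<rho> \<in> \<sigma>" "\<rho> \<noteq> \<pi>" for \<rho>
      using pi_elements_mono[OF x partition_on_compl[OF part that(1) \<pi> that(2)]] N(3)[OF that(1)] by blast
    then show "x \<in> R \<pi>" using pi_elements_carrier[OF x] by (auto simp: R_def)
  qed
  have R_other: "x \<in> D"
    if \<pi>: "\<pi> \<in> \<sigma>" and p: "Factorial_Ring.prime p" "p \<notin> \<pi>" and x: "x \<in> R \<pi>" "x \<in> pi_elements {p}" for \<pi> p x
  proof -
    obtain \<rho> where \<rho>: "\<rho> \<in> \<sigma>" "p \<in> \<rho>" using partition_on_class[OF part] p(1) by blast
    then have "x \<in> N \<rho>" using x(1) p(2) by (auto simp: R_def)
    moreover have "x \<in> pi_elements \<rho>" using x(2) pi_elements_mono \<rho>(2) by blast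
    ultimately show ?thesis using N(4)[OF \<rho>(1)] by blast
  qed
  have R_central: "g \<otimes> d = d \<otimes> g" if \<pi>: "\<pi> \<in> \<sigma>" and g: "g \<in> R \<pi>" and d: "d \<in> D" "d \<in> pi_elements \<pi>" for \<pi> g d
  proof -
    obtain H L where H: "hall_pi_subgroup \<pi> G H" and L: "L \<lhd> G\<lparr>carrier := H\<rparr>"
      and compl: "complement_in (G\<lparr>carrier := H\<rparr>) (pi_core \<pi> (G\<lparr>carrier := D\<rparr>)) L"
      using ii \<pi> unfolding condition_ii_def by blast
    have sH: "subgroup H G" "pi_number \<pi> (card H)" using H by (auto simp: hall_pi_subgroup_iff)
    have H\<pi>: "H \<subseteq> pi_elements \<pi>" using subgroup_pi_elements[OF sH] .
    interpret H: finite_group "G\<lparr>carrier := H\<rparr>" using subgroup_finite_group[OF sH(1)] .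
    define B where "B = D \<inter> pi_elements \<pi>"
    have B: "pi_core \<pi> (G\<lparr>carrier := D\<rparr>) = B" "subgroup B G"
      unfolding B_def using pi_core_of_abelian_subgroup[OF sD D_abelian] by auto
    have BL: "B <#> L = H" "B \<inter> L = {\<one>}" "subgroup B (G\<lparr>carrier := H\<rparr>)"
      using compl unfolding B(1) by (auto simp: complement_in_def)
    have BH: "B \<subseteq> H" using subgroup.subset[OF BL(3)] by simp
    have nB: "B \<lhd> G\<lparr>carrier := H\<rparr>"
      using normal_restrict_supergroup[OF sH(1) D_subgroups[OF B(2)] BH] by (simp add: B_def)
    have sL: "subgroup L (G\<lparr>carrier := H\<rparr>)" using L by (rule normal_imp_subgroup)
    have cL: "x \<in> carrier G" if "x \<in> L" for x
      using subgroup.subset[OF sL] subgroup.subset[OF sH(1)] that by auto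
    have "D <#> H = R \<pi>"
    proof (rule normal_hall_supplement[OF H _ _ nD D_R])
      show "subgroup (R \<pi>) G" using R_normal by (rule normal_imp_subgroup)
      show "H \<subseteq> R \<pi>" using H\<pi> R_pi[OF \<pi>] by blast
    qed (use R_other[OF \<pi>] in blast)
    then have "g \<in> D <#> H" using g by simp
    then obtain e h where eh: "e \<in> D" "h \<in> H" "g = e \<otimes> h" by (rule set_mult_obtain)
    have "h \<in> B <#> L" using eh(2) BL(1) by simp
    then obtain b l where bl: "b \<in> B" "l \<in> L" "h = b \<otimes> l" by (rule set_mult_obtain)
    have bD: "b \<in> D" using bl(1) by (simp add: B_def)
    have "d \<in> B" using d by (simp add: B_def)
    then have "d \<otimes> l = l \<otimes> d"
      using H.normal_imp_commuting[OF nB L, of d l] BL(2) bl(2) by simp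
    then have "(b \<otimes> l) \<otimes> d = d \<otimes> (b \<otimes> l)"
      using commute_mult[OF cD[OF bD] cL[OF bl(2)] cD[OF d(1)] D_abelian[OF bD d(1)]] by simp
    then show ?thesis
      unfolding eh(3) bl(3)
      using commute_mult[OF cD[OF eh(1)] m_closed[OF cD[OF bD] cL[OF bl(2)]] cD[OF d(1)] D_abelian[OF eh(1) d(1)]]
      by simp
  qed
  have "power_normal_hall G \<sigma> D R"
  proof (intro power_normal_hall.intro power_normal_hall_axioms.intro finite_group_axioms part nD)
    show "\<And>\<pi> p x. \<pi> \<in> \<sigma> \<Longrightarrow> Factorial_Ring.prime p \<Longrightarrow> p \<notin> \<pi> \<Longrightarrow> x \<in> R \<pi> \<Longrightarrow> x \<in> pi_elements {p} \<Longrightarrow> x \<in> D"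
      by (rule R_other)
    show "\<And>\<pi> g d. \<pi> \<in> \<sigma> \<Longrightarrow> g \<in> R \<pi> \<Longrightarrow> d \<in> D \<Longrightarrow> d \<in> pi_elements \<pi> \<Longrightarrow> g \<otimes> d = d \<otimes> g"
      by (rule R_central)
  qed (use D_abelian D_hall D_subgroups R_normal R_pi D_R in blast)+
  then show ?thesis by blast
qed

theorem theoremA:
  fixes G :: "('a, 'b) monoid_scheme" and \<sigma> :: "nat set set"
  assumes "group G" and "finite (carrier G)"
    and "partition_on {p. Factorial_Ring.prime p} \<sigma>"
  shows "(sigma_soluble \<sigma> G \<and> PsigmaT_group \<sigma> G \<longrightarrow>
            (\<exists>M. subgroup M G \<and> condition_i \<sigma> G (sigma_nilpotent_residual \<sigma> G) M \<and>
                 condition_ii \<sigma> G (sigma_nilpotent_residual \<sigma> G))) \<and>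
         ((\<exists>D M. subgroup D G \<and> subgroup M G \<and> condition_i \<sigma> G D M \<and> condition_ii \<sigma> G D) \<longrightarrow>
            PsigmaT_group \<sigma> G)"
proof (intro conjI impI; (elim exE conjE)?)
  interpret finite_group G using assms(1,2) by (intro finite_group.intro finite_group_axioms.intro)
  assume "sigma_soluble \<sigma> G" "PsigmaT_group \<sigma> G"
  then interpret soluble_psigmat G \<sigma>
    using assms(3) finite_group_axioms by (intro soluble_psigmat.intro soluble_psigmat_axioms.intro)
  show "\<exists>M. subgroup M G \<and> condition_i \<sigma> G (sigma_nilpotent_residual \<sigma> G) M \<and>
      condition_ii \<sigma> G (sigma_nilpotent_residual \<sigma> G)"
    unfolding sigma_nilpotent_residual_eq[OF assms(3)] by (rule residual_conditions)
next
  fix D M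
  interpret finite_group G using assms(1,2) by (intro finite_group.intro finite_group_axioms.intro)
  assume "condition_i \<sigma> G D M" "condition_ii \<sigma> G D"
  then obtain R where "power_normal_hall G \<sigma> D R" using conditions_power_normal_hall[OF assms(3)] by blast
  then show "PsigmaT_group \<sigma> G" by (rule power_normal_hall.psigmat)
qed

end
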